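(* Let $n\ge 3$, $\gamma_0,\dots,\gamma_n\in\{1,-1\}$, and $x\in\mathcal E'_{n-1}$. Call $(a,b)$ with $a,b\in\pm\mathcal E'_{n-1}$ an $x$-pair if $ab=n(b)x$ (so that $a,b,x$ are linearly independent). The subgraphs $C(x)$ and $C(\tilde x)$ of $\Gamma_e(\mathcal A_{n+1})$ have exactly the following vertices and edges, where in each case $\chi$ denotes the characteristic of the subgraph in question. (1) $C(x)$ with $\chi=-1$. The vertices are $(\tilde x,\pm\tilde e_0)$, $(\tilde e_0,\pm\gamma_n\tilde x)$ and, for all $x$-pairs $(a,b)$, $(a,\pm b)$, $(b,\pm\gamma_n a)$, $(\tilde a,\pm\tilde b)$, $(\tilde b,\pm\gamma_n\tilde a)$. For every $x$-pair $(a,b)$ the following six two-element sets, taken in this cyclic order, form a double hexagon (every vertex of a set is adjacent to every vertex of the cyclically next set, and there are no other edges among these twelve vertices): $\{(\tilde x,\tilde e_0),(\tilde e_0,\gamma_n\tilde x)\}$, $\{(a,b),(b,\gamma_n a)\}$, $\{(\tilde a,\tilde b),(\tilde b,\gamma_n\tilde a)\}$, $\{(\tilde x,-\tilde e_0),(\tilde e_0,-\gamma_n\tilde x)\}$, $\{(a,-b),(b,-\gamma_n a)\}$, $\{(\tilde a,-\tilde b),(\tilde b,-\gamma_n\tilde a)\}$. (2) $C(x)$ with $\chi=1$. The vertices are $(x,\pm e_0)$ together with all elements listed as vertices in (1). For every $x$-pair $(a,b)$ there are the hexagons $(x,e_0)-(a,b)-(b,\gamma_n a)-(x,-e_0)-(a,-b)-(b,-\gamma_n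 a)-(x,e_0)$ and $(x,-e_0)-(\tilde a,\tilde b)-(\tilde b,\gamma_n\tilde a)-(x,e_0)-(\tilde a,-\tilde b)-(\tilde b,-\gamma_n\tilde a)-(x,-e_0)$, with no other edges between the vertices of these two hexagons. There is also the hexagon $(x,-e_0)-(\tilde x,\tilde e_0)-(\tilde e_0,\gamma_n\tilde x)-(x,e_0)-(\tilde x,-\tilde e_0)-(\tilde e_0,-\gamma_n\tilde x)-(x,-e_0)$, and the vertices $(\tilde x,\pm\tilde e_0)$, $(\tilde e_0,\pm\gamma_n\tilde x)$ have no further neighbours. (3) $C(\tilde x)$ with $\chi=-1$. The vertices are $(x,\pm\tilde e_0)$, $(\tilde e_0,\pm\gamma_n x)$ and, for all $x$-pairs $(a,b)$, $(a,\pm\tilde b)$, $(\tilde b,\pm\gamma_n a)$, $(\tilde a,\pm\gamma_{n-1}b)$, $(b,\pm\gamma_{n-1}\gamma_n\tilde a)$. For every $x$-pair $(a,b)$ the following six sets, in this cyclic order, form a double hexagon (in the same sense as in (1)): $\{(x,\tilde e_0),(\tilde e_0,\gamma_n x)\}$, $\{(a,\tilde b),(\tilde b,\gamma_n a)\}$, $\{(\tilde a,\gamma_{n-1}b),(b,\gamma_{n-1}\gamma_n\tilde a)\}$, $\{(x,-\tilde e_0),(\tilde e_0,-\gamma_n x)\}$, $\{(a,-\tilde b),(\tilde b,-\gamma_n a)\}$, $\{(\tilde a,-\gamma_{n-1}b),(b,-\gamma_{n-1}\gamma_n\tilde a)\}$. (4) $C(\tilde x)$ with $\chi=1$. The vertices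 are $(\gamma_{n-1}\tilde x,\pm e_0)$ together with all elements listed as vertices in (3). For every $x$-pair $(a,b)$ there are the hexagons $(\gamma_{n-1}\tilde x,e_0)-(a,\tilde b)-(\tilde b,\gamma_n a)-(\gamma_{n-1}\tilde x,-e_0)-(a,-\tilde b)-(\tilde b,-\gamma_n a)-(\gamma_{n-1}\tilde x,e_0)$ and $(\gamma_{n-1}\tilde x,-e_0)-(\tilde a,\gamma_{n-1}b)-(b,\gamma_{n-1}\gamma_n\tilde a)-(\gamma_{n-1}\tilde x,e_0)-(\tilde a,-\gamma_{n-1}b)-(b,-\gamma_{n-1}\gamma_n\tilde a)-(\gamma_{n-1}\tilde x,-e_0)$, with no other edges between the vertices of these two hexagons. There is also the hexagon $(\gamma_{n-1}\tilde x,-e_0)-(x,\tilde e_0)-(\tilde e_0,\gamma_n x)-(\gamma_{n-1}\tilde x,e_0)-(x,-\tilde e_0)-(\tilde e_0,-\gamma_n x)-(\gamma_{n-1}\tilde x,-e_0)$, and the vertices $(x,\pm\tilde e_0)$, $(\tilde e_0,\pm\gamma_n x)$ have no further neighbours. Remaining edges. Let $a,b,c,d\in\pm\mathcal E'_{n-1}$ with $ab=\pm x$, $cd=\pm x$ and $a,b,c,d,x$ linearly independent. In $C(x)$ (cases (1) and (2)), if $(a,b)$ and $(c,d)$ are orthogonal in $\mathcal A_n^{\circ}$, then every vertex of $\{(a,b),(b,\gamma_n a),(\tilde a,\tilde b),(\tilde b,\gamma_n\tilde a)\}$ is adjacent to every vertex of $\{(c,d),(d,\gamma_n c),(\tilde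 c,\tilde d),(\tilde d,\gamma_n\tilde c)\}$; otherwise there are no edges between these two sets. In $C(\tilde x)$ (cases (3) and (4)), if $(a,b)$ and $(c,d)$ are orthogonal in $\mathcal A_n^{\bullet}$, then every vertex of $\{(a,\tilde b),(\tilde b,\gamma_n a),(\tilde a,\gamma_{n-1}b),(b,\gamma_{n-1}\gamma_n\tilde a)\}$ is adjacent to every vertex of $\{(c,\tilde d),(\tilde d,\gamma_n c),(\tilde c,\gamma_{n-1}d),(d,\gamma_{n-1}\gamma_n\tilde c)\}$; otherwise there are no edges between these two sets. There are no edges other than those described.
   Context: Cayley–Dickson algebras: $\mathcal A_0=\mathbb R$ with trivial conjugation and basis element $e^{(0)}_0=1$. For $\gamma_k\in\{1,-1\}$, $\mathcal A_{k+1}=\mathcal A_k\{\gamma_k\}$ consists of pairs $(a,b)$ of elements of $\mathcal A_k$ with componentwise linear operations, product $(a,b)(c,d)=(ac+\gamma_k\bar d b,\ da+b\bar c)$ and conjugation $\overline{(a,b)}=(\bar a,-b)$. Write $\mathcal A_n=\mathcal A_n\{\gamma_0,\dots,\gamma_{n-1}\}$ and $\mathcal A_{n+1}=\mathcal A_{n+1}\{\gamma_0,\dots,\gamma_n\}$. The standard basis of $\mathcal A_{k+1}$ is $e^{(k+1)}_j=(e^{(k)}_j,0)$ for $0\le j<2^k$ and $e^{(k+1)}_j=(0,e^{(k)}_{j-2^k})$ for $2^k\le j<2^{k+1}$. $\mathcal E_n$ is the standard basis of $\mathcal A_n$, $e_0$ is the unit, $\mathcal E'_n=\mathcal E_n\setminus\{e_0\}$.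 The norm is $n(a)=a\bar a=\bar a a\in\mathbb R$ (not to be confused with the integer $n$). Identify $a\in\mathcal A_{n-1}$ with $(a,0)\in\mathcal A_n$, so $\mathcal E_{n-1}\subset\mathcal E_n$. In $\mathcal A_n$ put $\tilde e_0=(0,e_0)=e^{(n)}_{2^{n-1}}$ and $\tilde a=a\tilde e_0$. $\mathcal A_n^{\circ}=\mathcal A_n\{\gamma_0,\dots,\gamma_{n-2},\gamma_n\}$ and $\mathcal A_n^{\bullet}=\mathcal A_n\{\gamma_0,\dots,\gamma_{n-2},\gamma_{n-1}\gamma_n\}$; their elements are pairs of elements of $\mathcal A_{n-1}=\mathcal A_{n-1}\{\gamma_0,\dots,\gamma_{n-2}\}$. Two elements $u,v$ of an algebra are orthogonal if $uv=vu=0$. The graph $\Gamma_e(\mathcal A_{n+1})$: vertices are the lines $\mathbb R(a,b)\subset\mathcal A_{n+1}$ spanned by zero divisors $(a,b)$ with $a\in\mathcal E'_n$, $b\in\pm\mathcal E_n$; two distinct lines are adjacent iff their generators are orthogonal. A vertex is denoted by any of its generators, so $(a,b)$ and $(-a,-b)$ are the same vertex. For $y\in\mathcal E_n$, $C(y)$ is the induced subgraph of $\Gamma_e(\mathcal A_{n+1})$ on the vertices $(a,b)$ with $ab=\pm y$. The value $\chi((a,b))=\gamma_n n(a)/n(b)\in\{1,-1\}$ is the same for all pairs $(a,b)$ of basis elements up to sign with $ab=\pm y$, and equals $\gamma_n n(y)$; it is called the characteristic $\chi(C(y))$. For $x\in\mathcal E'_{n-1}$, $\tilde x\in\mathcal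 E_n$. *)

theory Defs
  imports Complex_Main "HOL-Library.Function_Algebras"
begin

instantiation "fun" :: (type, real_vector) real_vector
begin

definition scaleR_fun :: "real \<Rightarrow> ('a \<Rightarrow> 'b) \<Rightarrow> 'a \<Rightarrow> 'b" where
  "scaleR_fun r f = (\<lambda>x. r *\<^sub>R f x)"

instance
  by standard (auto simp: scaleR_fun_def plus_fun_def algebra_simps)

end

lemma scaleR_fun_apply [simp]: "(r *\<^sub>R f) x = r *\<^sub>R f x"
  by (simp add: scaleR_fun_def)

section \<open>Cayley--Dickson algebras\<close>

text \<open>
  An element of the \<open>k\<close>-th algebra is its coordinate sequence with respect to the standard
  basis, i.e. a function vanishing from index \<open>2 ^ k\<close> on. A pair of elements of the \<open>k\<close>-th
  algebra is the concatenation of the two coordinate sequences, so that \<open>(a, 0)\<close> is the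
  same function as \<open>a\<close>: the identification of each algebra with a subset of the next one is
  literal equality. All operations below are meant for arguments in the carrier.
\<close>

type_synonym cd = "nat \<Rightarrow> real"

definition cd_carrier :: "nat \<Rightarrow> cd set" where
  "cd_carrier k = {a. \<forall>i\<ge>2 ^ k. a i = 0}"

definition cd_pair :: "nat \<Rightarrow> cd \<Rightarrow> cd \<Rightarrow> cd" where
  "cd_pair k a b = (\<lambda>i. if i < 2 ^ k then a i else b (i - 2 ^ k))"

definition cd_fst :: "nat \<Rightarrow> cd \<Rightarrow> cd" where
  "cd_fst k u = (\<lambda>i. if i < 2 ^ k then u i else 0)"

definition cd_snd :: "nat \<Rightarrow> cd \<Rightarrow> cd" where
  "cd_snd k u = (\<lambda>i. u (i + 2 ^ k))"

fun cd_conj :: "nat \<Rightarrow> cd \<Rightarrow> cd" where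
  "cd_conj 0 u = u"
| "cd_conj (Suc k) u = cd_pair k (cd_conj k (cd_fst k u)) (- cd_snd k u)"

fun cd_mult :: "(nat \<Rightarrow> real) \<Rightarrow> nat \<Rightarrow> cd \<Rightarrow> cd \<Rightarrow> cd" where
  "cd_mult \<gamma> 0 u v = (\<lambda>i. if i = 0 then u 0 * v 0 else 0)"
| "cd_mult \<gamma> (Suc k) u v =
     (let a = cd_fst k u; b = cd_snd k u; c = cd_fst k v; d = cd_snd k v
      in cd_pair k
           (cd_mult \<gamma> k a c + \<gamma> k *\<^sub>R cd_mult \<gamma> k (cd_conj k d) b)
           (cd_mult \<gamma> k d a + cd_mult \<gamma> k b (cd_conj k c)))"

definition cd_e :: "nat \<Rightarrow> cd" where
  "cd_e j = (\<lambda>i. if i = j then 1 else 0)"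

definition cd_basis :: "nat \<Rightarrow> cd set" where
  "cd_basis k = cd_e ` {..<2 ^ k}"

definition cd_basis' :: "nat \<Rightarrow> cd set" where
  "cd_basis' k = cd_basis k - {cd_e 0}"

definition plus_minus :: "cd set \<Rightarrow> cd set" where
  "plus_minus S = S \<union> uminus ` S"

text \<open>The product of an element with its conjugate is a real multiple of the unit
  (lemma \<open>cd_norm_eq\<close> below); the norm is its coordinate at the unit.\<close>

definition cd_norm :: "(nat \<Rightarrow> real) \<Rightarrow> nat \<Rightarrow> cd \<Rightarrow> real" where
  "cd_norm \<gamma> k a = cd_mult \<gamma> k a (cd_conj k a) 0"

lemma cd_fst_pair [simp]: "a \<in> cd_carrier k \<Longrightarrow> cd_fst k (cd_pair k a b) = a"
  by (auto simp: cd_fst_def cd_pair_def cd_carrier_def fun_eq_iff)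

lemma cd_snd_pair [simp]: "cd_snd k (cd_pair k a b) = b"
  by (auto simp: cd_snd_def cd_pair_def)

lemma cd_pair_fst_snd [simp]: "cd_pair k (cd_fst k u) (cd_snd k u) = u"
  by (auto simp: cd_fst_def cd_snd_def cd_pair_def)

lemma cd_fst_carrier [simp]: "cd_fst k u \<in> cd_carrier k"
  by (auto simp: cd_fst_def cd_carrier_def)

lemma cd_snd_carrier [simp]: "u \<in> cd_carrier (Suc k) \<Longrightarrow> cd_snd k u \<in> cd_carrier k"
  by (auto simp: cd_snd_def cd_carrier_def)

lemma cd_pair_carrier [simp]:
  "b \<in> cd_carrier k \<Longrightarrow> cd_pair k a b \<in> cd_carrier (Suc k)"
  by (auto simp: cd_pair_def cd_carrier_def)

lemma cd_pair_0 [simp]: "a \<in> cd_carrier k \<Longrightarrow> cd_pair k a 0 = a"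
  by (auto simp: cd_pair_def cd_carrier_def fun_eq_iff)

lemma cd_e_Suc:
  shows "j < 2 ^ k \<Longrightarrow> cd_e j = cd_pair k (cd_e j) 0"
    and "2 ^ k \<le> j \<Longrightarrow> cd_e j = cd_pair k 0 (cd_e (j - 2 ^ k))"
  by (auto simp: cd_e_def cd_pair_def fun_eq_iff)

lemma cd_mult_pair:
  assumes "a \<in> cd_carrier k" "c \<in> cd_carrier k"
  shows "cd_mult \<gamma> (Suc k) (cd_pair k a b) (cd_pair k c d) =
    cd_pair k
      (cd_mult \<gamma> k a c + \<gamma> k *\<^sub>R cd_mult \<gamma> k (cd_conj k d) b)
      (cd_mult \<gamma> k d a + cd_mult \<gamma> k b (cd_conj k c))"
  using assms by simp

lemma cd_fst_uminus: "cd_fst k (- u) = - cd_fst k u"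
  by (auto simp: cd_fst_def)

lemma cd_snd_uminus: "cd_snd k (- u) = - cd_snd k u"
  by (auto simp: cd_snd_def)

lemma cd_pair_uminus: "cd_pair k (- a) (- b) = - cd_pair k a b"
  by (auto simp: cd_pair_def)

lemma cd_conj_uminus: "cd_conj k (- u) = - cd_conj k u"
  by (induction k arbitrary: u) (simp_all add: cd_fst_uminus cd_snd_uminus cd_pair_uminus[symmetric])

lemma cd_conj_carrier [simp]: "u \<in> cd_carrier k \<Longrightarrow> cd_conj k u \<in> cd_carrier k"
proof (induction k arbitrary: u)
  case (Suc k)
  have "- cd_snd k u \<in> cd_carrier k"
    using cd_snd_carrier[OF Suc.prems] by (simp add: cd_carrier_def)
  then show ?case by simp
qed simp

lemma cd_conj_conj: "u \<in> cd_carrier k \<Longrightarrow> cd_conj k (cd_conj k u) = u"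
  by (induction k arbitrary: u) simp_all

lemma cd_mult_uminus:
  "cd_mult \<gamma> k (- u) v = - cd_mult \<gamma> k u v"
  "cd_mult \<gamma> k u (- v) = - cd_mult \<gamma> k u v"
  by (induction k arbitrary: u v)
     (simp_all add: fun_eq_iff Let_def cd_fst_uminus cd_snd_uminus cd_conj_uminus
        cd_pair_uminus[symmetric] scaleR_minus_right[symmetric] del: scaleR_minus_right,
      simp_all add: cd_pair_def)

lemma cd_norm_eq:
  assumes "a \<in> cd_carrier k"
  shows "cd_mult \<gamma> k a (cd_conj k a) = cd_norm \<gamma> k a *\<^sub>R cd_e 0"
    and "cd_mult \<gamma> k (cd_conj k a) a = cd_norm \<gamma> k a *\<^sub>R cd_e 0"
proof -
  have "cd_mult \<gamma> k a (cd_conj k a) = cd_norm \<gamma> k a *\<^sub>R cd_e 0 \<and>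
        cd_mult \<gamma> k (cd_conj k a) a = cd_norm \<gamma> k a *\<^sub>R cd_e 0"
    using assms
  proof (induction k arbitrary: a)
    case 0
    then show ?case by (auto simp: cd_norm_def cd_e_def fun_eq_iff)
  next
    case (Suc k)
    let ?p = "cd_fst k a" and ?q = "cd_snd k a"
    have q: "?q \<in> cd_carrier k" using Suc.prems by simp
    have p: "?p \<in> cd_carrier k" by simp
    note IH = Suc.IH[OF p] Suc.IH[OF q]
    have 1: "cd_mult \<gamma> (Suc k) a (cd_conj (Suc k) a) =
        cd_pair k ((cd_norm \<gamma> k ?p - \<gamma> k * cd_norm \<gamma> k ?q) *\<^sub>R cd_e 0) 0"
      by (simp add: Let_def IH cd_conj_conj cd_conj_uminus cd_mult_uminus)
        (simp add: cd_pair_def fun_eq_iff algebra_simps)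
    have 2: "cd_mult \<gamma> (Suc k) (cd_conj (Suc k) a) a =
        cd_pair k ((cd_norm \<gamma> k ?p - \<gamma> k * cd_norm \<gamma> k ?q) *\<^sub>R cd_e 0) 0"
      by (simp add: Let_def IH cd_conj_uminus cd_mult_uminus)
        (simp add: cd_pair_def fun_eq_iff algebra_simps)
    have 3: "cd_norm \<gamma> (Suc k) a = cd_norm \<gamma> k ?p - \<gamma> k * cd_norm \<gamma> k ?q"
      unfolding cd_norm_def[of \<gamma> "Suc k"] 1 by (simp add: cd_pair_def cd_e_def)
    have 4: "cd_pair k (r *\<^sub>R cd_e 0) 0 = r *\<^sub>R cd_e 0" for r
      by (auto simp: cd_pair_def cd_e_def fun_eq_iff)
    show ?case using 1 2 3 4 by metis
  qed
  then show "cd_mult \<gamma> k a (cd_conj k a) = cd_norm \<gamma> k a *\<^sub>R cd_e 0"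
    and "cd_mult \<gamma> k (cd_conj k a) a = cd_norm \<gamma> k a *\<^sub>R cd_e 0" by auto
qed

definition cd_orthogonal :: "(nat \<Rightarrow> real) \<Rightarrow> nat \<Rightarrow> cd \<Rightarrow> cd \<Rightarrow> bool" where
  "cd_orthogonal \<gamma> k u v \<longleftrightarrow> cd_mult \<gamma> k u v = 0 \<and> cd_mult \<gamma> k v u = 0"

definition cd_zero_divisor :: "(nat \<Rightarrow> real) \<Rightarrow> nat \<Rightarrow> cd \<Rightarrow> bool" where
  "cd_zero_divisor \<gamma> k u \<longleftrightarrow> u \<in> cd_carrier k \<and> u \<noteq> 0 \<and>
     (\<exists>v\<in>cd_carrier k. v \<noteq> 0 \<and> (cd_mult \<gamma> k u v = 0 \<or> cd_mult \<gamma> k v u = 0))"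

text \<open>Linear independence as a family; \<open>independent\<close> only sees the underlying set.\<close>

definition lin_indep :: "cd list \<Rightarrow> bool" where
  "lin_indep vs \<longleftrightarrow> distinct vs \<and> independent (set vs)"

text \<open>The element \<open>(0, e\<^sub>0)\<close> of the \<open>n\<close>-th algebra, for \<open>n \<ge> 1\<close>.\<close>

definition cd_te :: "nat \<Rightarrow> cd" where
  "cd_te n = cd_e (2 ^ (n - 1))"

definition cd_tilde :: "(nat \<Rightarrow> real) \<Rightarrow> nat \<Rightarrow> cd \<Rightarrow> cd" where
  "cd_tilde \<gamma> n a = cd_mult \<gamma> n a (cd_te n)"

section \<open>Simple graphs\<close>

text \<open>A graph is its vertex set together with its set of (two-element) edges.\<close>

type_synonym 'v graph = "'v set \<times> 'v set set"

abbreviation gverts :: "'v graph \<Rightarrow> 'v set" where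
  "gverts \<equiv> fst"

abbreviation gedges :: "'v graph \<Rightarrow> 'v set set" where
  "gedges \<equiv> snd"

definition induced :: "'v graph \<Rightarrow> 'v set \<Rightarrow> 'v graph" where
  "induced G W = (gverts G \<inter> W, {e \<in> gedges G. e \<subseteq> W})"

definition join_edges :: "'v set \<Rightarrow> 'v set \<Rightarrow> 'v set set" where
  "join_edges S T = {{u, v} | u v. u \<in> S \<and> v \<in> T}"

definition cycle_edges :: "'v list \<Rightarrow> 'v set set" where
  "cycle_edges vs = {{vs ! i, vs ! (Suc i mod length vs)} | i. i < length vs}"

definition cyclic_join_edges :: "'v set list \<Rightarrow> 'v set set" where
  "cyclic_join_edges Ss =
     (\<Union>i<length Ss. join_edges (Ss ! i) (Ss ! (Suc i mod length Ss)))"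

text \<open>Hexagons need not be induced; double hexagons are.\<close>

definition is_hexagon :: "'v graph \<Rightarrow> 'v list \<Rightarrow> bool" where
  "is_hexagon G vs \<longleftrightarrow> length vs = 6 \<and> distinct vs \<and>
     set vs \<subseteq> gverts G \<and> cycle_edges vs \<subseteq> gedges G"

definition is_double_hexagon :: "'v graph \<Rightarrow> 'v set list \<Rightarrow> bool" where
  "is_double_hexagon G Ss \<longleftrightarrow> length Ss = 6 \<and> (\<forall>i<6. card (Ss ! i) = 2) \<and>
     (\<forall>i<6. \<forall>j<6. i \<noteq> j \<longrightarrow> Ss ! i \<inter> Ss ! j = {}) \<and>
     induced G (\<Union>(set Ss)) = (\<Union>(set Ss), cyclic_join_edges Ss)"

section \<open>The orthogonality graph on pairs of basis elements\<close>

definition cd_line :: "nat \<Rightarrow> cd \<Rightarrow> cd \<Rightarrow> cd set" where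
  "cd_line n a b = span {cd_pair n a b}"

text \<open>\<open>Gamma_e \<gamma> n\<close> is the graph of the algebra of level \<open>n + 1\<close>.\<close>

definition Gamma_e_verts :: "(nat \<Rightarrow> real) \<Rightarrow> nat \<Rightarrow> cd set set" where
  "Gamma_e_verts \<gamma> n = {cd_line n a b | a b.
     a \<in> cd_basis' n \<and> b \<in> plus_minus (cd_basis n) \<and>
     cd_zero_divisor \<gamma> (Suc n) (cd_pair n a b)}"

definition Gamma_e :: "(nat \<Rightarrow> real) \<Rightarrow> nat \<Rightarrow> cd set graph" where
  "Gamma_e \<gamma> n = (Gamma_e_verts \<gamma> n,
     {{K, L} | K L. K \<in> Gamma_e_verts \<gamma> n \<and> L \<in> Gamma_e_verts \<gamma> n \<and> K \<noteq> L \<and>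
        (\<exists>u v. K = span {u} \<and> L = span {v} \<and> cd_orthogonal \<gamma> (Suc n) u v)})"

definition cd_C :: "(nat \<Rightarrow> real) \<Rightarrow> nat \<Rightarrow> cd \<Rightarrow> cd set graph" where
  "cd_C \<gamma> n y = induced (Gamma_e \<gamma> n)
     {cd_line n a b | a b. a \<in> cd_basis' n \<and> b \<in> plus_minus (cd_basis n) \<and>
        cd_mult \<gamma> n a b \<in> {y, - y}}"

text \<open>The common value of \<open>\<gamma>\<^sub>n n(a) / n(b)\<close> over all pairs of basis elements up to sign
  whose product is \<open>y\<close> up to sign.\<close>

definition cd_chi :: "(nat \<Rightarrow> real) \<Rightarrow> nat \<Rightarrow> cd \<Rightarrow> real" where
  "cd_chi \<gamma> n y = (THE c. \<forall>a\<in>plus_minus (cd_basis n). \<forall>b\<in>plus_minus (cd_basis n).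
     cd_mult \<gamma> n a b \<in> {y, - y} \<longrightarrow> \<gamma> n * cd_norm \<gamma> n a / cd_norm \<gamma> n b = c)"

definition x_pairs :: "(nat \<Rightarrow> real) \<Rightarrow> nat \<Rightarrow> cd \<Rightarrow> (cd \<times> cd) set" where
  "x_pairs \<gamma> n x = {(a, b). a \<in> plus_minus (cd_basis' (n - 1)) \<and>
     b \<in> plus_minus (cd_basis' (n - 1)) \<and>
     cd_mult \<gamma> (n - 1) a b = cd_norm \<gamma> (n - 1) b *\<^sub>R x}"

text \<open>The quadruples \<open>(a, b, c, d)\<close> to which the description of the remaining edges applies.\<close>

definition x_quads :: "(nat \<Rightarrow> real) \<Rightarrow> nat \<Rightarrow> cd \<Rightarrow> (cd \<times> cd \<times> cd \<times> cd) set" where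
  "x_quads \<gamma> n x = {(a, b, c, d). {a, b, c, d} \<subseteq> plus_minus (cd_basis' (n - 1)) \<and>
     cd_mult \<gamma> (n - 1) a b \<in> {x, - x} \<and> cd_mult \<gamma> (n - 1) c d \<in> {x, - x} \<and>
     lin_indep [a, b, c, d, x]}"

end

theory Submission
  imports Defs
begin

text \<open>
  Up to sign, basis elements multiply by adding their indices in \<open>\<int>\<^sub>2\<^sup>n\<close>, i.e. by \<open>xor\<close> of binary
  indices. For pairs of basis elements \<open>(a, b)\<close> and \<open>(c, d)\<close> whose products agree up to sign, both
  coordinates of a product of the pairs are therefore multiples of single basis elements, and
  orthogonality becomes two equations between signs. Inside the
  block formed by one \<open>x\<close>-pair these signs live in the quaternion algebra generated by \<open>a\<close> and \<open>b\<close> and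
  its double, so they are determined by the norms and by \<open>\<gamma>\<close>, and the characteristic decides which of
  two fixed adjacency tables occurs. Between different blocks, the signs for all sixteen pairs of
  vertices reduce to the same orthogonality condition one level below. The vertex \<open>(y, e\<^sub>0)\<close> is
  excluded for characteristic \<open>-1\<close> because it is then not a zero divisor.
\<close>


section \<open>Products of basis elements\<close>

text \<open>Basis elements still satisfy e_i (e_i e_j) = (e_i e_i) e_j and its mirror image, and the
  sign computations rest on these two laws and on conjugation reversing products. Orthogonality
  (\<open>cd_link\<close>) splits into an equation that fixes the product of the two signs and an
  equation free of them. Within a block the latter prescribes the value of the characteristic, so
  any two of the positions 0 to 5 are joined for exactly one value of it: there the two tables are
  complementary, one giving all joins between three classes of two positions, the other the joins
  inside these classes. For \<open>(y, e_0)\<close> the annihilator equations decouple into 2 by 2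
  systems with determinant n(y) - \<gamma>_n up to sign, which is nonzero exactly for characteristic
  -1. A block has no preferred first member: i and \<open>xor i x\<close> name the same block, and
  both occur as indices.\<close>

lemma nat_add_power2_eq_xor: "2 ^ k + i = xor (2 ^ k) i" if "i < 2 ^ k" for i :: nat
proof -
  have "\<not> bit i k" using that by (simp add: bit_iff_odd)
  then have "and (2 ^ k) i = 0"
    by (intro bit_eqI) (auto simp: bit_and_iff bit_exp_iff)
  then show ?thesis by (rule disjunctive_add_eq_xor)
qed

lemma nat_xor_less_power2: "xor i j < (2::nat) ^ k" if "i < 2 ^ k" "j < 2 ^ k" for i j :: nat
  using that by (metis take_bit_nat_eq_self take_bit_nat_less_exp take_bit_xor)

lemma nat_xor_cancel [simp]: "xor i (xor i j) = j" "xor (xor i j) j = i" "xor (xor j i) j = i"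
  for i j :: nat
proof -
  show *: "xor i (xor i j) = j" for i j :: nat
    by (simp add: xor.assoc[symmetric])
  show "xor (xor i j) j = i" by (simp add: xor.assoc)
  show "xor (xor j i) j = i" using *[of j i] by (simp only: xor.commute)
qed

lemma nat_xor_eq_0_iff [simp]: "xor i j = 0 \<longleftrightarrow> i = j" for i j :: nat
  by (metis nat_xor_cancel(1) xor.right_neutral xor_self_eq)

lemma nat_xor_power2:
  fixes i j :: nat
  assumes "i < 2 ^ k" "j < 2 ^ k"
  shows "xor i (2 ^ k + j) = 2 ^ k + xor i j"
    and "xor (2 ^ k + i) j = 2 ^ k + xor i j"
    and "xor (2 ^ k + i) (2 ^ k + j) = xor i j"
  using assms by (simp_all add: nat_add_power2_eq_xor nat_xor_less_power2)
    (metis xor.assoc xor.commute nat_xor_cancel(1))+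

lemma nat_xor_self_iff [simp]: "xor i j = i \<longleftrightarrow> j = 0" "xor i j = j \<longleftrightarrow> i = 0" for i j :: nat
  by (metis nat_xor_cancel(1) xor.right_neutral xor_self_eq)
     (metis nat_xor_cancel(2) xor.left_neutral xor_self_eq)

lemma nat_xor_self_iff' [simp]: "i = xor i j \<longleftrightarrow> j = 0" "j = xor i j \<longleftrightarrow> i = 0" for i j :: nat
  using nat_xor_self_iff[of i j] by metis+

lemma nat_xor_pos_iff [simp]: "0 < xor i j \<longleftrightarrow> i \<noteq> j" for i j :: nat
  by (simp only: zero_less_iff_neq_zero nat_xor_eq_0_iff simp_thms)

section \<open>Signs of conjugates and products of basis elements\<close>

definition cj :: "nat \<Rightarrow> real" where
  "cj i = (if i = 0 then 1 else - 1)"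

lemma cj_simps [simp]: "cj 0 = 1" "i \<noteq> 0 \<Longrightarrow> cj i = - 1"
  by (simp_all add: cj_def)

lemma cj_sign: "cj i \<in> {1, - 1}"
  by (simp add: cj_def)

text \<open>The structure constant in e_i e_j = \<open>cd_sign \<gamma> k i j\<close> e_(xor i j),
  see \<open>cd_mult_e\<close>. The branches are the four summands of the doubling product:
  arguments are swapped where it reads da or has the conjugate of d before b, and \<open>cj\<close>
  is the sign of the conjugation occurring there.\<close>

fun cd_sign :: "(nat \<Rightarrow> real) \<Rightarrow> nat \<Rightarrow> nat \<Rightarrow> nat \<Rightarrow> real" where
  "cd_sign \<gamma> 0 i j = 1"
| "cd_sign \<gamma> (Suc k) i j =
     (if i < 2 ^ k
      then if j < 2 ^ k then cd_sign \<gamma> k i j else cd_sign \<gamma> k (j - 2 ^ k) i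
      else if j < 2 ^ k then cj j * cd_sign \<gamma> k (i - 2 ^ k) j
      else \<gamma> k * cj (j - 2 ^ k) * cd_sign \<gamma> k (j - 2 ^ k) (i - 2 ^ k))"

lemma cd_sign_Suc:
  assumes "i < 2 ^ k" "j < 2 ^ k"
  shows "cd_sign \<gamma> (Suc k) i j = cd_sign \<gamma> k i j"
    and "cd_sign \<gamma> (Suc k) i (2 ^ k + j) = cd_sign \<gamma> k j i"
    and "cd_sign \<gamma> (Suc k) (2 ^ k + i) j = cj j * cd_sign \<gamma> k i j"
    and "cd_sign \<gamma> (Suc k) (2 ^ k + i) (2 ^ k + j) = \<gamma> k * cj j * cd_sign \<gamma> k j i"
  using assms by simp_all

lemma less_power2_Suc_cases [consumes 1, case_names low high]:
  assumes "i < (2::nat) ^ Suc k"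
  obtains (low) "i < 2 ^ k" | (high) i' where "i = 2 ^ k + i'" "i' < 2 ^ k"
  using assms that by (cases "i < 2 ^ k") (auto simp: not_less dest!: le_Suc_ex)

text \<open>Only the parameters below k enter. The two modified algebras of level n differ from the
  original one in the last parameter alone, so they share all signs of level n - 1.\<close>

lemma cd_sign_cong:
  assumes "\<And>l. l < k \<Longrightarrow> \<gamma> l = \<gamma>' l"
  shows "cd_sign \<gamma> k i j = cd_sign \<gamma>' k i j"
  using assms by (induction k arbitrary: i j) simp_all

lemma cd_sign_sign:
  assumes "\<And>l. l < k \<Longrightarrow> \<gamma> l \<in> {1, - 1}"
  shows "cd_sign \<gamma> k i j \<in> {1, - 1}"
  using assms by (induction k arbitrary: i j) (simp_all add: cj_def, fastforce+)

lemma cd_sign_0: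
  "cd_sign \<gamma> k 0 j = 1" "cd_sign \<gamma> k i 0 = 1"
  by (induction k arbitrary: i j) simp_all

text \<open>In terms of basis elements: conjugation reverses products, (e_i e_j) e_j = e_i (e_j
  e_j), and e_i (e_i e_j) = (e_i e_i) e_j. Doubling reverses some factors, so each cancellation law
  at one level uses both of them at the level below, and the conjugation law is needed to turn
  factors round. Hence a single joint induction.\<close>

lemma cd_sign_rules:
  assumes "\<And>l. l < k \<Longrightarrow> \<gamma> l \<in> {1, - 1}" "i < 2 ^ k" "j < 2 ^ k"
  shows "cj (xor i j) * cd_sign \<gamma> k i j = cj i * cj j * cd_sign \<gamma> k j i \<and>
    cd_sign \<gamma> k i j * cd_sign \<gamma> k (xor i j) j = cd_sign \<gamma> k j j \<and>
    cd_sign \<gamma> k i j * cd_sign \<gamma> k i (xor i j) = cd_sign \<gamma> k i i"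
  using assms
proof (induction k arbitrary: i j)
  case (Suc k)
  have IH: "cj (xor i j) * cd_sign \<gamma> k i j = cj i * cj j * cd_sign \<gamma> k j i"
    "cd_sign \<gamma> k i j * cd_sign \<gamma> k (xor i j) j = cd_sign \<gamma> k j j"
    "cd_sign \<gamma> k i j * cd_sign \<gamma> k i (xor i j) = cd_sign \<gamma> k i i"
    if "i < 2 ^ k" "j < 2 ^ k" for i j using Suc.IH[OF Suc.prems(1) that] by auto
  have cj': "cj i * (cj i * r) = r" for i r by (simp add: cj_def)
  have cjN: "cj (2 ^ k + r) = - 1" for r by (simp add: cj_def)
  note rules = cd_sign_Suc nat_xor_power2 nat_xor_less_power2 cjN
  show ?case
    using Suc.prems(2)
  proof (cases rule: less_power2_Suc_cases)
    case low
    show ?thesis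
      using Suc.prems(3)
    proof (cases rule: less_power2_Suc_cases)
      case low' : low
      show ?thesis using IH[OF low low'] low low'
        by (simp only: cd_sign_Suc nat_xor_less_power2)
    next
      case (high j')
      let ?s = "cd_sign \<gamma> k"
      have "?s j' i * (\<gamma> k * cj j' * ?s j' (xor i j')) = \<gamma> k * cj j' * (?s j' i * ?s j' (xor i j'))"
        by (simp only: ac_simps)
      then show ?thesis
        using IH[OF high(2) low] low high(2)
        by (simp add: high(1) rules xor.commute[of j'] cj' del: cd_sign.simps)
    qed
  next
    case (high i')
    show ?thesis
      using Suc.prems(3)
    proof (cases rule: less_power2_Suc_cases)
      case low
      let ?s = "cd_sign \<gamma> k"
      have "cj j * ?s i' j * (cj j * ?s (xor i' j) j) = ?s j j"
        using IH(2)[OF high(2) low] by (simp add: cj' mult_ac)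
      moreover have "cj j * ?s i' j * (\<gamma> k * cj (xor i' j) * ?s (xor i' j) i') =
          \<gamma> k * cj i' * ?s i' i'"
      proof -
        have "cj j * ?s i' j * (\<gamma> k * cj (xor i' j) * ?s (xor i' j) i') =
            \<gamma> k * cj j * (cj (xor i' j) * ?s i' j) * ?s (xor i' j) i'"
          by (simp only: ac_simps)
        also have "\<dots> = \<gamma> k * (cj j * (cj j * (cj i' * (?s j i' * ?s (xor j i') i'))))"
          by (simp only: IH(1)[OF high(2) low]) (simp only: xor.commute[of i' j] mult_ac)
        also have "\<dots> = \<gamma> k * cj i' * ?s i' i'"
          by (simp only: IH(2)[OF low high(2)] cj' mult.assoc)
        finally show ?thesis .
      qed
      ultimately show ?thesis
        using low high(2) by (simp add: high(1) rules cj' del: cd_sign.simps)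
    next
      case high' : (high j')
      let ?s = "cd_sign \<gamma> k"
      have "cj (xor i' j') * (\<gamma> k * cj j' * ?s j' i') = \<gamma> k * cj i' * ?s i' j'"
      proof -
        have "cj (xor i' j') * (\<gamma> k * cj j' * ?s j' i') = \<gamma> k * cj j' * (cj (xor j' i') * ?s j' i')"
          by (simp only: xor.commute[of j' i'] ac_simps)
        also have "\<dots> = \<gamma> k * (cj j' * (cj j' * (cj i' * ?s i' j')))"
          by (simp only: IH(1)[OF high'(2) high(2)] mult.assoc)
        finally show ?thesis by (simp only: cj' mult.assoc)
      qed
      moreover have "\<gamma> k * cj j' * ?s j' i' * ?s j' (xor i' j') = \<gamma> k * cj j' * ?s j' j'"
        by (simp only: IH(3)[OF high'(2) high(2)] xor.commute[of i' j'] mult.assoc)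
      moreover have "\<gamma> k * cj j' * ?s j' i' * (cj (xor i' j') * ?s i' (xor i' j')) =
          \<gamma> k * cj i' * ?s i' i'"
      proof -
        have "\<gamma> k * cj j' * ?s j' i' * (cj (xor i' j') * ?s i' (xor i' j')) =
            \<gamma> k * cj j' * (cj (xor j' i') * ?s j' i') * ?s i' (xor i' j')"
          by (simp only: xor.commute[of j' i'] ac_simps)
        also have "\<dots> = \<gamma> k * (cj j' * (cj j' * (cj i' * (?s i' j' * ?s i' (xor i' j')))))"
          by (simp only: IH(1)[OF high'(2) high(2)] mult.assoc)
        also have "\<dots> = \<gamma> k * cj i' * ?s i' i'"
          by (simp only: IH(3)[OF high(2) high'(2)] cj' mult.assoc)
        finally show ?thesis .
      qed
      ultimately show ?thesis
        using high(2) high'(2) by (simp add: high(1) high'(1) rules del: cd_sign.simps)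
    qed
  qed
qed simp


section \<open>Multiplying an arbitrary element by a basis element\<close>

lemma cd_mult_scaleR:
  "cd_mult \<gamma> k (r *\<^sub>R u) v = r *\<^sub>R cd_mult \<gamma> k u v"
  "cd_mult \<gamma> k u (r *\<^sub>R v) = r *\<^sub>R cd_mult \<gamma> k u v"
  and cd_conj_scaleR: "cd_conj k (r *\<^sub>R u) = r *\<^sub>R cd_conj k u"
proof -
  have fs: "cd_fst k (r *\<^sub>R u) = r *\<^sub>R cd_fst k u" "cd_snd k (r *\<^sub>R u) = r *\<^sub>R cd_snd k u"
    for r u k by (auto simp: cd_fst_def cd_snd_def)
  have conj: "cd_conj k (r *\<^sub>R u) = r *\<^sub>R cd_conj k u" for u k
    by (induction k arbitrary: u) (auto simp: fs cd_pair_def fun_eq_iff)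
  then show "cd_conj k (r *\<^sub>R u) = r *\<^sub>R cd_conj k u" .
  show "cd_mult \<gamma> k (r *\<^sub>R u) v = r *\<^sub>R cd_mult \<gamma> k u v"
    "cd_mult \<gamma> k u (r *\<^sub>R v) = r *\<^sub>R cd_mult \<gamma> k u v"
    by (induction k arbitrary: u v) (auto simp: Let_def fs conj cd_pair_def fun_eq_iff algebra_simps)
qed

lemma cd_mult_zero: "cd_mult \<gamma> k 0 v = 0" "cd_mult \<gamma> k u 0 = 0"
  using cd_mult_scaleR(1)[of \<gamma> k 0 0 v] cd_mult_scaleR(2)[of \<gamma> k u 0 0] by simp_all

lemma cd_conj_0: "cd_conj k 0 = 0"
  using cd_conj_scaleR[of k 0 0] by simp

lemma cd_conj_coord: "u \<in> cd_carrier k \<Longrightarrow> cd_conj k u = (\<lambda>i. cj i * u i)"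
proof (induction k arbitrary: u)
  case 0
  then show ?case by (auto simp: cd_carrier_def cj_def fun_eq_iff)
next
  case (Suc k)
  show ?case
    using Suc.prems by (simp add: Suc.IH) (auto simp: cd_pair_def cd_fst_def cd_snd_def cj_def fun_eq_iff)
qed

lemma cd_e_carrier [simp]: "j < 2 ^ k \<Longrightarrow> cd_e j \<in> cd_carrier k"
  by (auto simp: cd_e_def cd_carrier_def)

lemma cd_carrier_scaleR [simp]: "u \<in> cd_carrier k \<Longrightarrow> r *\<^sub>R u \<in> cd_carrier k"
  by (auto simp: cd_carrier_def)

lemma cd_conj_e: "j < 2 ^ k \<Longrightarrow> cd_conj k (cd_e j) = cj j *\<^sub>R cd_e j"
  by (simp add: cd_conj_coord) (auto simp: cd_e_def fun_eq_iff)

lemma cd_mult_carrier: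
  "u \<in> cd_carrier k \<Longrightarrow> v \<in> cd_carrier k \<Longrightarrow> cd_mult \<gamma> k u v \<in> cd_carrier k"
proof (induction k arbitrary: u v)
  case (Suc k)
  have add: "a \<in> cd_carrier k \<Longrightarrow> b \<in> cd_carrier k \<Longrightarrow> a + b \<in> cd_carrier k" for a b
    by (auto simp: cd_carrier_def)
  show ?case using Suc.prems by (auto simp: Let_def intro!: cd_pair_carrier add Suc.IH)
qed (auto simp: cd_carrier_def)

text \<open>Multiplication by a basis element permutes the coordinates by \<open>xor\<close> and
  changes signs. The other factor is arbitrary because excluding zero divisors requires testing
  against every element, not only against basis elements.\<close>

lemma cd_mult_e_coord:
  assumes "u \<in> cd_carrier k" "j < 2 ^ k" "i < 2 ^ k"
  shows "cd_mult \<gamma> k u (cd_e j) i = cd_sign \<gamma> k (xor i j) j * u (xor i j)"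
    and "cd_mult \<gamma> k (cd_e j) u i = cd_sign \<gamma> k j (xor i j) * u (xor i j)"
proof -
  have "cd_mult \<gamma> k u (cd_e j) i = cd_sign \<gamma> k (xor i j) j * u (xor i j) \<and>
    cd_mult \<gamma> k (cd_e j) u i = cd_sign \<gamma> k j (xor i j) * u (xor i j)"
    using assms
  proof (induction k arbitrary: u i j)
    case 0
    then show ?case by (simp add: cd_e_def)
  next
    case (Suc k)
    let ?a = "cd_fst k u" and ?b = "cd_snd k u"
    have b: "?b \<in> cd_carrier k" using Suc.prems by simp
    have u: "?a r = u r" "?b r = u (2 ^ k + r)" if "r < 2 ^ k" for r
      using that by (simp_all add: cd_fst_def cd_snd_def add.commute)
    note IH = Suc.IH[THEN conjunct1] Suc.IH[THEN conjunct2]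
    note red = IH b cd_mult_scaleR cd_mult_zero cd_sign_Suc nat_xor_power2
      nat_xor_less_power2 cd_conj_e u
    have u_eq: "u = cd_pair k ?a ?b" by simp
    show ?case
      using Suc.prems(2)
    proof (cases rule: less_power2_Suc_cases)
      case low
      have e: "cd_e j = cd_pair k (cd_e j) 0" using low by (rule cd_e_Suc)
      have *: "cd_mult \<gamma> (Suc k) u (cd_e j) =
          cd_pair k (cd_mult \<gamma> k ?a (cd_e j)) (cj j *\<^sub>R cd_mult \<gamma> k ?b (cd_e j))"
        "cd_mult \<gamma> (Suc k) (cd_e j) u =
          cd_pair k (cd_mult \<gamma> k (cd_e j) ?a) (cd_mult \<gamma> k ?b (cd_e j))"
        using cd_mult_pair[of ?a k "cd_e j" \<gamma> ?b 0] cd_mult_pair[of "cd_e j" k ?a \<gamma> 0 ?b] low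
        by (simp_all add: e[symmetric] cd_mult_zero cd_conj_0 cd_conj_e cd_mult_scaleR
            del: cd_mult.simps)
      show ?thesis
        using Suc.prems(3)
      proof (cases rule: less_power2_Suc_cases)
        case low' : low
        then show ?thesis
          unfolding * using low by (simp add: red cd_pair_def del: cd_sign.simps)
      next
        case (high i')
        then show ?thesis
          unfolding * using low by (simp add: red cd_pair_def del: cd_sign.simps)
      qed
    next
      case (high j')
      have e: "cd_e j = cd_pair k 0 (cd_e j')" using high cd_e_Suc(2)[of k j] by simp
      have 0: "0 \<in> cd_carrier k" by (simp add: cd_carrier_def)
      have *: "cd_mult \<gamma> (Suc k) u (cd_e j) =
          cd_pair k (\<gamma> k *\<^sub>R cj j' *\<^sub>R cd_mult \<gamma> k (cd_e j') ?b) (cd_mult \<gamma> k (cd_e j') ?a)"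
        "cd_mult \<gamma> (Suc k) (cd_e j) u =
          cd_pair k (\<gamma> k *\<^sub>R cd_mult \<gamma> k (cd_conj k ?b) (cd_e j'))
            (cd_mult \<gamma> k (cd_e j') (cd_conj k ?a))"
        using cd_mult_pair[of ?a k 0 \<gamma> ?b "cd_e j'"] cd_mult_pair[of 0 k ?a \<gamma> "cd_e j'" ?b] high 0
        by (simp_all add: e[symmetric] cd_mult_zero cd_conj_0 cd_conj_e cd_mult_scaleR
            del: cd_mult.simps)
      have cb: "cd_conj k ?a r = cj r * u r" "cd_conj k ?b r = cj r * u (2 ^ k + r)" if "r < 2 ^ k" for r
        using that b by (simp_all add: cd_conj_coord u)
      show ?thesis
        using Suc.prems(3)
      proof (cases rule: less_power2_Suc_cases)
        case low
        then show ?thesis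
          unfolding * using high by (simp add: red cb cd_pair_def del: cd_sign.simps)
      next
        case high' : (high i')
        then show ?thesis
          unfolding * using high by (simp add: red cb cd_pair_def del: cd_sign.simps)
      qed
    qed
  qed
  then show "cd_mult \<gamma> k u (cd_e j) i = cd_sign \<gamma> k (xor i j) j * u (xor i j)"
    and "cd_mult \<gamma> k (cd_e j) u i = cd_sign \<gamma> k j (xor i j) * u (xor i j)" by simp_all
qed

lemma cd_mult_e:
  assumes "i < 2 ^ k" "j < 2 ^ k"
  shows "cd_mult \<gamma> k (cd_e i) (cd_e j) = cd_sign \<gamma> k i j *\<^sub>R cd_e (xor i j)"
proof
  fix r
  show "cd_mult \<gamma> k (cd_e i) (cd_e j) r = (cd_sign \<gamma> k i j *\<^sub>R cd_e (xor i j)) r"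
  proof (cases "r < 2 ^ k")
    case True
    then show ?thesis
      using assms by (auto simp: cd_mult_e_coord) (auto simp: cd_e_def)
  next
    case False
    then have "cd_mult \<gamma> k (cd_e i) (cd_e j) r = 0" "r \<noteq> xor i j"
      using cd_mult_carrier[OF cd_e_carrier cd_e_carrier, OF assms] nat_xor_less_power2[OF assms]
      by (auto simp: cd_carrier_def)
    then show ?thesis by (simp add: cd_e_def)
  qed
qed

lemma cd_norm_e: "i < 2 ^ k \<Longrightarrow> cd_norm \<gamma> k (cd_e i) = cj i * cd_sign \<gamma> k i i"
  by (simp add: cd_norm_def cd_conj_e cd_mult_scaleR cd_mult_e) (simp add: cd_e_def)

lemma cd_norm_scaleR: "cd_norm \<gamma> k (r *\<^sub>R a) = r\<^sup>2 * cd_norm \<gamma> k a"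
  by (simp add: cd_norm_def cd_conj_scaleR cd_mult_scaleR power2_eq_square)

lemma scaleR_cd_e_eq_iff:
  assumes "r \<noteq> 0"
  shows "r *\<^sub>R cd_e i = s *\<^sub>R cd_e j \<longleftrightarrow> r = s \<and> i = j"
proof
  assume *: "r *\<^sub>R cd_e i = s *\<^sub>R cd_e j"
  show "r = s \<and> i = j"
    using fun_cong[OF *, of i] assms by (auto simp: cd_e_def split: if_splits)
qed simp

lemma cd_e_nonzero [simp]: "cd_e i \<noteq> 0"
proof
  assume "cd_e i = 0"
  then have "cd_e i i = 0" by simp
  then show False by (simp add: cd_e_def)
qed

lemma cd_e_eq_iff [simp]: "cd_e i = cd_e j \<longleftrightarrow> i = j"
  using scaleR_cd_e_eq_iff[of 1 i 1 j] by simp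

lemma sign_mult: "r \<in> {1, - 1} \<Longrightarrow> s \<in> {1, - 1} \<Longrightarrow> r * s \<in> {1, - 1 :: real}"
  by auto

section \<open>Orthogonality of pairs of basis elements\<close>

text \<open>Here \<open>\<rho>\<close> is the product of the two signs of the second entries. The
  first equation is the vanishing of the second coordinate of the product; the second is the
  vanishing of the first coordinate after \<open>\<rho>\<close> has been eliminated by the first
  equation.\<close>

definition cd_link :: "(nat \<Rightarrow> real) \<Rightarrow> nat \<Rightarrow> nat \<Rightarrow> nat \<Rightarrow> nat \<Rightarrow> nat \<Rightarrow> real \<Rightarrow> bool" where
  "cd_link \<gamma> n i j k l \<rho> \<longleftrightarrow> \<rho> = cd_sign \<gamma> n l i * cd_sign \<gamma> n j k \<and>
     \<gamma> n * cj l * cd_sign \<gamma> n l j * cd_sign \<gamma> n i k * (cd_sign \<gamma> n l i * cd_sign \<gamma> n j k) = - 1"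

text \<open>The four indices have total sum 0, so every splitting into two pairs gives equal sums.
  This puts both summands of each coordinate of the product on one basis element.\<close>

lemma xor_swap_eq:
  fixes i j k l :: nat
  assumes "xor i j = xor k l"
  shows "xor l j = xor i k" "xor l i = xor j k" "xor k i = xor j l"
proof -
  have l: "l = xor k (xor i j)" using assms by simp
  show "xor l j = xor i k" "xor l i = xor j k" "xor k i = xor j l"
    unfolding l by (simp_all add: xor.assoc) (simp_all add: xor.commute xor.left_commute)
qed

text \<open>Each coordinate of the product has a single coefficient, a sum or difference of two
  signs. As k is nonzero, e_k is negated by conjugation, which produces the difference in the second
  coordinate. Both orders of multiplication impose the same conditions: exchanging the factors
  negates the second coefficient and multiplies the first by a sign.\<close>

lemma cd_orthogonal_pair_iff:
  assumes \<gamma>: "\<And>l. l \<le> n \<Longrightarrow> \<gamma> l \<in> {1, - 1}"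
    and ijkl: "i < 2 ^ n" "j < 2 ^ n" "k < 2 ^ n" "l < 2 ^ n"
    and nz: "i \<noteq> 0" "k \<noteq> 0" and xor: "xor i j = xor k l"
    and \<sigma>: "\<sigma> \<in> {1, - 1}" and \<tau>: "\<tau> \<in> {1, - 1}"
  shows "cd_orthogonal \<gamma> (Suc n) (cd_pair n (cd_e i) (\<sigma> *\<^sub>R cd_e j)) (cd_pair n (cd_e k) (\<tau> *\<^sub>R cd_e l)) \<longleftrightarrow>
    cd_link \<gamma> n i j k l (\<sigma> * \<tau>)"
proof -
  let ?s = "cd_sign \<gamma> n"
  have pair0: "cd_pair n a b = 0 \<longleftrightarrow> a = 0 \<and> b = 0" if "a \<in> cd_carrier n" for a b
  proof
    assume *: "cd_pair n a b = 0"
    from that have "cd_fst n (cd_pair n a b) = a" by simp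
    moreover have "cd_snd n (cd_pair n a b) = b" by simp
    moreover have "cd_fst n 0 = 0" "cd_snd n 0 = 0" by (auto simp: cd_fst_def cd_snd_def)
    ultimately show "a = 0 \<and> b = 0" using * by metis
  qed (auto simp: cd_pair_def)
  have prod: "cd_mult \<gamma> (Suc n) (cd_pair n (cd_e i) (\<sigma> *\<^sub>R cd_e j)) (cd_pair n (cd_e k) (\<tau> *\<^sub>R cd_e l)) = 0 \<longleftrightarrow>
    ?s i k + \<gamma> n * \<sigma> * \<tau> * cj l * ?s l j = 0 \<and> \<tau> * ?s l i - \<sigma> * ?s j k = 0"
    if "i < 2 ^ n" "j < 2 ^ n" "k < 2 ^ n" "l < 2 ^ n" "xor i j = xor k l" "k \<noteq> 0" for i j k l \<sigma> \<tau>
  proof -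
    have eq: "cd_mult \<gamma> (Suc n) (cd_pair n (cd_e i) (\<sigma> *\<^sub>R cd_e j)) (cd_pair n (cd_e k) (\<tau> *\<^sub>R cd_e l)) =
      cd_pair n ((?s i k + \<gamma> n * \<sigma> * \<tau> * cj l * ?s l j) *\<^sub>R cd_e (xor i k))
        ((\<tau> * ?s l i - \<sigma> * ?s j k) *\<^sub>R cd_e (xor j k))"
      using that by (simp add: cd_mult_pair cd_mult_scaleR cd_mult_uminus cd_conj_scaleR cd_conj_e cd_mult_e
          xor_swap_eq[OF that(5)] scaleR_add_left scaleR_diff_left mult_ac del: cd_mult.simps)
    show ?thesis
      unfolding eq using that by (subst pair0) (simp_all add: nat_xor_less_power2)
  qed
  have sgn: "?s i j = 1 \<or> ?s i j = - 1" for i j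
    using cd_sign_sign[of n \<gamma> i j] \<gamma> by auto
  have "cj (xor i k) * ?s i k = - (cj k * ?s k i)" "cj (xor l j) * ?s l j = cj l * cj j * ?s j l"
    using cd_sign_rules[of n \<gamma> i k] cd_sign_rules[of n \<gamma> l j] \<gamma> ijkl nz by simp_all
  moreover have "cj (xor l j) = cj (xor i k)" using xor_swap_eq[OF xor] by simp
  \<comment> \<open>Reversing the factors changes both summands of the first coordinate by the same
    sign \<open>cj (xor i k)\<close>.\<close>
  ultimately have rev: "?s k i = cj (xor i k) * ?s i k" "cj j * ?s j l = cj l * (cj (xor i k) * ?s l j)"
    using nz by (auto simp: cj_def split: if_splits)
  have "?s k i + \<gamma> n * \<tau> * \<sigma> * cj j * ?s j l =
    cj (xor i k) * (?s i k + \<gamma> n * \<sigma> * \<tau> * cj l * ?s l j)"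
    using rev by (simp add: algebra_simps)
  then have "?s k i + \<gamma> n * \<tau> * \<sigma> * cj j * ?s j l = 0 \<longleftrightarrow> ?s i k + \<gamma> n * \<sigma> * \<tau> * cj l * ?s l j = 0"
    by (simp add: cj_def)
  then have "cd_orthogonal \<gamma> (Suc n) (cd_pair n (cd_e i) (\<sigma> *\<^sub>R cd_e j)) (cd_pair n (cd_e k) (\<tau> *\<^sub>R cd_e l)) \<longleftrightarrow>
    ?s i k + \<gamma> n * \<sigma> * \<tau> * cj l * ?s l j = 0 \<and> \<tau> * ?s l i - \<sigma> * ?s j k = 0"
    unfolding cd_orthogonal_def prod[OF ijkl xor nz(2)] prod[OF ijkl(3,4,1,2) xor[symmetric] nz(1)]
    by auto
  also have "\<dots> \<longleftrightarrow> cd_link \<gamma> n i j k l (\<sigma> * \<tau>)"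
  proof -
    have "\<tau> * ?s l i - \<sigma> * ?s j k = 0 \<longleftrightarrow> \<sigma> * \<tau> = ?s l i * ?s j k"
      using sgn[of l i] sgn[of j k] \<sigma> \<tau> by auto
    moreover have "?s i k + \<gamma> n * \<sigma> * \<tau> * cj l * ?s l j = 0 \<longleftrightarrow>
      \<gamma> n * cj l * ?s l j * ?s i k * (\<sigma> * \<tau>) = - 1"
    proof -
      define u where "u = \<gamma> n * \<sigma> * \<tau> * cj l * ?s l j"
      have "u \<in> {1, - 1}"
        unfolding u_def using sgn[of l j] \<gamma>[of n] \<sigma> \<tau> cj_sign[of l] by (intro sign_mult) auto
      then have "?s i k + u = 0 \<longleftrightarrow> u * ?s i k = - 1" using sgn[of i k] by auto
      then show ?thesis by (simp add: u_def mult_ac)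
    qed
    ultimately show ?thesis unfolding cd_link_def by auto
  qed
  finally show ?thesis .
qed

section \<open>Lines with normalised generators\<close>

definition cd_vertex :: "nat \<Rightarrow> nat \<Rightarrow> nat \<Rightarrow> real \<Rightarrow> cd set" where
  "cd_vertex n i j \<sigma> = cd_line n (cd_e i) (\<sigma> *\<^sub>R cd_e j)"

lemma cd_pair_scaleR: "cd_pair n (r *\<^sub>R a) (r *\<^sub>R b) = r *\<^sub>R cd_pair n a b"
  by (auto simp: cd_pair_def)

lemma span_insert_scaleR: "c \<noteq> 0 \<Longrightarrow> span {c *\<^sub>R v} = span {v :: cd}"
proof -
  assume "c \<noteq> 0"
  have "inverse c *\<^sub>R (c *\<^sub>R v) \<in> span {c *\<^sub>R v}" "c *\<^sub>R v \<in> span {v}"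
    by (intro span_scale span_base; simp)+
  then show "span {c *\<^sub>R v} = span {v}"
    using \<open>c \<noteq> 0\<close> by (simp add: span_eq)
qed

lemma cd_line_scaleR:
  assumes "\<sigma> \<in> {1, - 1}"
  shows "cd_line n (\<sigma> *\<^sub>R cd_e i) (\<tau> *\<^sub>R cd_e j) = cd_vertex n i j (\<sigma> * \<tau>)"
proof -
  have "\<sigma> * \<sigma> = 1" using assms by auto
  then have "cd_pair n (\<sigma> *\<^sub>R cd_e i) (\<tau> *\<^sub>R cd_e j) = \<sigma> *\<^sub>R cd_pair n (cd_e i) ((\<sigma> * \<tau>) *\<^sub>R cd_e j)"
    by (simp add: cd_pair_scaleR[symmetric] mult.assoc[symmetric])
  then show ?thesis using assms
    unfolding cd_line_def cd_vertex_def by (metis span_insert_scaleR insertE singletonD zero_neq_neg_one zero_neq_one)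
qed

text \<open>The first entry of the generator carries coefficient 1, so two such generators of one
  line can only differ by the factor 1.\<close>

lemma cd_vertex_eq_iff:
  assumes "i < 2 ^ n" "k < 2 ^ n" "\<sigma> \<noteq> 0"
  shows "cd_vertex n i j \<sigma> = cd_vertex n k l \<tau> \<longleftrightarrow> i = k \<and> j = l \<and> \<sigma> = \<tau>"
proof
  assume "cd_vertex n i j \<sigma> = cd_vertex n k l \<tau>"
  then have "cd_pair n (cd_e i) (\<sigma> *\<^sub>R cd_e j) \<in> span {cd_pair n (cd_e k) (\<tau> *\<^sub>R cd_e l)}"
    unfolding cd_vertex_def cd_line_def using span_base by blast
  then obtain c where "cd_pair n (cd_e i) (\<sigma> *\<^sub>R cd_e j) = c *\<^sub>R cd_pair n (cd_e k) (\<tau> *\<^sub>R cd_e l)"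
    by (auto simp: span_singleton)
  then have *: "cd_pair n (cd_e i) (\<sigma> *\<^sub>R cd_e j) = cd_pair n (c *\<^sub>R cd_e k) ((c * \<tau>) *\<^sub>R cd_e l)"
    by (simp add: cd_pair_scaleR[symmetric])
  have "1 *\<^sub>R cd_e i = c *\<^sub>R cd_e k"
    using arg_cong[OF *, of "cd_fst n"] assms by simp
  moreover have "\<sigma> *\<^sub>R cd_e j = (c * \<tau>) *\<^sub>R cd_e l"
    using arg_cong[OF *, of "cd_snd n"] by simp
  ultimately show "i = k \<and> j = l \<and> \<sigma> = \<tau>"
    using assms(3) by (simp only: scaleR_cd_e_eq_iff) (auto simp: scaleR_cd_e_eq_iff)
qed simp

text \<open>Edges are defined through some choice of generators; homogeneity of the product allows
  any fixed choice.\<close>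

lemma ex_orthogonal_generators_iff:
  "(\<exists>u v. span {p} = span {u} \<and> span {q} = span {v} \<and> cd_orthogonal \<gamma> k u v) \<longleftrightarrow> cd_orthogonal \<gamma> k p q"
proof
  assume "\<exists>u v. span {p} = span {u} \<and> span {q} = span {v} \<and> cd_orthogonal \<gamma> k u v"
  then obtain u v where *: "span {p} = span {u}" "span {q} = span {v}" "cd_orthogonal \<gamma> k u v"
    by blast
  have "p \<in> span {u}" "q \<in> span {v}" using * span_base[of p "{p}"] span_base[of q "{q}"] by auto
  then obtain c d where "p = c *\<^sub>R u" "q = d *\<^sub>R v" by (auto simp: span_singleton)
  then show "cd_orthogonal \<gamma> k p q" using * by (simp add: cd_orthogonal_def cd_mult_scaleR)
qed blast

lemma cd_pair_nonzero: "i < 2 ^ n \<Longrightarrow> cd_pair n (cd_e i) b \<noteq> 0"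
  by (auto simp: fun_eq_iff cd_pair_def cd_e_def intro!: exI[of _ i])

text \<open>Inherited from the symmetry of orthogonality, avoiding a computation with signs. Any two
  signs with product \<open>\<rho>\<close> would serve as coefficients; 1 and \<open>\<rho>\<close>
  are taken.\<close>

lemma cd_link_sym:
  assumes "\<And>l. l \<le> n \<Longrightarrow> \<gamma> l \<in> {1, - 1}"
    and "i < 2 ^ n" "j < 2 ^ n" "k < 2 ^ n" "l < 2 ^ n" "i \<noteq> 0" "k \<noteq> 0" "xor i j = xor k l"
    and "\<rho> \<in> {1, - 1}"
  shows "cd_link \<gamma> n i j k l \<rho> \<longleftrightarrow> cd_link \<gamma> n k l i j \<rho>"
proof -
  have "cd_link \<gamma> n i j k l (1 * \<rho>) \<longleftrightarrow>
    cd_orthogonal \<gamma> (Suc n) (cd_pair n (cd_e i) (1 *\<^sub>R cd_e j)) (cd_pair n (cd_e k) (\<rho> *\<^sub>R cd_e l))"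
    using assms by (intro cd_orthogonal_pair_iff[symmetric]) auto
  also have "\<dots> \<longleftrightarrow>
    cd_orthogonal \<gamma> (Suc n) (cd_pair n (cd_e k) (\<rho> *\<^sub>R cd_e l)) (cd_pair n (cd_e i) (1 *\<^sub>R cd_e j))"
    unfolding cd_orthogonal_def by blast
  also have "\<dots> \<longleftrightarrow> cd_link \<gamma> n k l i j (\<rho> * 1)"
    using assms by (intro cd_orthogonal_pair_iff) auto
  finally show ?thesis by simp
qed

text \<open>For an annihilated pair (c, d) the coordinates couple \<open>c r\<close> only with
  \<open>d (xor r m)\<close>. The resulting 2 by 2 system has determinant n(e_m) - \<gamma>_n up to
  sign, and the hypothesis makes the two terms add up instead of cancelling.\<close>

lemma not_zero_divisor_e_unit:
  assumes \<gamma>: "\<And>l. l \<le> n \<Longrightarrow> \<gamma> l \<in> {1, - 1}"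
    and m: "m < 2 ^ n" and chi: "\<gamma> n * cd_norm \<gamma> n (cd_e m) = - 1" and \<sigma>: "\<sigma> \<in> {1, - 1}"
  shows "\<not> cd_zero_divisor \<gamma> (Suc n) (cd_pair n (cd_e m) (\<sigma> *\<^sub>R cd_e 0))"
proof
  let ?s = "cd_sign \<gamma> n"
  have \<gamma>': "\<And>l. l < n \<Longrightarrow> \<gamma> l \<in> {1, - 1}" using \<gamma> by simp
  have s0: "?s i j \<noteq> 0" for i j using cd_sign_sign[of n \<gamma> i j] \<gamma>' by force
  have N: "\<gamma> n * cj m * ?s m m = - 1" using chi m by (simp add: cd_norm_e mult.assoc)
  \<comment> \<open>The product of the diagonal entries when the pair is the left factor: up to
    conjugation signs it is n(e_m).\<close>
  have key: "?s (xor r m) m * ?s m r * (cj r * cj (xor r m)) = cj m * ?s m m" if "r < 2 ^ n" for r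
  proof -
    have "cj (xor r m) * ?s r m = cj r * cj m * ?s m r" "?s r m * ?s (xor r m) m = ?s m m"
      using cd_sign_rules[of n \<gamma> r m] \<gamma>' that m by simp_all
    moreover have "cj r * cj r = 1" "cj m * cj m = 1" "cj (xor r m) * cj (xor r m) = 1" by (simp_all add: cj_def)
    ultimately show ?thesis by algebra
  qed
  assume "cd_zero_divisor \<gamma> (Suc n) (cd_pair n (cd_e m) (\<sigma> *\<^sub>R cd_e 0))"
  then obtain v where v: "v \<in> cd_carrier (Suc n)" "v \<noteq> 0" and v_mult:
    "cd_mult \<gamma> (Suc n) (cd_pair n (cd_e m) (\<sigma> *\<^sub>R cd_e 0)) v = 0 \<or>
     cd_mult \<gamma> (Suc n) v (cd_pair n (cd_e m) (\<sigma> *\<^sub>R cd_e 0)) = 0"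
    by (auto simp: cd_zero_divisor_def)
  obtain c d where v_eq: "v = cd_pair n c d" and cd: "c \<in> cd_carrier n" "d \<in> cd_carrier n"
    using v(1) by (metis cd_pair_fst_snd cd_fst_carrier cd_snd_carrier)
  have e0: "(0::nat) < 2 ^ n" by simp
  have PQ: "cd_pair n (cd_mult \<gamma> n (cd_e m) c + (\<gamma> n * \<sigma>) *\<^sub>R cd_mult \<gamma> n (cd_conj n d) (cd_e 0))
       (cd_mult \<gamma> n d (cd_e m) + \<sigma> *\<^sub>R cd_mult \<gamma> n (cd_e 0) (cd_conj n c)) = 0 \<or>
     cd_pair n (cd_mult \<gamma> n c (cd_e m) + (\<gamma> n * \<sigma>) *\<^sub>R cd_mult \<gamma> n (cd_e 0) d)
       (\<sigma> *\<^sub>R cd_mult \<gamma> n (cd_e 0) c + cj m *\<^sub>R cd_mult \<gamma> n d (cd_e m)) = 0" (is "?P = 0 \<or> ?Q = 0")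
    using v_mult
    by (simp only: v_eq cd_mult_pair[OF cd_e_carrier[OF m] cd(1)] cd_mult_pair[OF cd(1) cd_e_carrier[OF m]]
        cd_mult_scaleR cd_conj_scaleR cd_conj_e[OF m] cd_conj_e[OF e0] cj_simps scaleR_one scaleR_scaleR)
  have unit: "cd_mult \<gamma> n (cd_e 0) u = u" "cd_mult \<gamma> n u (cd_e 0) = u"
    if "u \<in> cd_carrier n" for u
  proof -
    have "cd_mult \<gamma> n (cd_e 0) u r = u r \<and> cd_mult \<gamma> n u (cd_e 0) r = u r" for r
    proof (cases "r < 2 ^ n")
      case True
      then show ?thesis using that by (simp add: cd_mult_e_coord cd_sign_0)
    next
      case False
      then show ?thesis
        using that cd_mult_carrier[OF that cd_e_carrier[OF e0], of \<gamma>] cd_mult_carrier[OF cd_e_carrier[OF e0] that, of \<gamma>]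
        by (auto simp: cd_carrier_def)
    qed
    then show "cd_mult \<gamma> n (cd_e 0) u = u" "cd_mult \<gamma> n u (cd_e 0) = u"
      by (auto simp: fun_eq_iff)
  qed
  have coord: "cd_pair n a b = 0 \<Longrightarrow> r < 2 ^ n \<Longrightarrow> a r = 0 \<and> b r = 0" for a b r
    by (auto simp: fun_eq_iff cd_pair_def dest: spec[of _ r] spec[of _ "r + 2 ^ n"])
  \<comment> \<open>The first alternative has the given pair as left factor, the second has it as
    right factor.\<close>
  have eqs: "(\<forall>r<2 ^ n. ?s m (xor r m) * c (xor r m) + \<gamma> n * \<sigma> * (cj r * d r) = 0 \<and>
      ?s (xor r m) m * d (xor r m) + \<sigma> * (cj r * c r) = 0) \<or>
    (\<forall>r<2 ^ n. ?s (xor r m) m * c (xor r m) + \<gamma> n * \<sigma> * d r = 0 \<and>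
      \<sigma> * c r + cj m * (?s (xor r m) m * d (xor r m)) = 0)"
    using PQ
  proof (elim disj_forward)
    assume "?P = 0"
    have carrier: "(\<lambda>r. cj r * c r) \<in> cd_carrier n" "(\<lambda>r. cj r * d r) \<in> cd_carrier n"
      using cd by (simp_all add: cd_carrier_def)
    show "\<forall>r<2 ^ n. ?s m (xor r m) * c (xor r m) + \<gamma> n * \<sigma> * (cj r * d r) = 0 \<and>
      ?s (xor r m) m * d (xor r m) + \<sigma> * (cj r * c r) = 0"
    proof (intro allI impI)
      fix r :: nat assume r: "r < 2 ^ n"
      show "?s m (xor r m) * c (xor r m) + \<gamma> n * \<sigma> * (cj r * d r) = 0 \<and>
        ?s (xor r m) m * d (xor r m) + \<sigma> * (cj r * c r) = 0"
        using coord[OF \<open>?P = 0\<close> r] m cd carrier r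
        by (simp add: unit cd_conj_coord[OF cd(1)] cd_conj_coord[OF cd(2)] cd_mult_e_coord)
    qed
  next
    assume "?Q = 0"
    show "\<forall>r<2 ^ n. ?s (xor r m) m * c (xor r m) + \<gamma> n * \<sigma> * d r = 0 \<and>
      \<sigma> * c r + cj m * (?s (xor r m) m * d (xor r m)) = 0"
    proof (intro allI impI)
      fix r :: nat assume r: "r < 2 ^ n"
      show "?s (xor r m) m * c (xor r m) + \<gamma> n * \<sigma> * d r = 0 \<and>
        \<sigma> * c r + cj m * (?s (xor r m) m * d (xor r m)) = 0"
        using coord[OF \<open>?Q = 0\<close> r] m cd r by (simp add: unit cd_mult_e_coord)
    qed
  qed
  have sq: "\<gamma> n * \<gamma> n = 1" "\<sigma> * \<sigma> = 1" using \<gamma>[of n] \<sigma> by auto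
  have cj2: "cj r * cj r = 1" for r by (simp add: cj_def)
  have c0: "c r = 0" if r: "r < 2 ^ n" for r
  proof -
    \<comment> \<open>The first equation at \<open>r'\<close> and the second one at \<open>r\<close>
      involve only \<open>c r\<close> and \<open>d r'\<close>.\<close>
    define r' where "r' = xor r m"
    have r': "r' < 2 ^ n" "xor r' m = r" using r m by (simp_all add: r'_def nat_xor_less_power2)
    have k: "?s r' m * ?s m r * (cj r * cj r') = cj m * ?s m m" "?s r m * ?s r' m = ?s m m"
      using key[OF r] cd_sign_rules[of n \<gamma> r m] \<gamma>' r m by (simp_all add: r'_def)
    show ?thesis
      using eqs
    proof
      assume *: "\<forall>r<2 ^ n. ?s m (xor r m) * c (xor r m) + \<gamma> n * \<sigma> * (cj r * d r) = 0 \<and>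
        ?s (xor r m) m * d (xor r m) + \<sigma> * (cj r * c r) = 0"
      have "?s m r * c r + \<gamma> n * \<sigma> * (cj r' * d r') = 0" "?s r' m * d r' + \<sigma> * (cj r * c r) = 0"
        using *[rule_format, OF r'(1)] *[rule_format, OF r] by (simp_all add: r' r'_def[symmetric])
      then show ?thesis
        using k(1) N sq cj2[of r] cj2[of r'] by algebra
    next
      assume *: "\<forall>r<2 ^ n. ?s (xor r m) m * c (xor r m) + \<gamma> n * \<sigma> * d r = 0 \<and>
        \<sigma> * c r + cj m * (?s (xor r m) m * d (xor r m)) = 0"
      have "?s r m * c r + \<gamma> n * \<sigma> * d r' = 0" "\<sigma> * c r + cj m * (?s r' m * d r') = 0"
        using *[rule_format, OF r'(1)] *[rule_format, OF r] by (simp_all add: r' r'_def[symmetric])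
      then show ?thesis
        using k(2) N sq by algebra
    qed
  qed
  have zero: "c r = 0 \<and> d r = 0" if r: "r < 2 ^ n" for r
  proof -
    have "c (xor r m) = 0" using r m by (intro c0 nat_xor_less_power2)
    then show ?thesis
      using eqs c0[OF r] r sq cj2[of r] by (auto dest!: spec[of _ r])
  qed
  have "v r = 0" for r
  proof (cases "r < 2 ^ n")
    case True
    then show ?thesis using zero by (simp add: v_eq cd_pair_def)
  next
    case False
    then show ?thesis using zero[of "r - 2 ^ n"] cd(2) by (cases "r - 2 ^ n < 2 ^ n") (auto simp: v_eq cd_pair_def cd_carrier_def)
  qed
  then have "v = 0" by auto
  then show False using v by simp
qed

section \<open>The subgraphs \<open>C(y)\<close>\<close>

lemma sum_fun_apply: "(\<Sum>v\<in>A. f v) i = (\<Sum>v\<in>A. f v i)" for f :: "'a \<Rightarrow> 'b \<Rightarrow> 'c :: comm_monoid_add"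
  by (induction A rule: infinite_finite_induct) simp_all

lemma lin_indep_basis:
  assumes "distinct (map fst ps)" "\<forall>(i, \<sigma>)\<in>set ps. \<sigma> \<noteq> 0"
  shows "lin_indep (map (\<lambda>(i, \<sigma>). \<sigma> *\<^sub>R cd_e i) ps)"
proof -
  let ?f = "\<lambda>(i, \<sigma>). \<sigma> *\<^sub>R cd_e i"
  have inj: "inj_on ?f (set ps)"
    using assms(2) by (auto simp: inj_on_def scaleR_cd_e_eq_iff split: prod.splits)
  have unique: "p = q" if "p \<in> set ps" "q \<in> set ps" "fst p = fst q" for p q
    using assms(1) that by (auto simp: distinct_map inj_on_def)
  have "independent (?f ` set ps)"
    unfolding dependent_finite[OF finite_imageI[OF finite_set]]
  proof (rule notI, elim exE conjE bexE)
    fix u v assume sum: "(\<Sum>v\<in>?f ` set ps. u v *\<^sub>R v) = 0" and v: "v \<in> ?f ` set ps" and u: "u v \<noteq> 0"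
    obtain i \<sigma> where i: "(i, \<sigma>) \<in> set ps" "v = \<sigma> *\<^sub>R cd_e i" using v by auto
    have "0 = (\<Sum>v\<in>?f ` set ps. u v *\<^sub>R v) i" using sum by simp
    also have "\<dots> = (\<Sum>v\<in>?f ` set ps. u v * v i)" by (simp add: sum_fun_apply)
    also have "\<dots> = (\<Sum>v'\<in>{v}. u v' * v' i)"
    proof (rule sum.mono_neutral_right)
      show "\<forall>v'\<in>?f ` set ps - {v}. u v' * v' i = 0"
      proof
        fix v' assume v': "v' \<in> ?f ` set ps - {v}"
        then obtain j \<tau> where j: "(j, \<tau>) \<in> set ps" "v' = \<tau> *\<^sub>R cd_e j" by auto
        have "j \<noteq> i" using unique[OF j(1) i(1)] j(2) i(2) v' by auto
        then show "u v' * v' i = 0" by (simp add: j(2) cd_e_def)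
      qed
    qed (use v in auto)
    also have "\<dots> = u v * \<sigma>" by (simp add: i(2) cd_e_def)
    finally show False using u assms(2) i(1) by auto
  qed
  moreover have "distinct (map ?f ps)"
    using assms(1) inj by (simp add: distinct_map)
  ultimately show ?thesis by (simp add: lin_indep_def)
qed

lemma lin_indep_neq:
  assumes "lin_indep vs" "r < length vs" "s < length vs" "r \<noteq> s" "vs ! r = \<sigma> *\<^sub>R cd_e i" "vs ! s = \<tau> *\<^sub>R cd_e j"
    "\<sigma> \<in> {1, - 1}" "\<tau> \<in> {1, - 1}"
  shows "i \<noteq> j"
proof
  assume "i = j"
  let ?u = "vs ! r" and ?v = "vs ! s"
  have "distinct vs" "independent (set vs)" using assms(1) by (simp_all add: lin_indep_def)
  then have "?u \<noteq> ?v" using nth_eq_iff_index_eq[of vs r s] assms(2-4) by blast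
  have "?u = (\<sigma> * \<tau>) *\<^sub>R ?v" using assms(5-8) \<open>i = j\<close> by auto
  then have "?u \<in> span {?v}" by (auto simp: span_singleton)
  then have "?u \<in> span (set vs - {?u})"
    using span_mono[of "{?v}" "set vs - {?u}"] assms(3) \<open>?u \<noteq> ?v\<close> by auto
  then show False using \<open>independent (set vs)\<close> assms(2) unfolding dependent_def by auto
qed

lemma plus_minus_iff: "b \<in> plus_minus S \<longleftrightarrow> (\<exists>a\<in>S. \<exists>\<sigma>\<in>{1, - 1}. b = \<sigma> *\<^sub>R a)"
  by (auto simp: plus_minus_def)

lemma cd_basis_iff: "a \<in> cd_basis k \<longleftrightarrow> (\<exists>i<2 ^ k. a = cd_e i)"
  by (auto simp: cd_basis_def)

lemma cd_basis'_iff: "a \<in> cd_basis' k \<longleftrightarrow> (\<exists>i<2 ^ k. i \<noteq> 0 \<and> a = cd_e i)"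
  by (auto simp: cd_basis'_def cd_basis_iff)

lemma plus_minus_basis_iff:
  "b \<in> plus_minus (cd_basis k) \<longleftrightarrow> (\<exists>i \<sigma>. i < 2 ^ k \<and> \<sigma> \<in> {1, - 1} \<and> b = \<sigma> *\<^sub>R cd_e i)"
  "b \<in> plus_minus (cd_basis' k) \<longleftrightarrow> (\<exists>i \<sigma>. i < 2 ^ k \<and> i \<noteq> 0 \<and> \<sigma> \<in> {1, - 1} \<and> b = \<sigma> *\<^sub>R cd_e i)"
  unfolding plus_minus_iff Bex_def cd_basis_iff cd_basis'_iff by auto

lemma scaleR_cd_e_pm_iff:
  assumes "r \<in> {1, - 1}"
  shows "r *\<^sub>R cd_e i \<in> {cd_e m, - cd_e m} \<longleftrightarrow> i = m"
proof -
  have "cd_e m = 1 *\<^sub>R cd_e m" "- cd_e m = (- 1) *\<^sub>R cd_e m" by simp_all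
  then show ?thesis using assms scaleR_cd_e_eq_iff[of r i] by (metis insert_iff singletonD zero_neq_one zero_neq_neg_one)
qed

lemma cd_mult_pm_iff:
  assumes "\<And>l. l < k \<Longrightarrow> \<gamma> l \<in> {1, - 1}" "i < 2 ^ k" "j < 2 ^ k" "\<sigma> \<in> {1, - 1}" "\<tau> \<in> {1, - 1}"
  shows "cd_mult \<gamma> k (\<sigma> *\<^sub>R cd_e i) (\<tau> *\<^sub>R cd_e j) \<in> {cd_e m, - cd_e m} \<longleftrightarrow> j = xor i m"
proof -
  have "cd_mult \<gamma> k (\<sigma> *\<^sub>R cd_e i) (\<tau> *\<^sub>R cd_e j) = (\<sigma> * \<tau> * cd_sign \<gamma> k i j) *\<^sub>R cd_e (xor i j)"
    using assms by (simp add: cd_mult_scaleR cd_mult_e)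
  moreover have "\<sigma> * \<tau> * cd_sign \<gamma> k i j \<in> {1, - 1}"
    by (intro sign_mult assms cd_sign_sign)
  moreover have "xor i j = m \<longleftrightarrow> j = xor i m" by auto
  ultimately show ?thesis by (simp only: scaleR_cd_e_pm_iff)
qed

text \<open>Multiplicativity of the norm on basis elements, n(e_i e_j) n(e_j) = n(e_i), as all norms
  are 1 or -1. It fails for arbitrary elements of higher levels but follows here from the
  cancellation laws.\<close>

lemma cd_sign_norm:
  assumes "\<And>l. l < k \<Longrightarrow> \<gamma> l \<in> {1, - 1}" "i < 2 ^ k" "j < 2 ^ k"
  shows "cj (xor i j) * cd_sign \<gamma> k (xor i j) (xor i j) * (cj j * cd_sign \<gamma> k j j) = cj i * cd_sign \<gamma> k i i"
proof -
  let ?s = "cd_sign \<gamma> k" and ?x = "xor i j"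
  have x: "?x < 2 ^ k" using assms by (simp add: nat_xor_less_power2)
  have xx: "?s ?x ?x = ?s ?x j * ?s ?x i"
    using cd_sign_rules[OF assms(1) x assms(3)] by simp
  have ii: "?s i i = ?s j i * ?s ?x i" and ji: "cj ?x * ?s j i = cj j * cj i * ?s i j"
    using cd_sign_rules[OF assms(1,3,2)] by (simp_all add: xor.commute[of j i])
  have jj: "?s j j = ?s i j * ?s ?x j"
    using cd_sign_rules[OF assms] by simp
  have sq: "?s i' j' * ?s i' j' = 1" for i' j'
    using cd_sign_sign[of k \<gamma> i' j', OF assms(1)] by auto
  have cj2: "cj i' * cj i' = 1" for i' by (simp add: cj_def)
  have "cj ?x * ?s ?x ?x * (cj j * ?s j j) =
      (cj ?x * ?s j i) * ?s j i * cj j * (?s ?x j * ?s ?x j) * ?s ?x i * ?s i j"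
    using sq[of j i] by (simp add: xx jj mult_ac)
  also have "\<dots> = (cj j * cj j) * (?s i j * ?s i j) * (?s ?x j * ?s ?x j) * cj i * (?s j i * ?s ?x i)"
    by (simp only: ji mult_ac)
  finally show ?thesis by (simp add: sq cj2 ii)
qed

lemma edges_subset_eq:
  "{e \<in> {{u, v} | u v. u \<in> A \<and> v \<in> A \<and> u \<noteq> v \<and> Q u v}. e \<subseteq> W} =
   {{u, v} | u v. u \<in> A \<inter> W \<and> v \<in> A \<inter> W \<and> u \<noteq> v \<and> Q u v}"
  by blast

section \<open>Vertices, edges and characteristic of C(e_m) by index and sign\<close>

context
  fixes \<gamma> :: "nat \<Rightarrow> real" and n m :: nat
  assumes \<gamma>_sign: "\<forall>l\<le>n. \<gamma> l \<in> {1, - 1}" and m: "m < 2 ^ n"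
begin

private lemma \<gamma>: "l \<le> n \<Longrightarrow> \<gamma> l \<in> {1, - 1}"
  using \<gamma>_sign by blast

text \<open>For a fixed product e_m up to sign the second index is forced, so a vertex is a nonzero
  first index together with a sign.\<close>

abbreviation (input) "vx i \<sigma> \<equiv> cd_vertex n i (xor i m) \<sigma>"

lemma Gamma_e_verts_eq:
  "Gamma_e_verts \<gamma> n = {cd_vertex n i j \<sigma> | i j \<sigma>. i < 2 ^ n \<and> i \<noteq> 0 \<and> j < 2 ^ n \<and> \<sigma> \<in> {1, - 1} \<and>
     cd_zero_divisor \<gamma> (Suc n) (cd_pair n (cd_e i) (\<sigma> *\<^sub>R cd_e j))}"
  unfolding Gamma_e_verts_def cd_vertex_def plus_minus_basis_iff cd_basis'_iff by blast

lemma C_lines_eq: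
  "{cd_line n a b | a b. a \<in> cd_basis' n \<and> b \<in> plus_minus (cd_basis n) \<and>
        cd_mult \<gamma> n a b \<in> {cd_e m, - cd_e m}} = {vx i \<sigma> | i \<sigma>. i < 2 ^ n \<and> i \<noteq> 0 \<and> \<sigma> \<in> {1, - 1}}"
proof -
  have *: "cd_mult \<gamma> n (cd_e i) (\<tau> *\<^sub>R cd_e j) \<in> {cd_e m, - cd_e m} \<longleftrightarrow> j = xor i m"
    if "i < 2 ^ n" "j < 2 ^ n" "\<tau> \<in> {1, - 1}" for i j \<tau>
    using cd_mult_pm_iff[of n \<gamma> i j 1 \<tau> m] \<gamma> that by simp
  show ?thesis
  proof (intro equalityI subsetI)
    fix K assume "K \<in> {cd_line n a b | a b. a \<in> cd_basis' n \<and> b \<in> plus_minus (cd_basis n) \<and>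
        cd_mult \<gamma> n a b \<in> {cd_e m, - cd_e m}}"
    then obtain i j \<tau> where "i < 2 ^ n" "i \<noteq> 0" "j < 2 ^ n" "\<tau> \<in> {1, - 1}"
      "K = cd_line n (cd_e i) (\<tau> *\<^sub>R cd_e j)" "cd_mult \<gamma> n (cd_e i) (\<tau> *\<^sub>R cd_e j) \<in> {cd_e m, - cd_e m}"
      unfolding plus_minus_basis_iff cd_basis'_iff by blast
    then show "K \<in> {vx i \<sigma> | i \<sigma>. i < 2 ^ n \<and> i \<noteq> 0 \<and> \<sigma> \<in> {1, - 1}}"
      unfolding cd_vertex_def using * by blast
  next
    fix K assume "K \<in> {vx i \<sigma> | i \<sigma>. i < 2 ^ n \<and> i \<noteq> 0 \<and> \<sigma> \<in> {1, - 1}}"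
    then obtain i \<tau> where i: "i < 2 ^ n" "i \<noteq> 0" "\<tau> \<in> {1, - 1}"
      "K = cd_line n (cd_e i) (\<tau> *\<^sub>R cd_e (xor i m))"
      unfolding cd_vertex_def by blast
    have "xor i m < 2 ^ n" using i m by (simp add: nat_xor_less_power2)
    then show "K \<in> {cd_line n a b | a b. a \<in> cd_basis' n \<and> b \<in> plus_minus (cd_basis n) \<and>
        cd_mult \<gamma> n a b \<in> {cd_e m, - cd_e m}}"
      using i *[of i "xor i m" \<tau>] unfolding plus_minus_basis_iff cd_basis'_iff by blast
  qed
qed

text \<open>The zero divisor condition stays unresolved here. It is decided later, either by
  exhibiting a neighbour or by \<open>not_zero_divisor_e_unit\<close>.\<close>

lemma cd_C_verts:
  "gverts (cd_C \<gamma> n (cd_e m)) = {vx i \<sigma> | i \<sigma>. i < 2 ^ n \<and> i \<noteq> 0 \<and> \<sigma> \<in> {1, - 1} \<and>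
     cd_zero_divisor \<gamma> (Suc n) (cd_pair n (cd_e i) (\<sigma> *\<^sub>R cd_e (xor i m)))}"
proof -
  have inj: "k = i \<and> l = xor i m \<and> \<tau> = \<sigma>"
    if "vx i \<sigma> = cd_vertex n k l \<tau>" "i < 2 ^ n" "k < 2 ^ n" "\<sigma> \<in> {1, - 1}" for i k l \<sigma> \<tau>
    using that cd_vertex_eq_iff[of i n k \<sigma> "xor i m" l \<tau>] by auto
  have less: "xor i m < 2 ^ n" if "i < 2 ^ n" for i using that m by (rule nat_xor_less_power2)
  have "gverts (cd_C \<gamma> n (cd_e m)) =
    Gamma_e_verts \<gamma> n \<inter> {vx i \<sigma> | i \<sigma>. i < 2 ^ n \<and> i \<noteq> 0 \<and> \<sigma> \<in> {1, - 1}}"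
    unfolding cd_C_def induced_def Gamma_e_def C_lines_eq by simp
  also have "\<dots> = {vx i \<sigma> | i \<sigma>. i < 2 ^ n \<and> i \<noteq> 0 \<and> \<sigma> \<in> {1, - 1} \<and>
     cd_zero_divisor \<gamma> (Suc n) (cd_pair n (cd_e i) (\<sigma> *\<^sub>R cd_e (xor i m)))}" (is "_ = ?R")
  proof (intro equalityI subsetI)
    fix K assume K: "K \<in> Gamma_e_verts \<gamma> n \<inter> {vx i \<sigma> | i \<sigma>. i < 2 ^ n \<and> i \<noteq> 0 \<and> \<sigma> \<in> {1, - 1}}"
    then obtain i \<sigma> where i: "K = vx i \<sigma>" "i < 2 ^ n" "i \<noteq> 0" "\<sigma> \<in> {1, - 1}" by blast
    from K obtain k l \<tau> where k: "K = cd_vertex n k l \<tau>" "k < 2 ^ n" "\<tau> \<in> {1, - 1}"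
      "cd_zero_divisor \<gamma> (Suc n) (cd_pair n (cd_e k) (\<tau> *\<^sub>R cd_e l))"
      unfolding Gamma_e_verts_eq by blast
    have "k = i \<and> l = xor i m \<and> \<tau> = \<sigma>" by (rule inj) (use i k in simp_all)
    then show "K \<in> ?R" using i k by blast
  next
    fix K assume "K \<in> ?R"
    then show "K \<in> Gamma_e_verts \<gamma> n \<inter> {vx i \<sigma> | i \<sigma>. i < 2 ^ n \<and> i \<noteq> 0 \<and> \<sigma> \<in> {1, - 1}}"
      unfolding Gamma_e_verts_eq using less by blast
  qed
  finally show ?thesis .
qed

lemma vx_orthogonal_iff:
  assumes "i < 2 ^ n" "i \<noteq> 0" "k < 2 ^ n" "k \<noteq> 0" "\<sigma> \<in> {1, - 1}" "\<tau> \<in> {1, - 1}"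
  shows "(\<exists>u v. vx i \<sigma> = span {u} \<and> vx k \<tau> = span {v} \<and> cd_orthogonal \<gamma> (Suc n) u v) \<longleftrightarrow>
    cd_link \<gamma> n i (xor i m) k (xor k m) (\<sigma> * \<tau>)"
  unfolding cd_vertex_def cd_line_def ex_orthogonal_generators_iff
  using assms m \<gamma> by (intro cd_orthogonal_pair_iff) (auto simp: nat_xor_less_power2)

text \<open>An orthogonal partner is itself a witness of being a zero divisor, so a link alone makes
  both ends vertices.\<close>

lemma cd_C_verts_link:
  assumes "i < 2 ^ n" "i \<noteq> 0" "k < 2 ^ n" "k \<noteq> 0" "\<sigma> \<in> {1, - 1}" "\<tau> \<in> {1, - 1}"
    and "cd_link \<gamma> n i (xor i m) k (xor k m) (\<sigma> * \<tau>)"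
  shows "vx i \<sigma> \<in> gverts (cd_C \<gamma> n (cd_e m))" "vx k \<tau> \<in> gverts (cd_C \<gamma> n (cd_e m))"
proof -
  have "cd_orthogonal \<gamma> (Suc n) (cd_pair n (cd_e i) (\<sigma> *\<^sub>R cd_e (xor i m))) (cd_pair n (cd_e k) (\<tau> *\<^sub>R cd_e (xor k m)))"
    using assms vx_orthogonal_iff[OF assms(1-6)]
    unfolding cd_vertex_def cd_line_def ex_orthogonal_generators_iff by simp
  moreover have "xor i m < 2 ^ n" "xor k m < 2 ^ n" using assms m by (auto intro: nat_xor_less_power2)
  then have "cd_pair n (cd_e i) (\<sigma> *\<^sub>R cd_e (xor i m)) \<in> cd_carrier (Suc n)"
    "cd_pair n (cd_e k) (\<tau> *\<^sub>R cd_e (xor k m)) \<in> cd_carrier (Suc n)" by simp_all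
  ultimately have "cd_zero_divisor \<gamma> (Suc n) (cd_pair n (cd_e i) (\<sigma> *\<^sub>R cd_e (xor i m)))"
    "cd_zero_divisor \<gamma> (Suc n) (cd_pair n (cd_e k) (\<tau> *\<^sub>R cd_e (xor k m)))"
    unfolding cd_zero_divisor_def cd_orthogonal_def using cd_pair_nonzero assms by blast+
  then show "vx i \<sigma> \<in> gverts (cd_C \<gamma> n (cd_e m))" "vx k \<tau> \<in> gverts (cd_C \<gamma> n (cd_e m))"
    unfolding cd_C_verts using assms by blast+
qed

lemma cd_C_edges:
  "gedges (cd_C \<gamma> n (cd_e m)) = {{vx i \<sigma>, vx k \<tau>} | i \<sigma> k \<tau>. i < 2 ^ n \<and> i \<noteq> 0 \<and> k < 2 ^ n \<and> k \<noteq> 0 \<and>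
     \<sigma> \<in> {1, - 1} \<and> \<tau> \<in> {1, - 1} \<and> i \<noteq> k \<and> cd_link \<gamma> n i (xor i m) k (xor k m) (\<sigma> * \<tau>)}"
    (is "?E = ?R")
proof (intro equalityI subsetI)
  have C: "gverts (cd_C \<gamma> n (cd_e m)) =
    Gamma_e_verts \<gamma> n \<inter> {vx i \<sigma> | i \<sigma>. i < 2 ^ n \<and> i \<noteq> 0 \<and> \<sigma> \<in> {1, - 1}}"
    unfolding cd_C_def induced_def Gamma_e_def C_lines_eq by simp
  have E: "?E = {{K, L} | K L. K \<in> gverts (cd_C \<gamma> n (cd_e m)) \<and> L \<in> gverts (cd_C \<gamma> n (cd_e m)) \<and> K \<noteq> L \<and>
     (\<exists>u v. K = span {u} \<and> L = span {v} \<and> cd_orthogonal \<gamma> (Suc n) u v)}"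
    unfolding C unfolding cd_C_def induced_def Gamma_e_def C_lines_eq snd_conv
    by (rule edges_subset_eq)
  {
    fix e assume "e \<in> ?E"
    then obtain K L where e: "e = {K, L}" "K \<noteq> L" "K \<in> gverts (cd_C \<gamma> n (cd_e m))"
      "L \<in> gverts (cd_C \<gamma> n (cd_e m))"
      and o: "\<exists>u v. K = span {u} \<and> L = span {v} \<and> cd_orthogonal \<gamma> (Suc n) u v"
      unfolding E by blast
    then obtain i \<sigma> k \<tau> where K: "K = vx i \<sigma>" "i < 2 ^ n" "i \<noteq> 0" "\<sigma> \<in> {1, - 1}"
      and L: "L = vx k \<tau>" "k < 2 ^ n" "k \<noteq> 0" "\<tau> \<in> {1, - 1}" unfolding cd_C_verts by blast
    have link: "cd_link \<gamma> n i (xor i m) k (xor k m) (\<sigma> * \<tau>)"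
      using o K L vx_orthogonal_iff[of i k \<sigma> \<tau>] by simp
    \<comment> \<open>With equal first indices the second indices agree as well, so the first
      equation of \<open>cd_link\<close> is the square of a sign and forces equal coefficients: the
      two lines would coincide.\<close>
    have "i \<noteq> k"
    proof
      assume ik: "i = k"
      have "cd_sign \<gamma> n (xor k m) k \<in> {1, - 1}" by (rule cd_sign_sign, rule \<gamma>) simp
      then have "\<sigma> * \<tau> = 1" using link unfolding ik cd_link_def by auto
      then have "\<sigma> = \<tau>" using K(4) L(4) by auto
      then show False using e(2) K(1) L(1) ik by simp
    qed
    then show "e \<in> ?R" using e K L link by blast
  next
    fix e assume "e \<in> ?R"
    then obtain i \<sigma> k \<tau> where e: "e = {vx i \<sigma>, vx k \<tau>}" and *: "i < 2 ^ n" "i \<noteq> 0" "k < 2 ^ n" "k \<noteq> 0"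
     "\<sigma> \<in> {1, - 1}" "\<tau> \<in> {1, - 1}" "cd_link \<gamma> n i (xor i m) k (xor k m) (\<sigma> * \<tau>)" and ik: "i \<noteq> k" by blast
    have "vx i \<sigma> \<noteq> vx k \<tau>"
      using ik * by (subst cd_vertex_eq_iff) auto
    then show "e \<in> ?E"
      unfolding E e using cd_C_verts_link[OF *] vx_orthogonal_iff[OF *(1-6), THEN iffD2, OF *(7)]
      by (intro CollectI exI[of _ "vx i \<sigma>"] exI[of _ "vx k \<tau>"] conjI refl)
  }
qed

lemma cd_C_edge_iff:
  assumes "i < 2 ^ n" "i \<noteq> 0" "k < 2 ^ n" "k \<noteq> 0" "\<sigma> \<in> {1, - 1}" "\<tau> \<in> {1, - 1}"
  shows "{vx i \<sigma>, vx k \<tau>} \<in> gedges (cd_C \<gamma> n (cd_e m)) \<longleftrightarrow>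
    i \<noteq> k \<and> cd_link \<gamma> n i (xor i m) k (xor k m) (\<sigma> * \<tau>)"
proof
  assume "{vx i \<sigma>, vx k \<tau>} \<in> gedges (cd_C \<gamma> n (cd_e m))"
  then obtain i' \<sigma>' k' \<tau>' where e: "{vx i \<sigma>, vx k \<tau>} = {vx i' \<sigma>', vx k' \<tau>'}"
    and *: "i' < 2 ^ n" "i' \<noteq> 0" "k' < 2 ^ n" "k' \<noteq> 0"
     "\<sigma>' \<in> {1, - 1}" "\<tau>' \<in> {1, - 1}" "i' \<noteq> k'" "cd_link \<gamma> n i' (xor i' m) k' (xor k' m) (\<sigma>' * \<tau>')"
    unfolding cd_C_edges mem_Collect_eq by (elim exE conjE) (rule that)
  have inj: "vx i \<sigma> = vx k \<tau> \<longleftrightarrow> i = k \<and> \<sigma> = \<tau>"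
    if "i < 2 ^ n" "k < 2 ^ n" "\<sigma> \<in> {1, - 1}" for i k \<sigma> \<tau>
    using that by (subst cd_vertex_eq_iff) auto
  have "i = i' \<and> \<sigma> = \<sigma>' \<and> k = k' \<and> \<tau> = \<tau>' \<or> i = k' \<and> \<sigma> = \<tau>' \<and> k = i' \<and> \<tau> = \<sigma>'"
    using e inj[OF assms(1) *(1) assms(5)] inj[OF assms(1) *(3) assms(5)]
      inj[OF assms(3) *(1) assms(6)] inj[OF assms(3) *(3) assms(6)]
    unfolding doubleton_eq_iff by (elim disjE conjE; simp)
  \<comment> \<open>An edge is unordered, so the representation obtained may list its ends in the
    opposite order.\<close>
  moreover have "cd_link \<gamma> n k' (xor k' m) i' (xor i' m) (\<tau>' * \<sigma>')"
  proof -
    have "xor i' m < 2 ^ n" "xor k' m < 2 ^ n" "xor i' (xor i' m) = xor k' (xor k' m)"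
      "\<tau>' * \<sigma>' \<in> {1, - 1}"
      using * m by (simp_all only: nat_xor_less_power2 nat_xor_cancel sign_mult)
    then have "cd_link \<gamma> n i' (xor i' m) k' (xor k' m) (\<tau>' * \<sigma>') \<longleftrightarrow>
        cd_link \<gamma> n k' (xor k' m) i' (xor i' m) (\<tau>' * \<sigma>')"
      using * by (intro cd_link_sym \<gamma>)
    then show ?thesis using *(8) by (simp only: mult.commute[of \<tau>' \<sigma>'])
  qed
  ultimately show "i \<noteq> k \<and> cd_link \<gamma> n i (xor i m) k (xor k m) (\<sigma> * \<tau>)"
    using * by auto
next
  assume "i \<noteq> k \<and> cd_link \<gamma> n i (xor i m) k (xor k m) (\<sigma> * \<tau>)"
  then show "{vx i \<sigma>, vx k \<tau>} \<in> gedges (cd_C \<gamma> n (cd_e m))"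
    unfolding cd_C_edges using assms by blast
qed

text \<open>If ab is e_m up to sign, then n(a) / n(b) = n(e_m) by \<open>cd_sign_norm\<close>, which
  does not depend on the pair.\<close>

lemma cd_chi_eq: "cd_chi \<gamma> n (cd_e m) = \<gamma> n * cd_norm \<gamma> n (cd_e m)"
proof -
  have chi: "\<gamma> n * cd_norm \<gamma> n a / cd_norm \<gamma> n b = \<gamma> n * cd_norm \<gamma> n (cd_e m)"
    if a: "a \<in> plus_minus (cd_basis n)" and b: "b \<in> plus_minus (cd_basis n)"
      and "cd_mult \<gamma> n a b \<in> {cd_e m, - cd_e m}" for a b
  proof -
    obtain i \<sigma> j \<tau> where a: "i < 2 ^ n" "\<sigma> \<in> {1, - 1}" "a = \<sigma> *\<^sub>R cd_e i"
      and b: "j < 2 ^ n" "\<tau> \<in> {1, - 1}" "b = \<tau> *\<^sub>R cd_e j"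
      using a b unfolding plus_minus_basis_iff by blast
    have j: "j = xor i m"
      using that(3) cd_mult_pm_iff[of n \<gamma> i j \<sigma> \<tau> m] \<gamma> a b by simp
    let ?s = "cd_sign \<gamma> n"
    have sq: "\<sigma>\<^sup>2 = 1" "\<tau>\<^sup>2 = 1" using a b by auto
    have \<gamma>': "\<And>l. l < n \<Longrightarrow> \<gamma> l \<in> {1, - 1}" using \<gamma> by simp
    have N: "cj j * ?s j j = 1 \<or> cj j * ?s j j = - 1"
      using sign_mult[OF cj_sign cd_sign_sign[of n \<gamma> j j]] \<gamma>' by auto
    have "xor j m = i" using j by simp
    then have "cj i * ?s i i * (cj m * ?s m m) = cj j * ?s j j"
      using cd_sign_norm[of n \<gamma> j m] \<gamma>' b(1) m by simp
    moreover have "cj m * ?s m m * (cj m * ?s m m) = 1"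
      using sign_mult[OF cj_sign[of m] cd_sign_sign[of n \<gamma> m m]] \<gamma>' by auto
    ultimately have "cj i * ?s i i = cj j * ?s j j * (cj m * ?s m m)" by algebra
    then show ?thesis
      using a b m N by (auto simp: cd_norm_scaleR sq cd_norm_e)
  qed
  show ?thesis
    unfolding cd_chi_def
  proof (rule the_equality)
    fix c assume c: "\<forall>a\<in>plus_minus (cd_basis n). \<forall>b\<in>plus_minus (cd_basis n).
      cd_mult \<gamma> n a b \<in> {cd_e m, - cd_e m} \<longrightarrow> \<gamma> n * cd_norm \<gamma> n a / cd_norm \<gamma> n b = c"
    \<comment> \<open>The pair (e_m, e_0) shows that the condition on the common value is not
      vacuous, which gives uniqueness.\<close>
    have "cd_e m \<in> plus_minus (cd_basis n)" "cd_e 0 \<in> plus_minus (cd_basis n)"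
      unfolding plus_minus_basis_iff
      by (intro exI[of _ m] exI[of _ 1] conjI; simp add: m) (intro exI[of _ 0] exI[of _ 1] conjI; simp)
    moreover have "cd_mult \<gamma> n (cd_e m) (cd_e 0) \<in> {cd_e m, - cd_e m}"
      using m by (simp add: cd_mult_e cd_sign_0)
    ultimately show "c = \<gamma> n * cd_norm \<gamma> n (cd_e m)" using c chi by metis
  qed (use chi in blast)
qed

end

section \<open>Graphs glued from hexagons\<close>

lemma join_edges_doubletons: "join_edges {a, b} {c, d} = {{a, c}, {a, d}, {b, c}, {b, d}}"
  by (auto simp: join_edges_def)

lemma less_6_cases: "m < 6 \<longleftrightarrow> m \<in> {0, 1, 2, 3, 4, 5 :: nat}" by auto
lemma less_7_cases: "m < 7 \<longleftrightarrow> m \<in> {0, 1, 2, 3, 4, 5, 6 :: nat}" by auto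

lemma all_less_6: "(\<forall>i<(6::nat). P i) \<longleftrightarrow> P 0 \<and> P 1 \<and> P 2 \<and> P 3 \<and> P 4 \<and> P 5"
  unfolding less_6_cases by blast

lemma Union_lessThan_6: "(\<Union>i<(6::nat). A i) = A 0 \<union> (A 1 \<union> (A 2 \<union> (A 3 \<union> (A 4 \<union> A 5))))"
proof -
  have "{..<6::nat} = {0, 1, 2, 3, 4, 5}" by auto
  then show ?thesis by simp
qed

lemma cyclic_join_edges_6:
  "cyclic_join_edges [a, b, c, d, e, f] = join_edges a b \<union> (join_edges b c \<union> (join_edges c d \<union>
     (join_edges d e \<union> (join_edges e f \<union> join_edges f a))))"
proof -
  have "length [a, b, c, d, e, f] = 6" by simp
  then show ?thesis unfolding cyclic_join_edges_def by (simp only: Union_lessThan_6) simp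
qed

lemma cycle_edges_6:
  "cycle_edges [a, b, c, d, e, f] = {{a, b}, {b, c}, {c, d}, {d, e}, {e, f}, {f, a}}"
proof -
  have "cycle_edges vs = (\<Union>i<length vs. {{vs ! i, vs ! (Suc i mod length vs)}})" for vs :: "'a list"
    by (auto simp: cycle_edges_def)
  moreover have "length [a, b, c, d, e, f] = 6" by simp
  ultimately show ?thesis by (simp only: Union_lessThan_6) (simp add: insert_commute)
qed

text \<open>
  Adjacency tables of one block, whose vertices carry a position \<open>m\<close> and a sign: \<open>m = 0, 1\<close> for
  the two vertices involving \<open>e\<^sub>0\<close> tilde, \<open>m = 2, ..., 5\<close> for the four vertices of an \<open>x\<close>-pair, \<open>m = 6\<close> for
  \<open>(x, e\<^sub>0)\<close>, and analogously for the other subgraph. The entry is the product of signs for which two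
  positions are adjacent, or 0 if they never are.
\<close>

definition double_hexagon_sign :: "nat \<Rightarrow> nat \<Rightarrow> real" where
  "double_hexagon_sign m m' =
     (if m div 2 = m' div 2 then 0 else if m div 2 + m' div 2 = 2 then - 1 else 1)"

definition hexagons_sign :: "nat \<Rightarrow> nat \<Rightarrow> real" where
  "hexagons_sign m m' =
     (if {(m, m'), (m', m)} \<inter> {(6, 2), (2, 3), (4, 5), (5, 6), (0, 1), (1, 6)} \<noteq> {} then 1
      else if {(m, m'), (m', m)} \<inter> {(3, 6), (6, 4), (6, 0)} \<noteq> {} then - 1 else 0)"

text \<open>Every position has a neighbour. This is what later certifies its vertices as zero
  divisors.\<close>

lemma hexagons_sign_ex: "m < 7 \<Longrightarrow> \<exists>m'<7. hexagons_sign m m' \<in> {1, - 1}"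
proof -
  assume "m < 7"
  then consider "m \<in> {0, 1, 2, 3, 4, 5}" | "m = 6" by fastforce
  then show ?thesis
  proof cases
    case 1
    then show ?thesis by (intro exI[of _ 6], elim insertE emptyE) (simp_all add: hexagons_sign_def)
  next
    case 2
    then show ?thesis by (intro exI[of _ 0]) (simp add: hexagons_sign_def)
  qed
qed

lemma double_hexagon_sign_ex: "m < 6 \<Longrightarrow> \<exists>m'<6. double_hexagon_sign m m' \<in> {1, - 1}"
proof -
  assume "m < 6"
  then consider "m \<in> {0, 1}" | "m \<in> {2, 3, 4, 5}" by fastforce
  then show ?thesis
  proof cases
    case 1
    then show ?thesis
      by (intro exI[of _ 2], elim insertE emptyE) (simp_all add: double_hexagon_sign_def)
  next
    case 2
    then show ?thesis
      by (intro exI[of _ 0], elim insertE emptyE) (simp_all add: double_hexagon_sign_def)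
  qed
qed

lemma sign_table_sym:
  "hexagons_sign m m' = hexagons_sign m' m" "double_hexagon_sign m m' = double_hexagon_sign m' m"
  by (simp_all only: hexagons_sign_def double_hexagon_sign_def insert_commute[of "(m, m')"] add.commute eq_commute)

lemma sign_table_irrefl: "hexagons_sign m m = 0" "double_hexagon_sign m m = 0"
  by (auto simp: hexagons_sign_def double_hexagon_sign_def)

section \<open>Abstract graphs assembled from blocks with common special vertices\<close>

lemma UN_pairs_eq:
  assumes "\<And>a b. (a, b) \<in> P \<Longrightarrow> \<exists>i\<in>J. f a b = f' i" and "\<And>i. i \<in> J \<Longrightarrow> \<exists>a b. (a, b) \<in> P \<and> f a b = f' i"
  shows "(\<Union>(a, b)\<in>P. f a b) = (\<Union>i\<in>J. f' i)"
proof (intro equalityI subsetI)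
  fix v assume "v \<in> (\<Union>(a, b)\<in>P. f a b)"
  then obtain a b where "(a, b) \<in> P" "v \<in> f a b" by blast
  then show "v \<in> (\<Union>i\<in>J. f' i)" using assms(1)[of a b] by (metis UN_I)
next
  fix v assume "v \<in> (\<Union>i\<in>J. f' i)"
  then obtain i where "i \<in> J" "v \<in> f' i" by blast
  then obtain a b where "(a, b) \<in> P" "v \<in> f a b" using assms(2)[of i] by metis
  then show "v \<in> (\<Union>(a, b)\<in>P. f a b)" by blast
qed

text \<open>A common interface for both subgraphs and both characteristics.
  \<open>w i m \<sigma>\<close> is the vertex at position m of block i with sign
  \<open>\<sigma>\<close>; positions 0, 1 and 6 are shared by all blocks, and \<open>M\<close> is 6
  or 7 according to whether position 6 is present. Since i and \<open>p i\<close> name the same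
  block, \<open>partner\<close> only permutes the positions 2 to 5, and \<open>other_block\<close>
  speaks about genuinely different blocks, where adjacency depends on the product of signs but not
  on the positions.\<close>

locale block_graph =
  fixes G :: "'v graph" and J :: "nat set" and p :: "nat \<Rightarrow> nat"
    and w :: "nat \<Rightarrow> nat \<Rightarrow> real \<Rightarrow> 'v" and M :: nat and T :: "nat \<Rightarrow> nat \<Rightarrow> real"
    and orth :: "nat \<Rightarrow> nat \<Rightarrow> real \<Rightarrow> bool"
  assumes nonempty: "J \<noteq> {}"
    and M_ge: "6 \<le> M"
    and special: "\<And>i k m. m \<in> {0, 1, 6} \<Longrightarrow> w i m = w k m"
    and inj: "\<And>i m m' \<sigma> \<tau>. i \<in> J \<Longrightarrow> m < 7 \<Longrightarrow> m' < 7 \<Longrightarrow> \<sigma> \<in> {1, - 1} \<Longrightarrow> w i m \<sigma> = w i m' \<tau> \<longleftrightarrow> m = m' \<and> \<sigma> = \<tau>"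
    and M_le: "M \<le> 7"
    and verts: "gverts G = {w i m \<sigma> | i m \<sigma>. i \<in> J \<and> m < M \<and> \<sigma> \<in> {1, - 1}}"
    and edges_ends: "\<And>e. e \<in> gedges G \<Longrightarrow>
      \<exists>i\<in>J. \<exists>k\<in>J. \<exists>m<M. \<exists>m'<M. \<exists>\<sigma>\<in>{1, - 1}. \<exists>\<tau>\<in>{1, - 1}. e = {w i m \<sigma>, w k m' \<tau>}"
    and same_block: "\<And>i m m' \<sigma> \<tau>. i \<in> J \<Longrightarrow> m < M \<Longrightarrow> m' < M \<Longrightarrow> \<sigma> \<in> {1, - 1} \<Longrightarrow> \<tau> \<in> {1, - 1} \<Longrightarrow>
      {w i m \<sigma>, w i m' \<tau>} \<in> gedges G \<longleftrightarrow> T m m' = \<sigma> * \<tau>"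
    and partner: "\<And>i m \<sigma>. i \<in> J \<Longrightarrow> m \<in> {2..5} \<Longrightarrow> \<sigma> \<in> {1, - 1} \<Longrightarrow>
      \<exists>m'\<in>{2..5}. \<exists>\<sigma>'\<in>{1, - 1}. w (p i) m \<sigma> = w i m' \<sigma>'"
    and other_block: "\<And>i k m m' \<sigma> \<tau>. i \<in> J \<Longrightarrow> k \<in> J \<Longrightarrow> k \<noteq> i \<Longrightarrow> k \<noteq> p i \<Longrightarrow> m \<in> {2..5} \<Longrightarrow> m' \<in> {2..5} \<Longrightarrow>
      \<sigma> \<in> {1, - 1} \<Longrightarrow> \<tau> \<in> {1, - 1} \<Longrightarrow> {w i m \<sigma>, w k m' \<tau>} \<in> gedges G \<longleftrightarrow> orth i k (\<sigma> * \<tau>)"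
begin

definition inner_edges :: "nat \<Rightarrow> nat set \<Rightarrow> 'v set set" where
  "inner_edges i A = {{w i m \<sigma>, w i m' \<tau>} | m m' \<sigma> \<tau>. m \<in> A \<and> m' \<in> A \<and> \<sigma> \<in> {1, - 1} \<and> \<tau> \<in> {1, - 1} \<and> T m m' = \<sigma> * \<tau>}"

definition quad :: "nat \<Rightarrow> real \<Rightarrow> 'v set" where
  "quad i \<sigma> = {w i 2 \<sigma>, w i 3 \<sigma>, w i 4 \<sigma>, w i 5 \<sigma>}"

definition outer_edges :: "'v set set" where
  "outer_edges = {e. \<exists>i k \<sigma> \<tau>. i \<in> J \<and> k \<in> J \<and> k \<noteq> i \<and> k \<noteq> p i \<and> \<sigma> \<in> {1, - 1} \<and> \<tau> \<in> {1, - 1} \<and>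
     orth i k (\<sigma> * \<tau>) \<and> e \<in> join_edges (quad i \<sigma>) (quad k \<tau>)}"

lemma quad_iff: "v \<in> quad i \<sigma> \<longleftrightarrow> (\<exists>m\<in>{2..5}. v = w i m \<sigma>)"
proof -
  have "{2..5::nat} = {2, 3, 4, 5}" by auto
  then show ?thesis by (simp add: quad_def)
qed

lemma join_quad_iff:
  "e \<in> join_edges (quad i \<sigma>) (quad k \<tau>) \<longleftrightarrow> (\<exists>m\<in>{2..5}. \<exists>m'\<in>{2..5}. e = {w i m \<sigma>, w k m' \<tau>})"
  unfolding join_edges_def mem_Collect_eq quad_iff by metis

text \<open>The block \<open>i\<close> in the special part may be any number, even one outside
  \<open>J\<close>, as special vertices do not depend on the block.\<close>

lemma verts_split:
  "gverts G = (\<Union>m\<in>{0, 1, 6} \<inter> {..<M}. {w i m 1, w i m (- 1)}) \<union> (\<Union>i\<in>J. quad i 1 \<union> quad i (- 1))"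
    (is "_ = ?S \<union> ?Q")
proof (intro equalityI subsetI)
  fix v assume "v \<in> gverts G"
  then obtain k m \<sigma> where k: "k \<in> J" and m: "m < M" "\<sigma> \<in> {1, - 1}" and v: "v = w k m \<sigma>"
    unfolding verts by blast
  show "v \<in> ?S \<union> ?Q"
  proof (cases "m \<in> {0, 1, 6}")
    case True
    then show ?thesis using special[OF True, of k i] m v by auto
  next
    case False
    then have "m \<in> {2..5}" using m M_le by auto
    then have "v \<in> quad k \<sigma>" using v quad_iff by blast
    then show ?thesis using k m by blast
  qed
next
  fix v assume "v \<in> ?S \<union> ?Q"
  then show "v \<in> gverts G"
  proof
    assume "v \<in> ?S"
    then obtain m \<sigma> where m: "m \<in> {0, 1, 6}" "m < M" "\<sigma> \<in> {1, - 1}" "v = w i m \<sigma>"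
      by (elim UN_E IntE insertE emptyE) auto
    obtain j where "j \<in> J" using nonempty by blast
    moreover have "v = w j m \<sigma>" using special[OF m(1), of i j] m(4) by simp
    ultimately show ?thesis unfolding verts using m by blast
  next
    assume "v \<in> ?Q"
    then obtain k \<sigma> where k: "k \<in> J" "\<sigma> \<in> {1, - 1}" "v \<in> quad k \<sigma>" by blast
    then obtain m where "m \<in> {2..5}" "v = w k m \<sigma>" unfolding quad_iff by blast
    moreover from this have "m < M" using M_ge by simp
    ultimately show ?thesis unfolding verts using k by blast
  qed
qed

lemma inner_edgesI:
  "m \<in> A \<Longrightarrow> m' \<in> A \<Longrightarrow> \<sigma> \<in> {1, - 1} \<Longrightarrow> \<tau> \<in> {1, - 1} \<Longrightarrow> T m m' = \<sigma> * \<tau> \<Longrightarrow>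
    {w i m \<sigma>, w i m' \<tau>} \<in> inner_edges i A"
  unfolding inner_edges_def by blast

lemma inner_edges_mono: "A \<subseteq> B \<Longrightarrow> inner_edges i A \<subseteq> inner_edges i B"
  unfolding inner_edges_def by (intro Collect_mono ex_mono impI conj_mono imp_refl) auto

text \<open>An edge with a special end, or between two names of one block, can be rewritten inside a
  single block, where the table applies. All other edges run between positions 2 to 5 of different
  blocks and are governed by \<open>orth\<close>.\<close>

lemma edges_eq: "gedges G = (\<Union>i\<in>J. inner_edges i {..<M}) \<union> outer_edges"
proof (intro equalityI subsetI)
  fix e assume "e \<in> gedges G"
  then obtain i k m m' \<sigma> \<tau> where ik: "i \<in> J" "k \<in> J" and m: "m < M" "m' < M"
    and \<sigma>: "\<sigma> \<in> {1, - 1}" "\<tau> \<in> {1, - 1}" and e: "e = {w i m \<sigma>, w k m' \<tau>}" and E: "e \<in> gedges G"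
    using edges_ends by meson
  have inner: "e \<in> (\<Union>i\<in>J. inner_edges i {..<M})"
    if "i \<in> J" "m < M" "m' < M" "\<sigma> \<in> {1, - 1}" "\<tau> \<in> {1, - 1}" "e = {w i m \<sigma>, w i m' \<tau>}" for i m m' \<sigma> \<tau>
  proof -
    have "T m m' = \<sigma> * \<tau>" using same_block[OF that(1-5)] E that(6) by simp
    then have "e \<in> inner_edges i {..<M}" unfolding that(6) using that by (intro inner_edgesI) auto
    then show ?thesis using that(1) by blast
  qed
  show "e \<in> (\<Union>i\<in>J. inner_edges i {..<M}) \<union> outer_edges"
  proof (cases "m \<in> {0, 1, 6} \<or> m' \<in> {0, 1, 6} \<or> k = i")
    case True
    \<comment> \<open>A special end can be renamed into the block of the other end.\<close>
    then have "e = {w k m \<sigma>, w k m' \<tau>} \<or> e = {w i m \<sigma>, w i m' \<tau>}"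
      using special[of m i k] special[of m' k i] unfolding e by auto
    then show ?thesis using inner[OF ik(1) m \<sigma>] inner[OF ik(2) m \<sigma>] by (intro UnI1) argo
  next
    case False
    then have m25: "m \<in> {2..5}" "m' \<in> {2..5}" using m M_le by auto
    show ?thesis
    proof (cases "k = p i")
      case True
      \<comment> \<open>The end in block \<open>p i\<close> is also a vertex of block i, at another
        position.\<close>
      obtain m'' \<tau>' where "m'' \<in> {2..5}" "\<tau>' \<in> {1, - 1}" "w k m' \<tau> = w i m'' \<tau>'"
        using partner[OF ik(1) m25(2) \<sigma>(2)] unfolding True[symmetric] by blast
      moreover from this have "m'' < M" using M_ge by simp
      ultimately show ?thesis using inner[of i m m'' \<sigma> \<tau>'] ik m \<sigma> e by simp
    next
      case False
      then have "orth i k (\<sigma> * \<tau>)"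
        using other_block[of i k m m' \<sigma> \<tau>] ik m25 \<sigma> E e \<open>\<not> (m \<in> {0, 1, 6} \<or> m' \<in> {0, 1, 6} \<or> k = i)\<close> by simp
      moreover have "e \<in> join_edges (quad i \<sigma>) (quad k \<tau>)" unfolding join_quad_iff using e m25 by blast
      ultimately show ?thesis
        unfolding outer_edges_def using ik \<sigma> False \<open>\<not> (m \<in> {0, 1, 6} \<or> m' \<in> {0, 1, 6} \<or> k = i)\<close> by blast
    qed
  qed
next
  fix e assume "e \<in> (\<Union>i\<in>J. inner_edges i {..<M}) \<union> outer_edges"
  then show "e \<in> gedges G"
  proof
    assume "e \<in> (\<Union>i\<in>J. inner_edges i {..<M})"
    then obtain i m m' \<sigma> \<tau> where "i \<in> J" "m < M" "m' < M" "\<sigma> \<in> {1, - 1}" "\<tau> \<in> {1, - 1}"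
      "T m m' = \<sigma> * \<tau>" "e = {w i m \<sigma>, w i m' \<tau>}"
      unfolding inner_edges_def by blast
    then show ?thesis using same_block by simp
  next
    assume "e \<in> outer_edges"
    then obtain i k \<sigma> \<tau> where *: "i \<in> J" "k \<in> J" "k \<noteq> i" "k \<noteq> p i" "\<sigma> \<in> {1, - 1}" "\<tau> \<in> {1, - 1}"
      "orth i k (\<sigma> * \<tau>)" "e \<in> join_edges (quad i \<sigma>) (quad k \<tau>)"
      unfolding outer_edges_def by blast
    then obtain m m' where "m \<in> {2..5}" "m' \<in> {2..5}" "e = {w i m \<sigma>, w k m' \<tau>}"
      unfolding join_quad_iff by blast
    then show ?thesis using other_block * by simp
  qed
qed

lemma induced_edges:
  assumes "i \<in> J" "A \<subseteq> {..<M}" "S = {w i m \<sigma> | m \<sigma>. m \<in> A \<and> \<sigma> \<in> {1, - 1}}"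
  shows "gedges (induced G S) = inner_edges i A"
proof (intro equalityI subsetI)
  fix e assume "e \<in> gedges (induced G S)"
  then have E: "e \<in> gedges G" "e \<subseteq> S" by (auto simp: induced_def)
  then obtain k l m m' \<sigma> \<tau> where "e = {w k m \<sigma>, w l m' \<tau>}" using edges_ends by meson
  then obtain m m' \<sigma> \<tau> where e: "e = {w i m \<sigma>, w i m' \<tau>}" "m \<in> A" "m' \<in> A" "\<sigma> \<in> {1, - 1}" "\<tau> \<in> {1, - 1}"
    using E(2) assms(3) by auto
  then have "T m m' = \<sigma> * \<tau>" using same_block[of i m m' \<sigma> \<tau>] assms(1,2) E(1) by auto
  then show "e \<in> inner_edges i A" unfolding e(1) using e(2-) by (intro inner_edgesI)
next
  fix e assume "e \<in> inner_edges i A"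
  then obtain m m' \<sigma> \<tau> where e: "e = {w i m \<sigma>, w i m' \<tau>}" "m \<in> A" "m' \<in> A" "\<sigma> \<in> {1, - 1}" "\<tau> \<in> {1, - 1}"
    "T m m' = \<sigma> * \<tau>"
    unfolding inner_edges_def by blast
  then have "e \<in> gedges G" using same_block[of i m m' \<sigma> \<tau>] assms(1,2) by auto
  moreover have "e \<subseteq> S" using e assms(3) by auto
  ultimately show "e \<in> gedges (induced G S)" by (simp add: induced_def)
qed

lemma quad_edges:
  assumes "i \<in> J" "k \<in> J" "k \<noteq> i" "k \<noteq> p i" "\<sigma> \<in> {1, - 1}" "\<tau> \<in> {1, - 1}"
  shows "if orth i k (\<sigma> * \<tau>) then join_edges (quad i \<sigma>) (quad k \<tau>) \<subseteq> gedges G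
    else join_edges (quad i \<sigma>) (quad k \<tau>) \<inter> gedges G = {}"
  using assms other_block by (auto simp: join_quad_iff)

text \<open>\<open>R\<close> stands for the quadruples of algebra elements. Neither direction needs
  a bijection with index quadruples: it is enough that every quadruple yields some blocks and signs
  with the same vertex sets and the same orthogonality condition, and conversely.\<close>

lemma outer_edges_eq:
  fixes R :: "('a \<times> 'a \<times> 'a \<times> 'a) set"
  assumes R: "\<And>a b c d. (a, b, c, d) \<in> R \<Longrightarrow> \<exists>i k \<sigma> \<tau>. i \<in> J \<and> k \<in> J \<and> k \<noteq> i \<and> k \<noteq> p i \<and>
      \<sigma> \<in> {1, - 1} \<and> \<tau> \<in> {1, - 1} \<and> Q a b = quad i \<sigma> \<and> Q c d = quad k \<tau> \<and> (Or a b c d \<longleftrightarrow> orth i k (\<sigma> * \<tau>))"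
    and R': "\<And>i k \<sigma> \<tau>. i \<in> J \<Longrightarrow> k \<in> J \<Longrightarrow> k \<noteq> i \<Longrightarrow> k \<noteq> p i \<Longrightarrow> \<sigma> \<in> {1, - 1} \<Longrightarrow> \<tau> \<in> {1, - 1} \<Longrightarrow>
      \<exists>a b c d. (a, b, c, d) \<in> R \<and> Q a b = quad i \<sigma> \<and> Q c d = quad k \<tau> \<and> (Or a b c d \<longleftrightarrow> orth i k (\<sigma> * \<tau>))"
  shows "(\<Union>(a, b, c, d)\<in>{(a, b, c, d). (a, b, c, d) \<in> R \<and> Or a b c d}. join_edges (Q a b) (Q c d)) = outer_edges"
    and "(a, b, c, d) \<in> R \<Longrightarrow> if Or a b c d then join_edges (Q a b) (Q c d) \<subseteq> gedges G
      else join_edges (Q a b) (Q c d) \<inter> gedges G = {}"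
proof -
  show "(\<Union>(a, b, c, d)\<in>{(a, b, c, d). (a, b, c, d) \<in> R \<and> Or a b c d}. join_edges (Q a b) (Q c d)) = outer_edges"
  proof (intro equalityI subsetI)
    fix e assume "e \<in> (\<Union>(a, b, c, d)\<in>{(a, b, c, d). (a, b, c, d) \<in> R \<and> Or a b c d}. join_edges (Q a b) (Q c d))"
    then obtain a b c d where abcd: "(a, b, c, d) \<in> R" "Or a b c d" "e \<in> join_edges (Q a b) (Q c d)" by blast
    obtain i k \<sigma> \<tau> where "i \<in> J" "k \<in> J" "k \<noteq> i" "k \<noteq> p i" "\<sigma> \<in> {1, - 1}" "\<tau> \<in> {1, - 1}"
      "Q a b = quad i \<sigma>" "Q c d = quad k \<tau>" "Or a b c d \<longleftrightarrow> orth i k (\<sigma> * \<tau>)"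
      using R[OF abcd(1)] by (elim exE conjE) (rule that)
    then show "e \<in> outer_edges"
      using abcd(2,3) unfolding outer_edges_def by auto
  next
    fix e assume "e \<in> outer_edges"
    then obtain i k \<sigma> \<tau> where ik: "i \<in> J" "k \<in> J" "k \<noteq> i" "k \<noteq> p i" "\<sigma> \<in> {1, - 1}" "\<tau> \<in> {1, - 1}"
      "orth i k (\<sigma> * \<tau>)" "e \<in> join_edges (quad i \<sigma>) (quad k \<tau>)"
      unfolding outer_edges_def by blast
    obtain a b c d where "(a, b, c, d) \<in> R" "Q a b = quad i \<sigma>" "Q c d = quad k \<tau>" "Or a b c d"
      using R'[OF ik(1-6)] ik(7) by blast
    moreover from this have "e \<in> join_edges (Q a b) (Q c d)" using ik(8) by simp
    ultimately show "e \<in> (\<Union>(a, b, c, d)\<in>{(a, b, c, d). (a, b, c, d) \<in> R \<and> Or a b c d}. join_edges (Q a b) (Q c d))"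
      by blast
  qed
  show "if Or a b c d then join_edges (Q a b) (Q c d) \<subseteq> gedges G
      else join_edges (Q a b) (Q c d) \<inter> gedges G = {}" if abcd: "(a, b, c, d) \<in> R"
  proof -
    obtain i k \<sigma> \<tau> where "i \<in> J" "k \<in> J" "k \<noteq> i" "k \<noteq> p i" "\<sigma> \<in> {1, - 1}" "\<tau> \<in> {1, - 1}"
      "Q a b = quad i \<sigma>" "Q c d = quad k \<tau>" "Or a b c d \<longleftrightarrow> orth i k (\<sigma> * \<tau>)"
      using R[OF abcd] by (elim exE conjE) (rule that)
    then show ?thesis using quad_edges by simp
  qed
qed

end

section \<open>Characteristic -1: double hexagons\<close>

locale double_hexagons = block_graph G J p w 6 double_hexagon_sign orth
  for G :: "'v graph" and J p w orth
begin

definition double_hexagon :: "nat \<Rightarrow> 'v set list" where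
  "double_hexagon i =
     [{w i 0 1, w i 1 1}, {w i 2 1, w i 3 1}, {w i 4 1, w i 5 1},
      {w i 0 (- 1), w i 1 (- 1)}, {w i 2 (- 1), w i 3 (- 1)}, {w i 4 (- 1), w i 5 (- 1)}]"

text \<open>The six sets are the three classes of positions with equal \<open>m div 2\<close>, each
  taken with sign 1 and with sign -1. Neighbouring sets realise exactly the sign products of the
  table: the cycle goes twice through the three classes and changes sign between the last class and
  the first.\<close>

lemma cyclic_join_edges_double_hexagon: "cyclic_join_edges (double_hexagon i) = inner_edges i {..<6}"
proof (intro equalityI subsetI)
  fix e assume "e \<in> cyclic_join_edges (double_hexagon i)"
  then show "e \<in> inner_edges i {..<6}"
    unfolding double_hexagon_def cyclic_join_edges_6 join_edges_doubletons
    by (elim UnE insertE emptyE; simp only:; intro inner_edgesI; simp add: double_hexagon_sign_def)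
next
  fix e assume "e \<in> inner_edges i {..<6}"
  then obtain m m' \<sigma> \<tau> where "e = {w i m \<sigma>, w i m' \<tau>}" "m \<in> {0, 1, 2, 3, 4, 5}" "m' \<in> {0, 1, 2, 3, 4, 5}"
    "\<sigma> \<in> {1, - 1}" "\<tau> \<in> {1, - 1}" "double_hexagon_sign m m' = \<sigma> * \<tau>"
    unfolding inner_edges_def lessThan_iff less_6_cases by blast
  then show "e \<in> cyclic_join_edges (double_hexagon i)"
    unfolding double_hexagon_def cyclic_join_edges_6 join_edges_doubletons Un_iff insert_iff empty_iff
    by (elim disjE FalseE; simp add: double_hexagon_sign_def; simp add: insert_commute)
qed

lemma is_double_hexagon:
  assumes i: "i \<in> J"
  shows "is_double_hexagon G (double_hexagon i)"
proof -
  let ?S = "\<Union> (set (double_hexagon i))"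
  have S: "?S = {w i m \<sigma> | m \<sigma>. m \<in> {..<6} \<and> \<sigma> \<in> {1, - 1}}"
    unfolding lessThan_iff less_6_cases by (auto simp: double_hexagon_def)
  have "gverts G \<inter> ?S = ?S" unfolding S verts using i by auto
  moreover have "gedges (induced G ?S) = cyclic_join_edges (double_hexagon i)"
    unfolding cyclic_join_edges_double_hexagon by (rule induced_edges[OF i _ S]) simp
  ultimately have "induced G ?S = (?S, cyclic_join_edges (double_hexagon i))"
    by (simp add: induced_def)
  then show ?thesis
    unfolding is_double_hexagon_def all_less_6 using i
    by (simp add: double_hexagon_def inj card_insert_if)
qed

lemma verts_eq: "gverts G = {w i 0 1, w i 0 (- 1), w i 1 1, w i 1 (- 1)} \<union> (\<Union>i\<in>J. quad i 1 \<union> quad i (- 1))"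
  unfolding verts_split[of i] by auto

lemma edges_eq': "gedges G = (\<Union>i\<in>J. cyclic_join_edges (double_hexagon i)) \<union> outer_edges"
  unfolding cyclic_join_edges_double_hexagon by (rule edges_eq)

text \<open>Passage from families indexed by \<open>J\<close> to families indexed by
  \<open>x\<close>-pairs. Several pairs may yield the same block, so only agreement of values in
  both directions is required.\<close>

lemma description:
  fixes P :: "('a \<times> 'a) set" and R :: "('a \<times> 'a \<times> 'a \<times> 'a) set"
  assumes P: "\<And>a b. (a, b) \<in> P \<Longrightarrow> \<exists>i\<in>J. D a b = double_hexagon i \<and> F a b = quad i 1 \<union> quad i (- 1)"
    and P': "\<And>i. i \<in> J \<Longrightarrow> \<exists>a b. (a, b) \<in> P \<and> D a b = double_hexagon i \<and> F a b = quad i 1 \<union> quad i (- 1)"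
    and R: "(\<Union>(a, b, c, d)\<in>{(a, b, c, d). (a, b, c, d) \<in> R \<and> Or a b c d}. join_edges (Q a b) (Q c d)) = outer_edges"
    and S: "S = {w i0 0 1, w i0 0 (- 1), w i0 1 1, w i0 1 (- 1)}"
  shows "gverts G = S \<union> (\<Union>(a, b)\<in>P. F a b) \<and> (\<forall>(a, b)\<in>P. is_double_hexagon G (D a b)) \<and>
    gedges G = (\<Union>(a, b)\<in>P. cyclic_join_edges (D a b)) \<union>
      (\<Union>(a, b, c, d)\<in>{(a, b, c, d). (a, b, c, d) \<in> R \<and> Or a b c d}. join_edges (Q a b) (Q c d))"
proof (intro conjI)
  have "(\<Union>(a, b)\<in>P. F a b) = (\<Union>i\<in>J. quad i 1 \<union> quad i (- 1))"
    by (rule UN_pairs_eq) (use P P' in metis)+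
  then show "gverts G = S \<union> (\<Union>(a, b)\<in>P. F a b)"
    unfolding S verts_eq[of i0] by simp
  show "\<forall>(a, b)\<in>P. is_double_hexagon G (D a b)"
    using P is_double_hexagon by fastforce
  have "(\<Union>(a, b)\<in>P. cyclic_join_edges (D a b)) = (\<Union>i\<in>J. cyclic_join_edges (double_hexagon i))"
    by (rule UN_pairs_eq) (use P P' in metis)+
  then show "gedges G = (\<Union>(a, b)\<in>P. cyclic_join_edges (D a b)) \<union>
      (\<Union>(a, b, c, d)\<in>{(a, b, c, d). (a, b, c, d) \<in> R \<and> Or a b c d}. join_edges (Q a b) (Q c d))"
    unfolding R edges_eq' by simp
qed

end

section \<open>Characteristic 1: hexagons\<close>

locale hexagons = block_graph G J p w 7 hexagons_sign orth
  for G :: "'v graph" and J p w orth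
begin

definition hexagon1 :: "nat \<Rightarrow> 'v list" where
  "hexagon1 i = [w i 6 1, w i 2 1, w i 3 1, w i 6 (- 1), w i 2 (- 1), w i 3 (- 1)]"

definition hexagon2 :: "nat \<Rightarrow> 'v list" where
  "hexagon2 i = [w i 6 (- 1), w i 4 1, w i 5 1, w i 6 1, w i 4 (- 1), w i 5 (- 1)]"

definition hexagon0 :: "nat \<Rightarrow> 'v list" where
  "hexagon0 i = [w i 6 (- 1), w i 0 1, w i 1 1, w i 6 1, w i 0 (- 1), w i 1 (- 1)]"

lemmas hexagon_defs = hexagon0_def hexagon1_def hexagon2_def

text \<open>The right-hand side contains every edge that the table allows among these positions, so
  the equality also excludes further edges between the two hexagons.\<close>

lemma cycle_edges_hexagon12:
  "cycle_edges (hexagon1 i) \<union> cycle_edges (hexagon2 i) = inner_edges i {2, 3, 4, 5, 6}"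
proof (intro equalityI subsetI)
  fix e assume "e \<in> cycle_edges (hexagon1 i) \<union> cycle_edges (hexagon2 i)"
  then show "e \<in> inner_edges i {2, 3, 4, 5, 6}"
    unfolding hexagon_defs cycle_edges_6
    by (elim UnE insertE emptyE; simp only:; intro inner_edgesI; simp add: hexagons_sign_def)
next
  fix e assume "e \<in> inner_edges i {2, 3, 4, 5, 6}"
  then obtain m m' \<sigma> \<tau> where "e = {w i m \<sigma>, w i m' \<tau>}" "m \<in> {2, 3, 4, 5, 6}" "m' \<in> {2, 3, 4, 5, 6}"
    "\<sigma> \<in> {1, - 1}" "\<tau> \<in> {1, - 1}" "hexagons_sign m m' = \<sigma> * \<tau>"
    unfolding inner_edges_def by blast
  then show "e \<in> cycle_edges (hexagon1 i) \<union> cycle_edges (hexagon2 i)"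
    unfolding hexagon_defs cycle_edges_6 Un_iff insert_iff empty_iff
    by (elim disjE FalseE; simp add: hexagons_sign_def doubleton_eq_iff)
qed

lemma cycle_edges_hexagon0: "cycle_edges (hexagon0 i) = inner_edges i {0, 1, 6}"
proof (intro equalityI subsetI)
  fix e assume "e \<in> cycle_edges (hexagon0 i)"
  then show "e \<in> inner_edges i {0, 1, 6}"
    unfolding hexagon_defs cycle_edges_6
    by (elim UnE insertE emptyE; simp only:; intro inner_edgesI; simp add: hexagons_sign_def)
next
  fix e assume "e \<in> inner_edges i {0, 1, 6}"
  then obtain m m' \<sigma> \<tau> where "e = {w i m \<sigma>, w i m' \<tau>}" "m \<in> {0, 1, 6}" "m' \<in> {0, 1, 6}"
    "\<sigma> \<in> {1, - 1}" "\<tau> \<in> {1, - 1}" "hexagons_sign m m' = \<sigma> * \<tau>"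
    unfolding inner_edges_def by blast
  then show "e \<in> cycle_edges (hexagon0 i)"
    unfolding hexagon_defs cycle_edges_6 Un_iff insert_iff empty_iff
    by (elim disjE FalseE; simp add: hexagons_sign_def doubleton_eq_iff)
qed

text \<open>The table vanishes between the positions 0, 1 and the positions 2 to 5, so the two parts
  of a block meet only at position 6.\<close>

lemma inner_edges_7: "inner_edges i {..<7} = inner_edges i {2, 3, 4, 5, 6} \<union> inner_edges i {0, 1, 6}"
proof (intro equalityI subsetI)
  fix e assume "e \<in> inner_edges i {..<7}"
  then obtain m m' \<sigma> \<tau> where e: "e = {w i m \<sigma>, w i m' \<tau>}"
    and m: "m \<in> {0, 1, 2, 3, 4, 5, 6}" "m' \<in> {0, 1, 2, 3, 4, 5, 6}"
    and \<sigma>: "\<sigma> \<in> {1, - 1}" "\<tau> \<in> {1, - 1}" "hexagons_sign m m' = \<sigma> * \<tau>"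
    unfolding inner_edges_def lessThan_iff less_7_cases by blast
  from \<sigma> have "hexagons_sign m m' \<noteq> 0" by auto
  with m have "{m, m'} \<subseteq> {2, 3, 4, 5, 6} \<or> {m, m'} \<subseteq> {0, 1, 6}"
    by (elim insertE emptyE; simp add: hexagons_sign_def)
  then show "e \<in> inner_edges i {2, 3, 4, 5, 6} \<union> inner_edges i {0, 1, 6}"
  proof (elim disjE)
    have "e \<in> inner_edges i A" if "{m, m'} \<subseteq> A" for A
      unfolding e using that by (intro inner_edgesI \<sigma>) simp_all
    then show "{m, m'} \<subseteq> {2, 3, 4, 5, 6} \<Longrightarrow> e \<in> inner_edges i {2, 3, 4, 5, 6} \<union> inner_edges i {0, 1, 6}"
      "{m, m'} \<subseteq> {0, 1, 6} \<Longrightarrow> e \<in> inner_edges i {2, 3, 4, 5, 6} \<union> inner_edges i {0, 1, 6}"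
      by (blast intro: UnI1 UnI2)+
  qed
next
  fix e assume "e \<in> inner_edges i {2, 3, 4, 5, 6} \<union> inner_edges i {0, 1, 6}"
  moreover have "inner_edges i {2, 3, 4, 5, 6} \<subseteq> inner_edges i {..<7}"
    "inner_edges i {0, 1, 6} \<subseteq> inner_edges i {..<7}"
    by (rule inner_edges_mono; simp)+
  ultimately show "e \<in> inner_edges i {..<7}" by blast
qed

lemma edges_eq':
  "gedges G = (\<Union>i\<in>J. cycle_edges (hexagon1 i) \<union> cycle_edges (hexagon2 i)) \<union> cycle_edges (hexagon0 k) \<union> outer_edges"
proof -
  \<comment> \<open>Its positions 0, 1 and 6 are special, so all blocks share this hexagon and one
    copy suffices.\<close>
  have "cycle_edges (hexagon0 i) = cycle_edges (hexagon0 k)" for i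
    using special[of _ i k] by (simp add: hexagon0_def)
  then have "(\<Union>i\<in>J. inner_edges i {..<7}) =
      (\<Union>i\<in>J. cycle_edges (hexagon1 i) \<union> cycle_edges (hexagon2 i)) \<union> cycle_edges (hexagon0 k)"
    unfolding inner_edges_7 cycle_edges_hexagon12[symmetric] cycle_edges_hexagon0[symmetric]
    using nonempty by auto
  then show ?thesis using edges_eq by simp
qed

lemma is_hexagon:
  assumes "i \<in> J"
  shows "is_hexagon G (hexagon1 i)" "is_hexagon G (hexagon2 i)" "is_hexagon G (hexagon0 i)"
proof -
  have v: "w i m \<sigma> \<in> gverts G" if "m < 7" "\<sigma> \<in> {1, - 1}" for m \<sigma> unfolding verts using assms that by blast
  have e: "cycle_edges (hexagon0 i) \<subseteq> gedges G" "cycle_edges (hexagon1 i) \<union> cycle_edges (hexagon2 i) \<subseteq> gedges G"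
    using edges_eq'[of i] assms by blast+
  show "is_hexagon G (hexagon1 i)" "is_hexagon G (hexagon2 i)" "is_hexagon G (hexagon0 i)"
    unfolding is_hexagon_def using e by (simp_all add: hexagon_defs v inj assms)
qed

lemma induced_hexagons:
  assumes "i \<in> J"
  shows "gedges (induced G (set (hexagon1 i) \<union> set (hexagon2 i))) =
    cycle_edges (hexagon1 i) \<union> cycle_edges (hexagon2 i)"
  unfolding cycle_edges_hexagon12
  by (rule induced_edges[OF assms]) (auto simp: hexagon_defs)

text \<open>Vertices at positions 0 and 1 are different from those at positions 2 to 6 of every
  block, hence occur neither in outer edges nor in the other two hexagons.\<close>

lemma special_edges:
  assumes "e \<in> gedges G" "e \<inter> {w k 0 1, w k 0 (- 1), w k 1 1, w k 1 (- 1)} \<noteq> {}"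
  shows "e \<in> cycle_edges (hexagon0 k)"
proof -
  obtain m0 \<sigma>0 where m0: "w k m0 \<sigma>0 \<in> e" "m0 \<in> {0, 1}" "\<sigma>0 \<in> {1, - 1}" using assms(2) by auto
  have neq: "w k m0 \<sigma>0 \<noteq> w i m \<sigma>" if "i \<in> J" "m \<in> {2..6}" for i m \<sigma>
    using special[of m0 k i] m0 inj[of i m0 m \<sigma>0 \<sigma>] that by auto
  have "\<not> e \<in> outer_edges"
    proof
      assume "e \<in> outer_edges"
      then obtain i l m m' \<sigma> \<tau> where "i \<in> J" "l \<in> J" "m \<in> {2..5}" "m' \<in> {2..5}" "e = {w i m \<sigma>, w l m' \<tau>}"
        unfolding outer_edges_def join_quad_iff by blast
      then show False using m0(1) neq[of i m \<sigma>] neq[of l m' \<tau>] by auto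
    qed
  moreover have "\<not> e \<in> cycle_edges (hexagon1 i) \<union> cycle_edges (hexagon2 i)" if "i \<in> J" for i
    unfolding cycle_edges_hexagon12
    proof
      assume "e \<in> inner_edges i {2, 3, 4, 5, 6}"
      then obtain m m' \<sigma> \<tau> where "e = {w i m \<sigma>, w i m' \<tau>}" "m \<in> {2, 3, 4, 5, 6}" "m' \<in> {2, 3, 4, 5, 6}"
        unfolding inner_edges_def by blast
      then show False using m0(1) neq[OF that, of m \<sigma>] neq[OF that, of m' \<tau>] by auto
    qed
  ultimately show ?thesis
    using assms(1) edges_eq'[of k] by blast
qed

lemma verts_eq: "gverts G = {w i 6 1, w i 6 (- 1)} \<union> ({w i 0 1, w i 0 (- 1), w i 1 1, w i 1 (- 1)} \<union>
  (\<Union>i\<in>J. quad i 1 \<union> quad i (- 1)))"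
  unfolding verts_split[of i] by auto

lemma description:
  fixes P :: "('a \<times> 'a) set" and R :: "('a \<times> 'a \<times> 'a \<times> 'a) set"
  assumes P: "\<And>a b. (a, b) \<in> P \<Longrightarrow>
      \<exists>i\<in>J. A a b = hexagon1 i \<and> B a b = hexagon2 i \<and> F a b = quad i 1 \<union> quad i (- 1)"
    and P': "\<And>i. i \<in> J \<Longrightarrow>
      \<exists>a b. (a, b) \<in> P \<and> A a b = hexagon1 i \<and> B a b = hexagon2 i \<and> F a b = quad i 1 \<union> quad i (- 1)"
    and R: "(\<Union>(a, b, c, d)\<in>{(a, b, c, d). (a, b, c, d) \<in> R \<and> Or a b c d}. join_edges (Q a b) (Q c d)) = outer_edges"
    and S: "S = {w i0 0 1, w i0 0 (- 1), w i0 1 1, w i0 1 (- 1)}"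
    and S': "S' = {w i0 6 1, w i0 6 (- 1)}"
    and H: "H = hexagon0 i0" and i0: "i0 \<in> J"
  shows "gverts G = S' \<union> (S \<union> (\<Union>(a, b)\<in>P. F a b)) \<and>
    (\<forall>(a, b)\<in>P. is_hexagon G (A a b) \<and> is_hexagon G (B a b) \<and>
      gedges (induced G (set (A a b) \<union> set (B a b))) = cycle_edges (A a b) \<union> cycle_edges (B a b)) \<and>
    is_hexagon G H \<and>
    (\<forall>E\<in>gedges G. E \<inter> S \<noteq> {} \<longrightarrow> E \<in> cycle_edges H) \<and>
    gedges G = (\<Union>(a, b)\<in>P. cycle_edges (A a b) \<union> cycle_edges (B a b)) \<union> cycle_edges H \<union>
      (\<Union>(a, b, c, d)\<in>{(a, b, c, d). (a, b, c, d) \<in> R \<and> Or a b c d}. join_edges (Q a b) (Q c d))"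
proof (intro conjI)
  have "(\<Union>(a, b)\<in>P. F a b) = (\<Union>i\<in>J. quad i 1 \<union> quad i (- 1))"
    by (rule UN_pairs_eq) (use P P' in metis)+
  then show "gverts G = S' \<union> (S \<union> (\<Union>(a, b)\<in>P. F a b))"
    unfolding S S' verts_eq[of i0] by simp
  show "\<forall>(a, b)\<in>P. is_hexagon G (A a b) \<and> is_hexagon G (B a b) \<and>
      gedges (induced G (set (A a b) \<union> set (B a b))) = cycle_edges (A a b) \<union> cycle_edges (B a b)"
  proof clarify
    fix a b assume "(a, b) \<in> P"
    then obtain i where "i \<in> J" "A a b = hexagon1 i" "B a b = hexagon2 i" using P by blast
    then show "is_hexagon G (A a b) \<and> is_hexagon G (B a b) \<and>
      gedges (induced G (set (A a b) \<union> set (B a b))) = cycle_edges (A a b) \<union> cycle_edges (B a b)"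
      using is_hexagon induced_hexagons by simp
  qed
  show "is_hexagon G H" unfolding H by (rule is_hexagon(3)[OF i0])
  show "\<forall>E\<in>gedges G. E \<inter> S \<noteq> {} \<longrightarrow> E \<in> cycle_edges H"
    unfolding H S using special_edges by blast
  have "(\<Union>(a, b)\<in>P. cycle_edges (A a b) \<union> cycle_edges (B a b)) =
    (\<Union>i\<in>J. cycle_edges (hexagon1 i) \<union> cycle_edges (hexagon2 i))"
    by (rule UN_pairs_eq) (use P P' in metis)+
  then show "gedges G = (\<Union>(a, b)\<in>P. cycle_edges (A a b) \<union> cycle_edges (B a b)) \<union> cycle_edges H \<union>
      (\<Union>(a, b, c, d)\<in>{(a, b, c, d). (a, b, c, d) \<in> R \<and> Or a b c d}. join_edges (Q a b) (Q c d))"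
    unfolding R H edges_eq'[of i0] by simp
qed

end

section \<open>From sign computations to block graphs\<close>

lemma cd_C_edge_ends:
  assumes "e \<in> gedges (cd_C \<gamma> n z)"
  obtains u v where "e = {u, v}" "u \<in> gverts (cd_C \<gamma> n z)" "v \<in> gverts (cd_C \<gamma> n z)"
proof -
  have e: "e \<subseteq> gverts (induced H W) \<and> (\<exists>u v. e = {u, v})"
    if "e \<in> gedges (induced H W)" "\<And>e. e \<in> gedges H \<Longrightarrow> \<exists>u\<in>gverts H. \<exists>v\<in>gverts H. e = {u, v}"
    for H :: "cd set graph" and W
    using that(1) that(2)[of e] by (auto simp: induced_def)
  have "e' \<in> gedges (Gamma_e \<gamma> n) \<Longrightarrow> \<exists>u\<in>gverts (Gamma_e \<gamma> n). \<exists>v\<in>gverts (Gamma_e \<gamma> n). e' = {u, v}" for e'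
    unfolding Gamma_e_def fst_conv snd_conv by blast
  then have "e \<subseteq> gverts (cd_C \<gamma> n z) \<and> (\<exists>u v. e = {u, v})"
    using assms unfolding cd_C_def by (intro e)
  then show ?thesis using that by auto
qed

text \<open>Reduces a subgraph to sign conditions. The indices run over all seven positions even if
  \<open>M = 6\<close>, because \<open>cover\<close> must reach every nonzero index, including y
  itself at position 6. By symmetry of the table only \<open>m < m'\<close> has to be checked within
  a block.\<close>

lemma block_graphI:
  fixes \<gamma> :: "nat \<Rightarrow> real" and n :: nat and idx :: "nat \<Rightarrow> nat \<Rightarrow> nat" and coef :: "nat \<Rightarrow> nat \<Rightarrow> real" and y :: nat
  defines "w \<equiv> \<lambda>i m \<sigma>. cd_vertex n (idx i m) (xor (idx i m) y) (coef i m * \<sigma>)"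
  assumes \<gamma>_sign: "\<forall>l\<le>n. \<gamma> l \<in> {1, - 1}" and y: "y < 2 ^ n"
    and nonempty: "J \<noteq> {}"
    and M: "M = 7 \<or> M = 6 \<and> cd_chi \<gamma> n (cd_e y) = - 1"
    and idx: "\<And>i m. i \<in> J \<Longrightarrow> m < 7 \<Longrightarrow> idx i m < 2 ^ n \<and> idx i m \<noteq> 0"
    and inj: "\<And>i. i \<in> J \<Longrightarrow> inj_on (idx i) {..<7}"
    and idx6: "\<And>i. idx i 6 = y"
    and coef: "\<And>i m. i \<in> J \<Longrightarrow> m < 7 \<Longrightarrow> coef i m \<in> {1, - 1}"
    and special: "\<And>i k m. m \<in> {0, 1, 6} \<Longrightarrow> idx i m = idx k m \<and> coef i m = coef k m"
    and cover: "\<And>r. r < 2 ^ n \<Longrightarrow> r \<noteq> 0 \<Longrightarrow> \<exists>i\<in>J. \<exists>m<7. r = idx i m"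
    and T_sym: "\<And>m m'. T m m' = T m' m" and T_irrefl: "\<And>m. T m m = 0"
    and T_ex: "\<And>m. m < M \<Longrightarrow> \<exists>m'<M. T m m' \<in> {1, - 1}"
    and T: "\<And>i m m' \<rho>. i \<in> J \<Longrightarrow> m < m' \<Longrightarrow> m' < M \<Longrightarrow> \<rho> \<in> {1, - 1} \<Longrightarrow>
      cd_link \<gamma> n (idx i m) (xor (idx i m) y) (idx i m') (xor (idx i m') y) (coef i m * coef i m' * \<rho>) \<longleftrightarrow> T m m' = \<rho>"
    and p: "\<And>i m. i \<in> J \<Longrightarrow> p i \<in> J"
    and partner: "\<And>i m. i \<in> J \<Longrightarrow> m \<in> {2..5} \<Longrightarrow> \<exists>m'\<in>{2..5}. idx (p i) m = idx i m'"
    and orth: "\<And>i k m m' \<rho>. i \<in> J \<Longrightarrow> k \<in> J \<Longrightarrow> k \<noteq> i \<Longrightarrow> k \<noteq> p i \<Longrightarrow> m \<in> {2..5} \<Longrightarrow> m' \<in> {2..5} \<Longrightarrow>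
      \<rho> \<in> {1, - 1} \<Longrightarrow> idx i m \<noteq> idx k m' \<and>
      (cd_link \<gamma> n (idx i m) (xor (idx i m) y) (idx k m') (xor (idx k m') y) (coef i m * coef k m' * \<rho>) \<longleftrightarrow> orth i k \<rho>)"
  shows "block_graph (cd_C \<gamma> n (cd_e y)) J p w M T orth"
proof -
  have \<gamma>: "\<And>l. l \<le> n \<Longrightarrow> \<gamma> l \<in> {1, - 1}" using \<gamma>_sign by blast
  let ?G = "cd_C \<gamma> n (cd_e y)"
  have xor_less: "xor r y < 2 ^ n" if "r < 2 ^ n" for r using that y by (rule nat_xor_less_power2)
  have M67: "6 \<le> M" "M \<le> 7" using M by auto
  have c\<sigma>: "coef i m * \<sigma> \<in> {1, - 1}" if "i \<in> J" "m < 7" "\<sigma> \<in> {1, - 1}" for i m \<sigma>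
    using sign_mult coef that by blast
  have link: "{w i m \<sigma>, w k m' \<tau>} \<in> gedges ?G \<longleftrightarrow> idx i m \<noteq> idx k m' \<and>
      cd_link \<gamma> n (idx i m) (xor (idx i m) y) (idx k m') (xor (idx k m') y) (coef i m * coef k m' * (\<sigma> * \<tau>))"
    if "i \<in> J" "k \<in> J" "m < 7" "m' < 7" "\<sigma> \<in> {1, - 1}" "\<tau> \<in> {1, - 1}" for i k m m' \<sigma> \<tau>
  proof -
    have "coef i m * \<sigma> * (coef k m' * \<tau>) = coef i m * coef k m' * (\<sigma> * \<tau>)" by simp
    moreover have "{w i m \<sigma>, w k m' \<tau>} \<in> gedges ?G \<longleftrightarrow> idx i m \<noteq> idx k m' \<and>
      cd_link \<gamma> n (idx i m) (xor (idx i m) y) (idx k m') (xor (idx k m') y) (coef i m * \<sigma> * (coef k m' * \<tau>))"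
      unfolding w_def using idx[OF that(1,3)] idx[OF that(2,4)] c\<sigma>[OF that(1,3,5)] c\<sigma>[OF that(2,4,6)]
      by (intro cd_C_edge_iff \<gamma>_sign y) auto
    ultimately show ?thesis by (simp only:)
  qed
  have repr: "\<exists>\<sigma>'\<in>{1, - 1}. cd_vertex n r (xor r y) \<sigma> = w i m \<sigma>'"
    if "i \<in> J" "m < 7" "r = idx i m" "\<sigma> \<in> {1, - 1}" for i m r \<sigma>
  proof
    show "coef i m * \<sigma> \<in> {1, - 1}" by (rule c\<sigma>[OF that(1,2,4)])
    have "coef i m * (coef i m * \<sigma>) = \<sigma>" using coef[OF that(1,2)] by auto
    then show "cd_vertex n r (xor r y) \<sigma> = w i m (coef i m * \<sigma>)" unfolding w_def that(3) by (simp only:)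
  qed
  have same: "{w i m \<sigma>, w i m' \<tau>} \<in> gedges ?G \<longleftrightarrow> T m m' = \<sigma> * \<tau>"
    if "i \<in> J" "m < M" "m' < M" "\<sigma> \<in> {1, - 1}" "\<tau> \<in> {1, - 1}" for i m m' \<sigma> \<tau>
  proof -
    have *: "{w i m \<sigma>, w i m' \<tau>} \<in> gedges ?G \<longleftrightarrow> T m m' = \<sigma> * \<tau>"
      if "m < m'" "m' < M" "\<sigma> \<in> {1, - 1}" "\<tau> \<in> {1, - 1}" for m m' \<sigma> \<tau>
    proof -
      have "idx i m \<noteq> idx i m'" using inj_onD[OF inj[OF \<open>i \<in> J\<close>], of m m'] that M67 by auto
      then show ?thesis
        using link[OF \<open>i \<in> J\<close> \<open>i \<in> J\<close>, of m m' \<sigma> \<tau>] T[OF \<open>i \<in> J\<close> that(1,2), of "\<sigma> * \<tau>"] sign_mult[OF that(3,4)] that M67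
        by simp
    qed
    consider "m < m'" | "m' < m" | "m = m'" by linarith
    then show ?thesis
    proof cases
      case 1
      then show ?thesis using * that by simp
    next
      case 2
      then show ?thesis using *[of m' m \<tau> \<sigma>] that T_sym[of m m'] by (simp add: insert_commute mult.commute)
    next
      case 3
      then show ?thesis using link[of i i m m \<sigma> \<tau>] that M67 T_irrefl[of m] by auto
    qed
  qed
  have verts: "gverts ?G = {w i m \<sigma> | i m \<sigma>. i \<in> J \<and> m < M \<and> \<sigma> \<in> {1, - 1}}" (is "_ = ?R")
  proof (intro equalityI subsetI)
    fix v assume "v \<in> gverts ?G"
    then obtain r \<sigma> where r: "r < 2 ^ n" "r \<noteq> 0" "\<sigma> \<in> {1, - 1}" "v = cd_vertex n r (xor r y) \<sigma>"
      and zd: "cd_zero_divisor \<gamma> (Suc n) (cd_pair n (cd_e r) (\<sigma> *\<^sub>R cd_e (xor r y)))"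
      unfolding cd_C_verts[OF \<gamma>_sign y] by blast
    obtain i m where i: "i \<in> J" "m < 7" "r = idx i m" using cover[OF r(1,2)] by blast
    \<comment> \<open>This can fail only for position 6 in characteristic -1, where the pair has
      second entry e_0 up to sign and is not a zero divisor.\<close>
    have "m < M"
    proof (rule ccontr)
      assume "\<not> m < M"
      then have "m = 6" "cd_chi \<gamma> n (cd_e y) = - 1" using M i(2) by auto
      then show False
        using not_zero_divisor_e_unit[where \<gamma> = \<gamma>, OF \<gamma> y _ r(3)] zd i(3) idx6 by (simp add: cd_chi_eq[OF \<gamma>_sign y])
    qed
    then show "v \<in> ?R" using repr[OF i r(3)] i(1) r(4) by blast
  next
    fix v assume "v \<in> ?R"
    then obtain i m \<sigma> where v: "v = w i m \<sigma>" "i \<in> J" "m < M" "\<sigma> \<in> {1, - 1}" by blast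
    \<comment> \<open>A neighbour in the table, with its sign adapted to \<open>\<sigma>\<close>,
      gives an edge, and the ends of edges are vertices.\<close>
    obtain m' where m': "m' < M" "T m m' \<in> {1, - 1}" using T_ex[OF v(3)] by blast
    have "T m m' = \<sigma> * (\<sigma> * T m m')" "\<sigma> * T m m' \<in> {1, - 1}" using v(4) m'(2) by auto
    then have "{w i m \<sigma>, w i m' (\<sigma> * T m m')} \<in> gedges ?G"
      using same[OF v(2,3) m'(1) v(4)] by simp
    moreover have "{u, u'} \<in> gedges ?G \<Longrightarrow> u \<in> gverts ?G" for u u'
      by (erule cd_C_edge_ends) (auto simp: doubleton_eq_iff)
    ultimately show "v \<in> gverts ?G" using v(1) by blast
  qed
  show ?thesis
  proof
    show "J \<noteq> {}" "6 \<le> M" "M \<le> 7" by (fact nonempty M67)+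
    show "w i m = w k m" if "m \<in> {0, 1, 6}" for i k m
      using special[OF that, of i k] by (auto simp: w_def)
    show "w i m \<sigma> = w i m' \<tau> \<longleftrightarrow> m = m' \<and> \<sigma> = \<tau>"
      if "i \<in> J" "m < 7" "m' < 7" "\<sigma> \<in> {1, - 1}" for i m m' \<sigma> \<tau>
    proof -
      have "coef i m * \<sigma> \<noteq> 0" using c\<sigma>[OF that(1,2,4)] by auto
      then have "w i m \<sigma> = w i m' \<tau> \<longleftrightarrow> idx i m = idx i m' \<and> coef i m * \<sigma> = coef i m' * \<tau>"
        unfolding w_def using idx[OF that(1,2)] idx[OF that(1,3)] by (subst cd_vertex_eq_iff) auto
      also have "\<dots> \<longleftrightarrow> m = m' \<and> \<sigma> = \<tau>"
        using inj_onD[OF inj[OF that(1)], of m m'] that coef[OF that(1,2)] by auto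
      finally show ?thesis .
    qed
    show "gverts ?G = {w i m \<sigma> | i m \<sigma>. i \<in> J \<and> m < M \<and> \<sigma> \<in> {1, - 1}}" by (fact verts)
    show "\<exists>i\<in>J. \<exists>k\<in>J. \<exists>m<M. \<exists>m'<M. \<exists>\<sigma>\<in>{1, - 1}. \<exists>\<tau>\<in>{1, - 1}. e = {w i m \<sigma>, w k m' \<tau>}"
      if E: "e \<in> gedges ?G" for e
    proof -
      obtain u v where e: "e = {u, v}" and uv: "u \<in> gverts ?G" "v \<in> gverts ?G"
        by (rule cd_C_edge_ends[OF E])
      from uv obtain i m \<sigma> k m' \<tau> where "i \<in> J" "m < M" "\<sigma> \<in> {1, - 1}" "u = w i m \<sigma>"
        "k \<in> J" "m' < M" "\<tau> \<in> {1, - 1}" "v = w k m' \<tau>" unfolding verts by blast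
      then show ?thesis unfolding e by blast
    qed
    show "{w i m \<sigma>, w i m' \<tau>} \<in> gedges ?G \<longleftrightarrow> T m m' = \<sigma> * \<tau>"
      if "i \<in> J" "m < M" "m' < M" "\<sigma> \<in> {1, - 1}" "\<tau> \<in> {1, - 1}" for i m m' \<sigma> \<tau>
      by (rule same[OF that])
    show "\<exists>m'\<in>{2..5}. \<exists>\<sigma>'\<in>{1, - 1}. w (p i) m \<sigma> = w i m' \<sigma>'"
      if A: "i \<in> J" "m \<in> {2..5}" "\<sigma> \<in> {1, - 1}" for i m \<sigma>
    proof -
      obtain m' where m': "m' \<in> {2..5}" "idx (p i) m = idx i m'" using partner[OF A(1,2)] by blast
      have "coef (p i) m * \<sigma> \<in> {1, - 1}" using c\<sigma>[OF p[OF A(1)] _ A(3), of m] A(2) by simp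
      then have "\<exists>\<sigma>'\<in>{1, - 1}. w (p i) m \<sigma> = w i m' \<sigma>'"
        using repr[OF A(1) _ m'(2), of "coef (p i) m * \<sigma>"] m'(1) unfolding w_def by simp
      then show ?thesis using m'(1) by blast
    qed
    show "{w i m \<sigma>, w k m' \<tau>} \<in> gedges ?G \<longleftrightarrow> orth i k (\<sigma> * \<tau>)"
      if "i \<in> J" "k \<in> J" "k \<noteq> i" "k \<noteq> p i" "m \<in> {2..5}" "m' \<in> {2..5}" "\<sigma> \<in> {1, - 1}" "\<tau> \<in> {1, - 1}" for i k m m' \<sigma> \<tau>
      using link[of i k m m' \<sigma> \<tau>] orth[OF that(1-6) sign_mult[OF that(7,8)]] that by simp
  qed
qed

section \<open>The two subgraphs\<close>

text \<open>Up to sign e_x is e_i e_j, so e_i, e_j, e_x multiply like the units of a quaternion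
  algebra. \<open>ni\<close> and \<open>nj\<close> are the norms of e_i and e_j, and
  \<open>\<kappa>\<close> is the sign for which (e_i, \<kappa> e_j) is an \<open>x\<close>-pair. All
  nine constants are monomials in these three signs, which makes the finite check in
  \<open>table\<close> possible.\<close>

lemma cd_sign_quaternion:
  assumes \<gamma>: "\<forall>l<k. \<gamma> l \<in> {1, - 1}" and i: "i < 2 ^ k" "i \<noteq> 0" "i \<noteq> x" and x: "x < 2 ^ k" "x \<noteq> 0"
  defines "s \<equiv> cd_sign \<gamma> k" and "j \<equiv> xor i x"
  defines "ni \<equiv> - s i i" and "nj \<equiv> - s j j"
  defines "\<kappa> \<equiv> nj * s i j"
  shows "s i i = - ni" "s j j = - nj" "s i j = \<kappa> * nj" "s j i = - (\<kappa> * nj)"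
    "s i x = - (\<kappa> * ni * nj)" "s x i = \<kappa> * ni * nj" "s x j = - \<kappa>" "s j x = \<kappa>" "s x x = - (ni * nj)"
    "ni \<in> {1, - 1}" "nj \<in> {1, - 1}" "\<kappa> \<in> {1, - 1}"
proof -
  have sgn: "s a b = 1 \<or> s a b = - 1" for a b
    using cd_sign_sign[of k \<gamma> a b] \<gamma> by (simp add: s_def)
  have rules: "cj (xor a b) * s a b = cj a * cj b * s b a" "s a b * s (xor a b) b = s b b"
    "s a b * s a (xor a b) = s a a" if "a < 2 ^ k" "b < 2 ^ k" for a b
    using cd_sign_rules[of k \<gamma> a b] \<gamma> that by (simp_all add: s_def)
  have j: "j < 2 ^ k" "j \<noteq> 0" using i x by (simp_all add: j_def nat_xor_less_power2)
  have anti: "s b a = - s a b" if "a < 2 ^ k" "b < 2 ^ k" "a \<noteq> 0" "b \<noteq> 0" "a \<noteq> b" for a b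
    using rules(1)[OF that(1,2)] that by simp
  have ij: "xor i j = x" "xor j x = i" "xor i x = j" "xor j i = x" "xor x i = j"
    using i x by (simp_all add: j_def xor.commute[of x i])
  have neq: "i \<noteq> j" "j \<noteq> x"
    using ij(1,2) i(2) x(2) by auto
  have sq: "s a b * s a b = 1" "s a b * (s a b * r) = r" for a b r
    using sgn[of a b] by auto
  have rel: "s i j * s x j = s j j" "s i j * s i x = s i i" "s x i * s x j = s x x"
    using rules[OF i(1) j(1)] rules[OF i(1) x(1)] rules[OF x(1) i(1)] by (simp_all add: ij)
  have ji: "s j i = - s i j" "s x i = - s i x" "s j x = - s x j"
    using anti[OF i(1) j(1) i(2) j(2)] anti[OF i(1) x(1) i(2) x(2)] anti[OF x(1) j(1) x(2) j(2)] i neq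
    by simp_all
  have xj: "s x j = s i j * s j j" and ix: "s i x = s i j * s i i"
    unfolding rel(1,2)[symmetric] by (simp_all add: sq)
  have xx: "s x x = - (s i i * s j j)"
    unfolding rel(3)[symmetric] by (simp add: ji xj ix sq mult_ac)
  show "s i i = - ni" "s j j = - nj" "s i j = \<kappa> * nj" "s j i = - (\<kappa> * nj)"
    "s i x = - (\<kappa> * ni * nj)" "s x i = \<kappa> * ni * nj" "s x j = - \<kappa>" "s j x = \<kappa>" "s x x = - (ni * nj)"
    unfolding ni_def nj_def \<kappa>_def by (simp_all add: ji xj ix xx sq mult_ac)
  show "ni \<in> {1, - 1}" "nj \<in> {1, - 1}"
    using sgn[of i i] sgn[of j j] by (auto simp: ni_def nj_def)
  then show "\<kappa> \<in> {1, - 1}" unfolding \<kappa>_def using sgn[of i j] by auto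
qed

text \<open>With k = n - 1, so \<open>\<gamma> k\<close> and \<open>\<gamma> (Suc k)\<close> are
  \<gamma>_(n-1) and \<gamma>_n, and x is an index rather than an element.\<close>

locale cd_center =
  fixes \<gamma> :: "nat \<Rightarrow> real" and k x :: nat
  assumes k: "2 \<le> k" and \<gamma>_sign: "\<forall>l\<le>Suc k. \<gamma> l \<in> {1, - 1}"
    and x: "x < 2 ^ k" "x \<noteq> 0"
begin

lemma \<gamma>: "l \<le> Suc k \<Longrightarrow> \<gamma> l \<in> {1, - 1}"
  using \<gamma>_sign by blast

definition "J = {i. i < 2 ^ k \<and> i \<noteq> 0 \<and> i \<noteq> x}"

text \<open>The sign for which \<open>(e\<^sub>i, kap i e\<^sub>j)\<close> with \<open>j = xor i x\<close> is an \<open>x\<close>-pair.\<close>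

definition "kap i = - cd_sign \<gamma> k (xor i x) (xor i x) * cd_sign \<gamma> k i (xor i x)"

text \<open>Indices of the first entries, in the order of the adjacency tables, for the
  \<open>x\<close>-pair a = e_i, b = \<open>kap i\<close> e_j with j = \<open>xor i x\<close>.
  Adding \<open>2 ^ k\<close> to an index is the tilde. The coefficients defined next belong to the
  second entries once the first entry is scaled to coefficient 1; for instance (b, \<gamma>_n a)
  turns into (e_j, \<gamma>_n \<open>kap i\<close> e_i).\<close>

definition "idx1 i m = [2 ^ k + x, 2 ^ k, i, xor i x, 2 ^ k + i, 2 ^ k + xor i x, x] ! m"

definition "coef1 i m = [1, \<gamma> (Suc k), kap i, \<gamma> (Suc k) * kap i, kap i, \<gamma> (Suc k) * kap i, 1] ! m"

definition "idx2 i m = [x, 2 ^ k, i, 2 ^ k + xor i x, 2 ^ k + i, xor i x, 2 ^ k + x] ! m"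

text \<open>The last entry is \<gamma>_(n-1) because position 6 is occupied by (\<gamma>_(n-1) times
  x tilde, e_0).\<close>

definition "coef2 i m = [1, \<gamma> (Suc k), kap i, \<gamma> (Suc k) * kap i, \<gamma> k * kap i,
  \<gamma> k * \<gamma> (Suc k) * kap i, \<gamma> k] ! m"

lemma sgn_k: "cd_sign \<gamma> k a b \<in> {1, - 1}"
  using \<gamma> by (intro cd_sign_sign) simp

lemma kap_sign: "kap i \<in> {1, - 1}"
proof -
  have "cd_sign \<gamma> k (xor i x) (xor i x) * cd_sign \<gamma> k i (xor i x) \<in> {1, - 1}"
    by (intro sign_mult sgn_k)
  then show ?thesis by (auto simp: kap_def)
qed

lemma J_xor: "i \<in> J \<Longrightarrow> xor i x \<in> J"
  using x by (auto simp: J_def nat_xor_less_power2)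

lemma xor_neq: "i \<in> J \<Longrightarrow> xor i x \<noteq> i" "i \<in> J \<Longrightarrow> i \<noteq> xor i x"
  using x nat_xor_self_iff(1)[of i x] by auto

lemma sign_Suc:
  assumes "a < 2 ^ k" "b < 2 ^ k"
  shows "cd_sign \<gamma> (Suc k) a b = cd_sign \<gamma> k a b"
    and "cd_sign \<gamma> (Suc k) a (2 ^ k + b) = cd_sign \<gamma> k b a"
    and "cd_sign \<gamma> (Suc k) (2 ^ k + a) b = cj b * cd_sign \<gamma> k a b"
    and "cd_sign \<gamma> (Suc k) (2 ^ k + a) (2 ^ k + b) = \<gamma> k * cj b * cd_sign \<gamma> k b a"
  using assms by (simp_all add: cd_sign_Suc del: cd_sign.simps)

lemma sign_Suc_power2:
  shows "a < 2 ^ k \<Longrightarrow> cd_sign \<gamma> (Suc k) a (2 ^ k) = 1"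
    and "b < 2 ^ k \<Longrightarrow> cd_sign \<gamma> (Suc k) (2 ^ k) b = cj b"
    and "a < 2 ^ k \<Longrightarrow> cd_sign \<gamma> (Suc k) (2 ^ k + a) (2 ^ k) = \<gamma> k"
    and "b < 2 ^ k \<Longrightarrow> cd_sign \<gamma> (Suc k) (2 ^ k) (2 ^ k + b) = \<gamma> k * cj b"
    and "cd_sign \<gamma> (Suc k) (2 ^ k) (2 ^ k) = \<gamma> k"
  using cd_sign_Suc[of a k 0 \<gamma>] cd_sign_Suc[of 0 k b \<gamma>] cd_sign_Suc[of 0 k 0 \<gamma>]
  by (simp_all add: cd_sign_0 del: cd_sign.simps)

lemma xor_Suc:
  assumes "a < 2 ^ k"
  shows "xor (2 ^ k + a) x = 2 ^ k + xor a x" "xor a (2 ^ k + x) = 2 ^ k + xor a x"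
    "xor (2 ^ k + a) (2 ^ k + x) = xor a x" "xor (2 ^ k) x = 2 ^ k + x" "xor (2 ^ k) (2 ^ k + x) = x"
  using nat_xor_power2[OF assms x(1)] nat_xor_power2[of 0 k x] x by simp_all

lemma chi1: "cd_chi \<gamma> (Suc k) (cd_e x) = - (\<gamma> (Suc k) * cd_sign \<gamma> k x x)"
  using x by (subst cd_chi_eq[OF \<gamma>_sign]) (auto simp: cd_norm_e sign_Suc simp del: cd_sign.simps)

lemma chi2: "cd_chi \<gamma> (Suc k) (cd_e (2 ^ k + x)) = \<gamma> k * \<gamma> (Suc k) * cd_sign \<gamma> k x x"
  using x by (subst cd_chi_eq[OF \<gamma>_sign]) (auto simp: cd_norm_e sign_Suc simp del: cd_sign.simps)

text \<open>All constants of level k + 1 that occur reduce to the quaternion constants of level k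
  together with \<gamma>_(n-1) and \<gamma>_n. After \<gamma>_n has been expressed through the
  characteristic, each pair of positions is a check over the remaining signs.\<close>

lemma table:
  assumes i: "i \<in> J" and m: "m < m'" "m' < 7" and \<rho>': "\<rho> \<in> {1, - 1}"
  shows "cd_chi \<gamma> (Suc k) (cd_e x) = - 1 \<Longrightarrow> m' < 6 \<Longrightarrow>
      cd_link \<gamma> (Suc k) (idx1 i m) (xor (idx1 i m) x) (idx1 i m') (xor (idx1 i m') x) (coef1 i m * coef1 i m' * \<rho>)
      \<longleftrightarrow> double_hexagon_sign m m' = \<rho>" (is "_ \<Longrightarrow> _ \<Longrightarrow> ?T1")
    and "cd_chi \<gamma> (Suc k) (cd_e x) = 1 \<Longrightarrow>
      cd_link \<gamma> (Suc k) (idx1 i m) (xor (idx1 i m) x) (idx1 i m') (xor (idx1 i m') x) (coef1 i m * coef1 i m' * \<rho>)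
      \<longleftrightarrow> hexagons_sign m m' = \<rho>" (is "_ \<Longrightarrow> ?T2")
    and "cd_chi \<gamma> (Suc k) (cd_e (2 ^ k + x)) = - 1 \<Longrightarrow> m' < 6 \<Longrightarrow>
      cd_link \<gamma> (Suc k) (idx2 i m) (xor (idx2 i m) (2 ^ k + x)) (idx2 i m') (xor (idx2 i m') (2 ^ k + x)) (coef2 i m * coef2 i m' * \<rho>)
      \<longleftrightarrow> double_hexagon_sign m m' = \<rho>" (is "_ \<Longrightarrow> _ \<Longrightarrow> ?T3")
    and "cd_chi \<gamma> (Suc k) (cd_e (2 ^ k + x)) = 1 \<Longrightarrow>
      cd_link \<gamma> (Suc k) (idx2 i m) (xor (idx2 i m) (2 ^ k + x)) (idx2 i m') (xor (idx2 i m') (2 ^ k + x)) (coef2 i m * coef2 i m' * \<rho>)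
      \<longleftrightarrow> hexagons_sign m m' = \<rho>" (is "_ \<Longrightarrow> ?T4")
proof -
  define j where "j = xor i x"
  let ?s = "cd_sign \<gamma> k"
  have i': "i < 2 ^ k" "i \<noteq> 0" "i \<noteq> x" using i by (simp_all add: J_def)
  have j': "j < 2 ^ k" "j \<noteq> 0" "j \<noteq> x" using J_xor[OF i] unfolding J_def j_def by blast+
  have ij: "xor i x = j" "xor j x = i" by (simp_all add: j_def)
  define ni nj \<kappa> where "ni = - ?s i i" and "nj = - ?s j j" and "\<kappa> = nj * ?s i j"
  have \<gamma>': "\<forall>l<k. \<gamma> l \<in> {1, - 1}" using \<gamma> by simp
  note quat = cd_sign_quaternion[of k \<gamma> i x, OF \<gamma>' i' x, folded j_def,
    folded ni_def nj_def, folded \<kappa>_def]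
  have q: "?s i i = - ni" "?s j j = - nj" "?s i j = \<kappa> * nj" "?s j i = - (\<kappa> * nj)"
    "?s i x = - (\<kappa> * ni * nj)" "?s x i = \<kappa> * ni * nj" "?s x j = - \<kappa>" "?s j x = \<kappa>" "?s x x = - (ni * nj)"
    by (rule quat)+
  have ni: "ni = 1 \<or> ni = - 1" and nj: "nj = 1 \<or> nj = - 1" and \<kappa>: "\<kappa> = 1 \<or> \<kappa> = - 1"
    using quat(10-12) by simp_all
  have kap: "kap i = \<kappa>" by (simp add: kap_def \<kappa>_def nj_def j_def)
  define g h where "g = \<gamma> (Suc k)" and "h = \<gamma> k"
  have gh: "g = 1 \<or> g = - 1" "h = 1 \<or> h = - 1" using \<gamma>[of "Suc k"] \<gamma>[of k] by (simp_all add: g_def h_def)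
  have m7: "m \<in> {0, 1, 2, 3, 4, 5, 6}" "m' \<in> {0, 1, 2, 3, 4, 5, 6}"
    using m unfolding less_7_cases[symmetric] by simp_all
  note red = idx1_def coef1_def idx2_def coef2_def ij xor_Suc[OF i'(1)] xor_Suc[OF j'(1)] xor_Suc[OF x(1)]
    sign_Suc sign_Suc_power2 i' j' i'(3)[symmetric] j'(3)[symmetric] x q cd_link_def kap g_def[symmetric] h_def[symmetric] cd_sign_0 hexagons_sign_def double_hexagon_sign_def
  have \<rho>: "\<rho> = 1 \<or> \<rho> = - 1" using \<rho>' by simp
  show ?T1 if "cd_chi \<gamma> (Suc k) (cd_e x) = - 1" "m' < 6"
  proof -
    \<comment> \<open>As n(x) = \<open>ni * nj\<close>, the characteristic is
      \<open>g * ni * nj\<close> for x. For x tilde, whose norm has the extra factor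
      -\<gamma>_(n-1), it is \<open>- (h * g * ni * nj)\<close>.\<close>
    have g: "g = - (ni * nj)" using that(1) gh ni nj unfolding chi1 q g_def[symmetric] h_def[symmetric] by auto
    show ?thesis using m m7 that(2)
      by (elim insertE emptyE; (simp add: red g del: cd_sign.simps)?;
        (use ni nj \<kappa> gh(2) \<rho> in \<open>elim disjE; simp\<close>)?)
  qed
  show ?T2 if "cd_chi \<gamma> (Suc k) (cd_e x) = 1"
  proof -
    have g: "g = ni * nj" using that(1) gh ni nj unfolding chi1 q g_def[symmetric] h_def[symmetric] by auto
    show ?thesis using m m7
      by (elim insertE emptyE; (simp add: red g del: cd_sign.simps)?;
        (use ni nj \<kappa> gh(2) \<rho> in \<open>elim disjE; simp\<close>)?)
  qed
  show ?T3 if "cd_chi \<gamma> (Suc k) (cd_e (2 ^ k + x)) = - 1" "m' < 6"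
  proof -
    have g: "g = h * ni * nj" using that(1) gh ni nj unfolding chi2 q g_def[symmetric] h_def[symmetric] by auto
    show ?thesis using m m7 that(2)
      by (elim insertE emptyE; (simp add: red g del: cd_sign.simps)?;
        (use ni nj \<kappa> gh(2) \<rho> in \<open>elim disjE; simp\<close>)?)
  qed
  show ?T4 if "cd_chi \<gamma> (Suc k) (cd_e (2 ^ k + x)) = 1"
  proof -
    have g: "g = - (h * ni * nj)" using that(1) gh ni nj unfolding chi2 q g_def[symmetric] h_def[symmetric] by auto
    show ?thesis using m m7
      by (elim insertE emptyE; (simp add: red g del: cd_sign.simps)?;
        (use ni nj \<kappa> gh(2) \<rho> in \<open>elim disjE; simp\<close>)?)
  qed
qed

text \<open>Orthogonality one level lower, with the last parameter replaced by \<gamma>_n, and by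
  \<gamma>_(n-1) \<gamma>_n in \<open>orth2\<close>. The factors \<open>kap\<close> pass from signs
  relative to \<open>x\<close>-pairs to plain coefficients.\<close>

definition "orth1 i l \<rho> \<longleftrightarrow>
  cd_link (\<gamma>(k := \<gamma> (Suc k))) k i (xor i x) l (xor l x) (kap i * kap l * \<rho>)"

definition "orth2 i l \<rho> \<longleftrightarrow>
  cd_link (\<gamma>(k := \<gamma> k * \<gamma> (Suc k))) k i (xor i x) l (xor l x) (kap i * kap l * \<rho>)"

text \<open>In C(x) both entries of a pair carry a tilde or neither does, so a factor \<gamma>_(n-1)
  is common to both summands of a coordinate and cancels. In C(x tilde) exactly one entry carries a
  tilde; multiplying two such pairs puts \<gamma>_(n-1) in front of only one summand, which explains
  the product parameter in \<open>orth2\<close>. The indices of different blocks are distinct and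
  nonzero, so their basis elements anticommute.\<close>

lemma cross:
  assumes i: "i \<in> J" and l: "l \<in> J" "l \<noteq> i" "l \<noteq> xor i x" and m: "m \<in> {2..5}" "m' \<in> {2..5}"
    and \<rho>: "\<rho> \<in> {1, - 1}"
  shows "cd_link \<gamma> (Suc k) (idx1 i m) (xor (idx1 i m) x) (idx1 l m') (xor (idx1 l m') x)
      (coef1 i m * coef1 l m' * \<rho>) \<longleftrightarrow> orth1 i l \<rho>" (is ?T1)
    and "cd_link \<gamma> (Suc k) (idx2 i m) (xor (idx2 i m) (2 ^ k + x)) (idx2 l m') (xor (idx2 l m') (2 ^ k + x))
      (coef2 i m * coef2 l m' * \<rho>) \<longleftrightarrow> orth2 i l \<rho>" (is ?T2)
    and "idx1 i m \<noteq> idx1 l m'" and "idx2 i m \<noteq> idx2 l m'"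
proof -
  define j where "j = xor i x"
  define q where "q = xor l x"
  let ?s = "cd_sign \<gamma> k"
  have i': "i < 2 ^ k" "i \<noteq> 0" "i \<noteq> x" using i by (simp_all add: J_def)
  have j': "j < 2 ^ k" "j \<noteq> 0" "j \<noteq> x" using J_xor[OF i] unfolding J_def j_def by blast+
  have l': "l < 2 ^ k" "l \<noteq> 0" "l \<noteq> x" using l by (simp_all add: J_def)
  have q': "q < 2 ^ k" "q \<noteq> 0" "q \<noteq> x" using J_xor[OF l(1)] unfolding J_def q_def by blast+
  have xors: "xor i x = j" "xor j x = i" "xor l x = q" "xor q x = l" by (simp_all add: j_def q_def)
  have neq: "i \<noteq> l" "i \<noteq> q" "j \<noteq> l" "j \<noteq> q"
    using l(2,3) unfolding j_def q_def by (metis nat_xor_cancel(2))+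
  have anti: "?s b a = - ?s a b" if "a < 2 ^ k" "b < 2 ^ k" "a \<noteq> 0" "b \<noteq> 0" "a \<noteq> b" for a b
    using cd_sign_rules[of k \<gamma> a b] \<gamma> that by simp
  txt \<open>Only the products \<open>B\<close> and \<open>C\<close> of signs matter, so \<open>r\<close> and \<open>t\<close> will cancel.\<close>
  define r t B C where "r = ?s i l" and "t = ?s i q" and "B = r * ?s j q" and "C = t * ?s j l"
  have rt: "r = 1 \<or> r = - 1" "t = 1 \<or> t = - 1"
    using sgn_k by (simp_all add: r_def t_def)
  then have s: "?s i l = r" "?s l i = - r" "?s j q = r * B" "?s q j = - (r * B)"
    "?s i q = t" "?s q i = - t" "?s j l = t * C" "?s l j = - (t * C)"
    using anti[OF i'(1) l'(1) i'(2) l'(2) neq(1)] anti[OF j'(1) q'(1) j'(2) q'(2) neq(4)]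
      anti[OF i'(1) q'(1) i'(2) q'(2) neq(2)] anti[OF j'(1) l'(1) j'(2) l'(2) neq(3)]
    by (auto simp: r_def[symmetric] t_def[symmetric] B_def C_def)
  have BC: "B = 1 \<or> B = - 1" "C = 1 \<or> C = - 1"
    using sign_mult[OF sgn_k sgn_k] by (simp_all add: r_def t_def B_def C_def)
  define g h where "g = \<gamma> (Suc k)" and "h = \<gamma> k"
  have gh: "g = 1 \<or> g = - 1" "h = 1 \<or> h = - 1" using \<gamma>[of "Suc k"] \<gamma>[of k] by (simp_all add: g_def h_def)
  have sq: "r * (r * z) = z" "t * (t * z) = z" "g * (g * z) = z" "h * (h * z) = z"
    "r * r = 1" "t * t = 1" "g * g = 1" "h * h = 1" for z
    using rt gh by auto
  have s': "cd_sign (\<gamma>(k := c)) k a b = ?s a b" for a b c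
    by (rule cd_sign_cong) simp
  define A where "A = kap i * kap l * \<rho>"
  have A: "A = 1 \<or> A = - 1"
    using sign_mult[OF sign_mult[OF kap_sign kap_sign] \<rho>] unfolding A_def by blast
  have coef: "c * kap i * (c' * kap l) * \<rho> = c * c' * A" "c * kap i * kap l * \<rho> = c * A"
    "kap i * (c' * kap l) * \<rho> = c' * A" "kap i * kap l * \<rho> = A" for c c'
    by (simp_all add: A_def)
  have m5: "m \<in> {2, 3, 4, 5}" "m' \<in> {2, 3, 4, 5}" using m by auto
  note red = xors xor_Suc[OF i'(1)] xor_Suc[OF j'(1)] xor_Suc[OF l'(1)] xor_Suc[OF q'(1)]
    sign_Suc i' j' l' q' s cd_link_def g_def[symmetric] h_def[symmetric] orth1_def orth2_def s' coef sq mult_ac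
  show ?T1
    using m5
    by (elim insertE emptyE; simp add: idx1_def coef1_def red del: cd_sign.simps;
      (use BC gh A in \<open>elim disjE; simp\<close>)?)
  show ?T2
    using m5
    by (elim insertE emptyE; simp add: idx2_def coef2_def red del: cd_sign.simps;
      (use BC gh A in \<open>elim disjE; simp\<close>)?)
  show "idx1 i m \<noteq> idx1 l m'" "idx2 i m \<noteq> idx2 l m'"
    using m5 neq i'(1) j'(1) l'(1) q'(1)
    by (auto simp: idx1_def idx2_def xors)
qed

section \<open>The four instances of the abstract block graph\<close>

definition "w1 i m \<sigma> = cd_vertex (Suc k) (idx1 i m) (xor (idx1 i m) x) (coef1 i m * \<sigma>)"

definition "w2 i m \<sigma> = cd_vertex (Suc k) (idx2 i m) (xor (idx2 i m) (2 ^ k + x)) (coef2 i m * \<sigma>)"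

lemma J_nonempty: "J \<noteq> {}"
proof -
  have "(2::nat) ^ 2 \<le> 2 ^ k" using k by (intro power_increasing) simp_all
  \<comment> \<open>The numbers 1 and 2 cannot both equal x; that 2 is a valid index uses
    \<open>2 \<le> k\<close>.\<close>
  then have "1 \<in> J \<or> 2 \<in> J" by (auto simp: J_def)
  then show ?thesis by blast
qed

lemma distinct_idx:
  assumes "i \<in> J"
  shows "distinct [2 ^ k + x, 2 ^ k, i, xor i x, 2 ^ k + i, 2 ^ k + xor i x, x]"
    and "distinct [x, 2 ^ k, i, 2 ^ k + xor i x, 2 ^ k + i, xor i x, 2 ^ k + x]"
  using assms J_xor[OF assms] xor_neq[OF assms] x by (auto simp: J_def)

lemma inj_on_idx:
  assumes "i \<in> J"
  shows "inj_on (idx1 i) {..<7}" "inj_on (idx2 i) {..<7}"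
  unfolding inj_on_def idx1_def idx2_def
  using distinct_idx[OF assms] by (auto simp: nth_eq_iff_index_eq simp del: distinct.simps)

lemma idx_bounds:
  assumes "i \<in> J" "m < 7"
  shows "idx1 i m < 2 ^ Suc k \<and> idx1 i m \<noteq> 0" "idx2 i m < 2 ^ Suc k \<and> idx2 i m \<noteq> 0"
proof -
  have "i < 2 ^ k" "i \<noteq> 0" "xor i x < 2 ^ k" "xor i x \<noteq> 0"
    using assms(1) J_xor[OF assms(1)] by (simp_all add: J_def)
  then show "idx1 i m < 2 ^ Suc k \<and> idx1 i m \<noteq> 0" "idx2 i m < 2 ^ Suc k \<and> idx2 i m \<noteq> 0"
    using assms(2) x unfolding less_7_cases
    by (elim insertE emptyE; simp add: idx1_def idx2_def)+
qed

lemma coef_sign: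
  assumes "m < 7"
  shows "coef1 i m \<in> {1, - 1}" "coef2 i m \<in> {1, - 1}"
proof -
  have "\<gamma> k \<in> {1, - 1}" "\<gamma> (Suc k) \<in> {1, - 1}" using \<gamma> by simp_all
  then show "coef1 i m \<in> {1, - 1}" "coef2 i m \<in> {1, - 1}"
    using assms kap_sign[of i] unfolding less_7_cases
    by (elim insertE emptyE; simp add: coef1_def coef2_def)+
qed

lemma idx_special:
  assumes "m \<in> {0, 1, 6}"
  shows "idx1 i m = idx1 l m \<and> coef1 i m = coef1 l m" "idx2 i m = idx2 l m \<and> coef2 i m = coef2 l m"
  using assms by (elim insertE emptyE; simp add: idx1_def idx2_def coef1_def coef2_def)+

lemma idx_cover:
  assumes "r < 2 ^ Suc k" "r \<noteq> 0"
  shows "\<exists>i\<in>J. \<exists>m<7. r = idx1 i m" "\<exists>i\<in>J. \<exists>m<7. r = idx2 i m"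
proof -
  obtain i0 where i0: "i0 \<in> J" using J_nonempty by blast
  have "(\<exists>i\<in>J. \<exists>m<7. r = idx1 i m) \<and> (\<exists>i\<in>J. \<exists>m<7. r = idx2 i m)"
    using assms(1)
  proof (cases rule: less_power2_Suc_cases)
    case low
    show ?thesis
    proof (cases "r = x")
      case True
      then have "r = idx1 i0 6" "r = idx2 i0 0" by (simp_all add: idx1_def idx2_def)
      moreover have "(0::nat) < 7" "(6::nat) < 7" by simp_all
      ultimately show ?thesis using i0 by blast
    next
      case False
      \<comment> \<open>As \<open>J\<close> contains both names of each block, position 2 here and
        position 4 below already reach every index that is not special.\<close>
      then have "r \<in> J" "r = idx1 r 2" "r = idx2 r 2" using low assms(2) by (simp_all add: J_def idx1_def idx2_def)
      moreover have "(2::nat) < 7" by simp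
      ultimately show ?thesis by blast
    qed
  next
    case (high r')
    show ?thesis
    proof (cases "r' = 0 \<or> r' = x")
      case True
      then have "(r = idx1 i0 1 \<or> r = idx1 i0 0) \<and> (r = idx2 i0 1 \<or> r = idx2 i0 6)"
        using high by (auto simp: idx1_def idx2_def)
      moreover have "(0::nat) < 7" "(1::nat) < 7" "(6::nat) < 7" by simp_all
      ultimately show ?thesis using i0 by blast
    next
      case False
      then have "r' \<in> J" "r = idx1 r' 4" "r = idx2 r' 4" using high by (simp_all add: J_def idx1_def idx2_def)
      moreover have "(4::nat) < 7" by simp
      ultimately show ?thesis by blast
    qed
  qed
  then show "\<exists>i\<in>J. \<exists>m<7. r = idx1 i m" "\<exists>i\<in>J. \<exists>m<7. r = idx2 i m" by blast+
qed

text \<open>Passing to \<open>xor i x\<close> exchanges the roles of a and b: positions 2 and 3 as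
  well as 4 and 5 are swapped in C(x), positions 2 and 5 as well as 3 and 4 in C(x tilde).\<close>

lemma idx_partner:
  assumes "m \<in> {2..5}"
  shows "\<exists>m'\<in>{2..5}. idx1 (xor i x) m = idx1 i m'" "\<exists>m'\<in>{2..5}. idx2 (xor i x) m = idx2 i m'"
proof -
  have "m \<in> {2, 3, 4, 5}" using assms by auto
  then show "\<exists>m'\<in>{2..5}. idx1 (xor i x) m = idx1 i m'"
    by (elim insertE emptyE; simp only:)
      (rule bexI[of _ 3] bexI[of _ 2] bexI[of _ 5] bexI[of _ 4]; simp add: idx1_def; fail)+
  have "m \<in> {2, 3, 4, 5}" using assms by auto
  then show "\<exists>m'\<in>{2..5}. idx2 (xor i x) m = idx2 i m'"
    by (elim insertE emptyE; simp only:)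
      (rule bexI[of _ 5] bexI[of _ 4] bexI[of _ 3] bexI[of _ 2]; simp add: idx2_def; fail)+
qed

lemma idx_6: "idx1 i 6 = x" "idx2 i 6 = 2 ^ k + x"
  by (simp_all add: idx1_def idx2_def)

lemma x_less: "x < 2 ^ Suc k" "2 ^ k + x < 2 ^ Suc k"
  using x by simp_all

lemma double_hexagons1:
  assumes chi: "cd_chi \<gamma> (Suc k) (cd_e x) = - 1"
  shows "double_hexagons (cd_C \<gamma> (Suc k) (cd_e x)) J (\<lambda>i. xor i x) w1 orth1"
  unfolding double_hexagons_def w1_def
  by (rule block_graphI[OF \<gamma>_sign x_less(1) J_nonempty disjI2[OF conjI[OF refl chi]]
        idx_bounds(1) inj_on_idx(1) idx_6(1) coef_sign(1) idx_special(1) idx_cover(1)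
        sign_table_sym(2) sign_table_irrefl(2) double_hexagon_sign_ex table(1)[OF _ _ _ _ chi]
        J_xor idx_partner(1) conjI[OF cross(3) cross(1)]]) simp_all

lemma hexagons1:
  assumes chi: "cd_chi \<gamma> (Suc k) (cd_e x) = 1"
  shows "hexagons (cd_C \<gamma> (Suc k) (cd_e x)) J (\<lambda>i. xor i x) w1 orth1"
  unfolding hexagons_def w1_def
  by (rule block_graphI[OF \<gamma>_sign x_less(1) J_nonempty disjI1[OF refl]
        idx_bounds(1) inj_on_idx(1) idx_6(1) coef_sign(1) idx_special(1) idx_cover(1)
        sign_table_sym(1) sign_table_irrefl(1) hexagons_sign_ex table(2)[OF _ _ _ _ chi]
        J_xor idx_partner(1) conjI[OF cross(3) cross(1)]]) simp_all

lemma double_hexagons2: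
  assumes chi: "cd_chi \<gamma> (Suc k) (cd_e (2 ^ k + x)) = - 1"
  shows "double_hexagons (cd_C \<gamma> (Suc k) (cd_e (2 ^ k + x))) J (\<lambda>i. xor i x) w2 orth2"
  unfolding double_hexagons_def w2_def
  by (rule block_graphI[OF \<gamma>_sign x_less(2) J_nonempty disjI2[OF conjI[OF refl chi]]
        idx_bounds(2) inj_on_idx(2) idx_6(2) coef_sign(2) idx_special(2) idx_cover(2)
        sign_table_sym(2) sign_table_irrefl(2) double_hexagon_sign_ex table(3)[OF _ _ _ _ chi]
        J_xor idx_partner(2) conjI[OF cross(4) cross(2)]]) simp_all

lemma hexagons2:
  assumes chi: "cd_chi \<gamma> (Suc k) (cd_e (2 ^ k + x)) = 1"
  shows "hexagons (cd_C \<gamma> (Suc k) (cd_e (2 ^ k + x))) J (\<lambda>i. xor i x) w2 orth2"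
  unfolding hexagons_def w2_def
  by (rule block_graphI[OF \<gamma>_sign x_less(2) J_nonempty disjI1[OF refl]
        idx_bounds(2) inj_on_idx(2) idx_6(2) coef_sign(2) idx_special(2) idx_cover(2)
        sign_table_sym(1) sign_table_irrefl(1) hexagons_sign_ex table(4)[OF _ _ _ _ chi]
        J_xor idx_partner(2) conjI[OF cross(4) cross(2)]]) simp_all

section \<open>Translation between indices and pairs of algebra elements\<close>

abbreviation "L \<equiv> cd_line (Suc k)"
abbreviation "t \<equiv> cd_tilde \<gamma> (Suc k)"
abbreviation "te \<equiv> cd_te (Suc k)"
abbreviation "g \<equiv> \<gamma> (Suc k)"
abbreviation "h \<equiv> \<gamma> k"
abbreviation "V \<equiv> cd_vertex (Suc k)"

lemma te_eq: "te = cd_e (2 ^ k)"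
  by (simp add: cd_te_def)

lemma tilde_e: "i < 2 ^ k \<Longrightarrow> t (cd_e i) = cd_e (2 ^ k + i)"
  using nat_xor_power2(1)[of i k 0]
  by (simp add: cd_tilde_def te_eq cd_mult_e sign_Suc_power2 del: cd_mult.simps cd_sign.simps)

lemma tilde_scaleR: "t (r *\<^sub>R a) = r *\<^sub>R t a"
  by (simp add: cd_tilde_def cd_mult_scaleR del: cd_mult.simps)

lemma line_e:
  "L (cd_e i) (cd_e j) = V i j 1" "L (cd_e i) (\<tau> *\<^sub>R cd_e j) = V i j \<tau>"
  "L (cd_e i) (- cd_e j) = V i j (- 1)" "L (cd_e i) (- (\<tau> *\<^sub>R cd_e j)) = V i j (- \<tau>)"
  by (simp_all add: cd_vertex_def)

lemma line_scaleR_e: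
  assumes "\<sigma> \<in> {1, - 1}"
  shows "L (\<sigma> *\<^sub>R cd_e i) (cd_e j) = V i j \<sigma>" "L (\<sigma> *\<^sub>R cd_e i) (\<tau> *\<^sub>R cd_e j) = V i j (\<sigma> * \<tau>)"
    "L (\<sigma> *\<^sub>R cd_e i) (- cd_e j) = V i j (- \<sigma>)" "L (\<sigma> *\<^sub>R cd_e i) (- (\<tau> *\<^sub>R cd_e j)) = V i j (- (\<sigma> * \<tau>))"
  using cd_line_scaleR[OF assms, of "Suc k" i 1 j] cd_line_scaleR[OF assms, of "Suc k" i \<tau> j]
    cd_line_scaleR[OF assms, of "Suc k" i "- 1" j] cd_line_scaleR[OF assms, of "Suc k" i "- \<tau>" j]
  by simp_all

lemma w1_eqs:
  assumes "i \<in> J"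
  shows "w1 i 0 \<sigma> = V (2 ^ k + x) (2 ^ k) \<sigma>" "w1 i 1 \<sigma> = V (2 ^ k) (2 ^ k + x) (g * \<sigma>)"
    "w1 i 2 \<sigma> = V i (xor i x) (kap i * \<sigma>)" "w1 i 3 \<sigma> = V (xor i x) i (g * kap i * \<sigma>)"
    "w1 i 4 \<sigma> = V (2 ^ k + i) (2 ^ k + xor i x) (kap i * \<sigma>)"
    "w1 i 5 \<sigma> = V (2 ^ k + xor i x) (2 ^ k + i) (g * kap i * \<sigma>)"
    "w1 i 6 \<sigma> = V x 0 \<sigma>"
  using assms J_xor[OF assms] x
  by (simp_all add: w1_def idx1_def coef1_def xor_Suc J_def)

lemma w2_eqs:
  assumes "i \<in> J"
  shows "w2 i 0 \<sigma> = V x (2 ^ k) \<sigma>" "w2 i 1 \<sigma> = V (2 ^ k) x (g * \<sigma>)"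
    "w2 i 2 \<sigma> = V i (2 ^ k + xor i x) (kap i * \<sigma>)" "w2 i 3 \<sigma> = V (2 ^ k + xor i x) i (g * kap i * \<sigma>)"
    "w2 i 4 \<sigma> = V (2 ^ k + i) (xor i x) (h * kap i * \<sigma>)"
    "w2 i 5 \<sigma> = V (xor i x) (2 ^ k + i) (h * g * kap i * \<sigma>)"
    "w2 i 6 \<sigma> = V (2 ^ k + x) 0 (h * \<sigma>)"
  using assms J_xor[OF assms] x
  by (simp_all add: w2_def idx2_def coef2_def xor_Suc J_def)

text \<open>The dictionary between signed pairs and blocks: the line of (a, b) is position 2 of
  block i with sign s. For s = 1 these are the \<open>x\<close>-pairs; the value -1 is needed
  because quadruples only require ab to be x up to sign.\<close>

definition rep :: "cd \<Rightarrow> cd \<Rightarrow> nat \<Rightarrow> real \<Rightarrow> bool" where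
  "rep a b i s \<longleftrightarrow> i \<in> J \<and> (\<exists>\<alpha>\<in>{1, - 1}. \<exists>\<beta>\<in>{1, - 1}. \<alpha> * \<beta> = kap i * s \<and>
     a = \<alpha> *\<^sub>R cd_e i \<and> b = \<beta> *\<^sub>R cd_e (xor i x))"

lemma rep_ex:
  assumes "i \<in> J" "s \<in> {1, - 1}"
  shows "\<exists>a b. rep a b i s"
proof -
  have "rep (1 *\<^sub>R cd_e i) ((kap i * s) *\<^sub>R cd_e (xor i x)) i s"
    unfolding rep_def using assms sign_mult[OF kap_sign assms(2), of i]
    by (intro conjI bexI[of _ 1] bexI[of _ "kap i * s"]) simp_all
  then show ?thesis by blast
qed

lemma rep_lines:
  assumes "rep a b i s"
  shows "L a b = w1 i 2 s" "L b (g *\<^sub>R a) = w1 i 3 s" "L (t a) (t b) = w1 i 4 s" "L (t b) (g *\<^sub>R t a) = w1 i 5 s"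
    "L a (- b) = w1 i 2 (- s)" "L b (- (g *\<^sub>R a)) = w1 i 3 (- s)"
    "L (t a) (- t b) = w1 i 4 (- s)" "L (t b) (- (g *\<^sub>R t a)) = w1 i 5 (- s)"
    and "L a (t b) = w2 i 2 s" "L (t b) (g *\<^sub>R a) = w2 i 3 s" "L (t a) (h *\<^sub>R b) = w2 i 4 s"
    "L b ((h * g) *\<^sub>R t a) = w2 i 5 s"
    "L a (- t b) = w2 i 2 (- s)" "L (t b) (- (g *\<^sub>R a)) = w2 i 3 (- s)" "L (t a) (- (h *\<^sub>R b)) = w2 i 4 (- s)"
    "L b (- ((h * g) *\<^sub>R t a)) = w2 i 5 (- s)"
proof -
  obtain \<alpha> \<beta> where i: "i \<in> J" and \<alpha>\<beta>: "\<alpha> \<in> {1, - 1}" "\<beta> \<in> {1, - 1}"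
    and eq: "\<alpha> * \<beta> = kap i * s" and a: "a = \<alpha> *\<^sub>R cd_e i" and b: "b = \<beta> *\<^sub>R cd_e (xor i x)"
    using assms unfolding rep_def by blast
  have less: "i < 2 ^ k" "xor i x < 2 ^ k" using i J_xor[OF i] by (simp_all add: J_def)
  have eqs: "\<beta> * (c * \<alpha>) = c * kap i * s" "\<alpha> * (c * \<beta>) = c * kap i * s" for c
    using eq by (simp_all add: mult_ac)
  note red = a b tilde_scaleR tilde_e less line_scaleR_e[OF \<alpha>\<beta>(1)] line_scaleR_e[OF \<alpha>\<beta>(2)]
    scaleR_scaleR w1_eqs[OF i] w2_eqs[OF i] eq eqs mult_minus_right
  show "L a b = w1 i 2 s" "L b (g *\<^sub>R a) = w1 i 3 s" "L (t a) (t b) = w1 i 4 s" "L (t b) (g *\<^sub>R t a) = w1 i 5 s"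
    "L a (- b) = w1 i 2 (- s)" "L b (- (g *\<^sub>R a)) = w1 i 3 (- s)"
    "L (t a) (- t b) = w1 i 4 (- s)" "L (t b) (- (g *\<^sub>R t a)) = w1 i 5 (- s)"
    by (simp_all only: red)
  show "L a (t b) = w2 i 2 s" "L (t b) (g *\<^sub>R a) = w2 i 3 s" "L (t a) (h *\<^sub>R b) = w2 i 4 s"
    "L b ((h * g) *\<^sub>R t a) = w2 i 5 s"
    "L a (- t b) = w2 i 2 (- s)" "L (t b) (- (g *\<^sub>R a)) = w2 i 3 (- s)" "L (t a) (- (h *\<^sub>R b)) = w2 i 4 (- s)"
    "L b (- ((h * g) *\<^sub>R t a)) = w2 i 5 (- s)"
    by (simp_all only: red)
qed

lemma special_lines:
  assumes i: "i \<in> J"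
  shows "L (t (cd_e x)) te = w1 i 0 1" "L te (g *\<^sub>R t (cd_e x)) = w1 i 1 1"
    "L (t (cd_e x)) (- te) = w1 i 0 (- 1)" "L te (- (g *\<^sub>R t (cd_e x))) = w1 i 1 (- 1)"
    "L (cd_e x) (cd_e 0) = w1 i 6 1" "L (cd_e x) (- cd_e 0) = w1 i 6 (- 1)"
    and "L (cd_e x) te = w2 i 0 1" "L te (g *\<^sub>R cd_e x) = w2 i 1 1"
    "L (cd_e x) (- te) = w2 i 0 (- 1)" "L te (- (g *\<^sub>R cd_e x)) = w2 i 1 (- 1)"
    "L (h *\<^sub>R t (cd_e x)) (cd_e 0) = w2 i 6 1" "L (h *\<^sub>R t (cd_e x)) (- cd_e 0) = w2 i 6 (- 1)"
  using x line_scaleR_e[OF \<gamma>[of k]] unfolding w1_eqs[OF i] w2_eqs[OF i]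
  by (simp_all add: te_eq tilde_e line_e)

text \<open>For a = \<alpha> e_i and b = \<beta> e_j the defining equation forces j =
  \<open>xor i x\<close> and says that \<alpha> \<beta> times the sign of e_i e_j is n(e_j).
  Multiplying by that sign gives \<alpha> \<beta> = \<open>kap i\<close>.\<close>

lemma x_pairs_iff: "(a, b) \<in> x_pairs \<gamma> (Suc k) (cd_e x) \<longleftrightarrow> (\<exists>i. rep a b i 1)"
proof
  assume "(a, b) \<in> x_pairs \<gamma> (Suc k) (cd_e x)"
  then obtain i \<alpha> j \<beta> where i: "i < 2 ^ k" "i \<noteq> 0" "\<alpha> \<in> {1, - 1}" "a = \<alpha> *\<^sub>R cd_e i"
    and j: "j < 2 ^ k" "j \<noteq> 0" "\<beta> \<in> {1, - 1}" "b = \<beta> *\<^sub>R cd_e j"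
    and ab: "cd_mult \<gamma> k a b = cd_norm \<gamma> k b *\<^sub>R cd_e x"
    unfolding x_pairs_def plus_minus_basis_iff by auto
  have sq: "\<beta>\<^sup>2 = 1" "\<alpha> * \<alpha> = 1" using i j by auto
  have sgn: "cd_sign \<gamma> k i' j' * cd_sign \<gamma> k i' j' = 1" for i' j'
    using sgn_k[of i' j'] by auto
  have "(\<alpha> * \<beta> * cd_sign \<gamma> k i j) *\<^sub>R cd_e (xor i j) = (- cd_sign \<gamma> k j j) *\<^sub>R cd_e x"
    using ab i j by (simp add: cd_mult_scaleR cd_mult_e cd_norm_scaleR cd_norm_e sq mult_ac)
  moreover have "\<alpha> * \<beta> * cd_sign \<gamma> k i j \<noteq> 0"
    using i(3) j(3) sgn[of i j] by auto
  ultimately have *: "\<alpha> * \<beta> * cd_sign \<gamma> k i j = - cd_sign \<gamma> k j j" and "xor i j = x"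
    using scaleR_cd_e_eq_iff[of "\<alpha> * \<beta> * cd_sign \<gamma> k i j" "xor i j" "- cd_sign \<gamma> k j j" x]
    by blast+
  then have jx: "j = xor i x" by auto
  have "\<alpha> * \<beta> = \<alpha> * \<beta> * cd_sign \<gamma> k i j * cd_sign \<gamma> k i j"
    using sgn[of i j] by (simp add: mult.assoc)
  then have "\<alpha> * \<beta> = kap i * 1"
    unfolding * by (simp add: kap_def jx)
  moreover have "i \<in> J" using i j(2) jx by (auto simp: J_def)
  ultimately have "rep a b i 1" unfolding rep_def using i j jx by blast
  then show "\<exists>i. rep a b i 1" by blast
next
  assume "\<exists>i. rep a b i 1"
  then obtain i \<alpha> \<beta> where i: "i \<in> J" "\<alpha> \<in> {1, - 1}" "\<beta> \<in> {1, - 1}" "\<alpha> * \<beta> = kap i"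
    and ab: "a = \<alpha> *\<^sub>R cd_e i" "b = \<beta> *\<^sub>R cd_e (xor i x)"
    unfolding rep_def mult_1_right by blast
  have less: "i < 2 ^ k" "i \<noteq> 0" "xor i x < 2 ^ k" "xor i x \<noteq> 0"
    using i(1) J_xor[OF i(1)] unfolding J_def by blast+
  have sq: "\<beta>\<^sup>2 = 1" using i(3) by auto
  have "cd_sign \<gamma> k i (xor i x) * cd_sign \<gamma> k i (xor i x) = 1"
    using sgn_k[of i "xor i x"] by auto
  then have "\<alpha> * \<beta> * cd_sign \<gamma> k i (xor i x) = - cd_sign \<gamma> k (xor i x) (xor i x)"
    unfolding i(4) kap_def by (simp add: mult.assoc)
  then have "cd_mult \<gamma> k a b = cd_norm \<gamma> k b *\<^sub>R cd_e x"
    using less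
    by (simp add: ab cd_mult_scaleR cd_mult_e cd_norm_scaleR cd_norm_e sq mult.left_commute[of \<beta>] mult.assoc)
  then show "(a, b) \<in> x_pairs \<gamma> (Suc k) (cd_e x)"
    unfolding x_pairs_def plus_minus_basis_iff using less i ab by auto
qed

text \<open>The products force the second indices to be \<open>xor i x\<close> and
  \<open>xor l x\<close>, so linear independence of the five signed basis elements amounts to the
  two pairs lying in different blocks.\<close>

lemma x_quads_iff:
  "(a, b, c, d) \<in> x_quads \<gamma> (Suc k) (cd_e x) \<longleftrightarrow>
    (\<exists>i l \<sigma> \<tau>. l \<noteq> i \<and> l \<noteq> xor i x \<and> \<sigma> \<in> {1, - 1} \<and> \<tau> \<in> {1, - 1} \<and> rep a b i \<sigma> \<and> rep c d l \<tau>)"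
proof
  assume "(a, b, c, d) \<in> x_quads \<gamma> (Suc k) (cd_e x)"
  then have pm: "a \<in> plus_minus (cd_basis' k)" "b \<in> plus_minus (cd_basis' k)"
      "c \<in> plus_minus (cd_basis' k)" "d \<in> plus_minus (cd_basis' k)"
    and mult: "cd_mult \<gamma> k a b \<in> {cd_e x, - cd_e x}" "cd_mult \<gamma> k c d \<in> {cd_e x, - cd_e x}"
    and indep: "lin_indep [a, b, c, d, cd_e x]"
    unfolding x_quads_def by auto
  from pm(1) obtain i \<alpha> where i: "i < 2 ^ k" "i \<noteq> 0" "\<alpha> \<in> {1, - 1}" "a = \<alpha> *\<^sub>R cd_e i"
    unfolding plus_minus_basis_iff by blast
  from pm(2) obtain j \<beta> where j: "j < 2 ^ k" "j \<noteq> 0" "\<beta> \<in> {1, - 1}" "b = \<beta> *\<^sub>R cd_e j"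
    unfolding plus_minus_basis_iff by blast
  from pm(3) obtain l \<delta> where l: "l < 2 ^ k" "l \<noteq> 0" "\<delta> \<in> {1, - 1}" "c = \<delta> *\<^sub>R cd_e l"
    unfolding plus_minus_basis_iff by blast
  from pm(4) obtain q \<epsilon> where q: "q < 2 ^ k" "q \<noteq> 0" "\<epsilon> \<in> {1, - 1}" "d = \<epsilon> *\<^sub>R cd_e q"
    unfolding plus_minus_basis_iff by blast
  have \<gamma>': "\<And>l. l < k \<Longrightarrow> \<gamma> l \<in> {1, - 1}" using \<gamma> by simp
  have jx: "j = xor i x"
    using mult(1) cd_mult_pm_iff[of k \<gamma> i j \<alpha> \<beta> x] \<gamma>' i j by simp
  have qx: "q = xor l x"
    using mult(2) cd_mult_pm_iff[of k \<gamma> l q \<delta> \<epsilon> x] \<gamma>' l q by simp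
  have "l \<noteq> i" using lin_indep_neq[OF indep, of 2 0 \<delta> l \<alpha> i] i l by simp
  moreover have "l \<noteq> xor i x" using lin_indep_neq[OF indep, of 2 1 \<delta> l \<beta> j] j l jx by simp
  moreover have "i \<in> J" "l \<in> J" using i l j(2) q(2) jx qx by (auto simp: J_def)
  moreover have "rep a b i (kap i * (\<alpha> * \<beta>))" "rep c d l (kap l * (\<delta> * \<epsilon>))"
  proof -
    have sq: "kap r * (kap r * s) = s" for r s using kap_sign[of r] by auto
    show "rep a b i (kap i * (\<alpha> * \<beta>))"
      unfolding rep_def sq using i j jx \<open>i \<in> J\<close> by blast
    show "rep c d l (kap l * (\<delta> * \<epsilon>))"
      unfolding rep_def sq using l q qx \<open>l \<in> J\<close> by blast
  qed
  moreover have "kap i * (\<alpha> * \<beta>) \<in> {1, - 1}" "kap l * (\<delta> * \<epsilon>) \<in> {1, - 1}"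
    by (intro sign_mult kap_sign i(3) j(3) l(3) q(3))+
  ultimately show "\<exists>i l \<sigma> \<tau>. l \<noteq> i \<and> l \<noteq> xor i x \<and> \<sigma> \<in> {1, - 1} \<and> \<tau> \<in> {1, - 1} \<and> rep a b i \<sigma> \<and> rep c d l \<tau>"
    by blast
next
  assume "\<exists>i l \<sigma> \<tau>. l \<noteq> i \<and> l \<noteq> xor i x \<and> \<sigma> \<in> {1, - 1} \<and> \<tau> \<in> {1, - 1} \<and> rep a b i \<sigma> \<and> rep c d l \<tau>"
  then obtain i l \<alpha> \<beta> \<delta> \<epsilon> where il: "l \<noteq> i" "l \<noteq> xor i x" "i \<in> J" "l \<in> J"
    and \<alpha>: "\<alpha> \<in> {1, - 1}" "\<beta> \<in> {1, - 1}" "\<delta> \<in> {1, - 1}" "\<epsilon> \<in> {1, - 1}"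
    and a: "a = \<alpha> *\<^sub>R cd_e i" and b: "b = \<beta> *\<^sub>R cd_e (xor i x)"
    and c: "c = \<delta> *\<^sub>R cd_e l" and d: "d = \<epsilon> *\<^sub>R cd_e (xor l x)"
    unfolding rep_def by blast
  have J: "i < 2 ^ k" "i \<noteq> 0" "i \<noteq> x" "xor i x < 2 ^ k" "xor i x \<noteq> 0" "xor i x \<noteq> x"
    "l < 2 ^ k" "l \<noteq> 0" "l \<noteq> x" "xor l x < 2 ^ k" "xor l x \<noteq> 0" "xor l x \<noteq> x"
    using il(3,4) J_xor[OF il(3)] J_xor[OF il(4)] unfolding J_def by blast+
  have \<gamma>': "\<And>l. l < k \<Longrightarrow> \<gamma> l \<in> {1, - 1}" using \<gamma> by simp
  have neq: "i \<noteq> xor l x" "xor i x \<noteq> xor l x" using il(1,2) by (metis nat_xor_cancel(2))+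
  have pm: "{a, b, c, d} \<subseteq> plus_minus (cd_basis' k)"
    unfolding a b c d insert_subset plus_minus_basis_iff using J \<alpha> by blast
  have mult: "cd_mult \<gamma> k a b \<in> {cd_e x, - cd_e x}" "cd_mult \<gamma> k c d \<in> {cd_e x, - cd_e x}"
    unfolding a b c d using cd_mult_pm_iff \<gamma>' J \<alpha> by blast+
  have "lin_indep (map (\<lambda>(i, \<sigma>). \<sigma> *\<^sub>R cd_e i) [(i, \<alpha>), (xor i x, \<beta>), (l, \<delta>), (xor l x, \<epsilon>), (x, 1)])"
  proof (rule lin_indep_basis)
    show "distinct (map fst [(i, \<alpha>), (xor i x, \<beta>), (l, \<delta>), (xor l x, \<epsilon>), (x, 1)])"
      using il(1,2) J(3,6,9,12) neq xor_neq[OF il(3)] xor_neq[OF il(4)] by simp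
    have "\<alpha> \<noteq> 0" "\<beta> \<noteq> 0" "\<delta> \<noteq> 0" "\<epsilon> \<noteq> 0" using \<alpha> by auto
    then show "\<forall>(i, \<sigma>)\<in>set [(i, \<alpha>), (xor i x, \<beta>), (l, \<delta>), (xor l x, \<epsilon>), (x, 1)]. \<sigma> \<noteq> 0"
      by simp
  qed
  then have indep: "lin_indep [a, b, c, d, cd_e x]" by (simp add: a b c d)
  show "(a, b, c, d) \<in> x_quads \<gamma> (Suc k) (cd_e x)"
    unfolding x_quads_def using pm mult indep by simp
qed

lemma rep_lin_indep: "rep a b i s \<Longrightarrow> lin_indep [a, b, cd_e x]"
proof -
  assume "rep a b i s"
  then obtain \<alpha> \<beta> where i: "i \<in> J" and \<alpha>: "\<alpha> \<in> {1, - 1}" "\<beta> \<in> {1, - 1}"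
    and ab: "a = \<alpha> *\<^sub>R cd_e i" "b = \<beta> *\<^sub>R cd_e (xor i x)" unfolding rep_def by blast
  have "i \<noteq> x" "xor i x \<noteq> x" "i \<noteq> xor i x" using i J_xor[OF i] xor_neq[OF i] unfolding J_def by blast+
  then show ?thesis
    using lin_indep_basis[of "[(i, \<alpha>), (xor i x, \<beta>), (x, 1)]"] \<alpha> by (auto simp: ab)
qed

text \<open>Orthogonality is insensitive to scaling, so both pairs are first brought to coefficient
  1 in the first entry.\<close>

lemma rep_orthogonal:
  assumes c: "c \<in> {1, - 1}" and ab: "rep a b i \<sigma>" and cd: "rep a' b' l \<tau>"
    and \<sigma>: "\<sigma> \<in> {1, - 1}" "\<tau> \<in> {1, - 1}"
  shows "cd_orthogonal (\<gamma>(k := c)) (Suc k) (cd_pair k a b) (cd_pair k a' b') \<longleftrightarrow>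
    cd_link (\<gamma>(k := c)) k i (xor i x) l (xor l x) (kap i * kap l * (\<sigma> * \<tau>))"
proof -
  have norm: "\<exists>r. r \<noteq> 0 \<and> cd_pair k a b = r *\<^sub>R cd_pair k (cd_e i) ((kap i * \<sigma>) *\<^sub>R cd_e (xor i x))"
    if ab: "rep a b i \<sigma>" for a b i \<sigma>
  proof -
    obtain \<alpha> \<beta> where \<alpha>: "\<alpha> \<in> {1, - 1}" "\<alpha> * \<beta> = kap i * \<sigma>" "\<beta> \<in> {1, - 1}"
      and ab: "a = \<alpha> *\<^sub>R cd_e i" "b = \<beta> *\<^sub>R cd_e (xor i x)" using ab unfolding rep_def by blast
    have "\<alpha> * (kap i * \<sigma>) = \<beta>" unfolding \<alpha>(2)[symmetric] using \<alpha>(1) by auto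
    then have "cd_pair k a b = \<alpha> *\<^sub>R cd_pair k (cd_e i) ((kap i * \<sigma>) *\<^sub>R cd_e (xor i x))"
      unfolding ab cd_pair_scaleR[symmetric] by simp
    then show ?thesis using \<alpha>(1) by (intro exI[of _ \<alpha>]) auto
  qed
  obtain r where r: "r \<noteq> 0" "cd_pair k a b = r *\<^sub>R cd_pair k (cd_e i) ((kap i * \<sigma>) *\<^sub>R cd_e (xor i x))"
    using norm[OF ab] by blast
  obtain s where s: "s \<noteq> 0" "cd_pair k a' b' = s *\<^sub>R cd_pair k (cd_e l) ((kap l * \<tau>) *\<^sub>R cd_e (xor l x))"
    using norm[OF cd] by blast
  have il: "i \<in> J" "l \<in> J" using ab cd by (simp_all add: rep_def)
  have J: "i < 2 ^ k" "i \<noteq> 0" "xor i x < 2 ^ k" "l < 2 ^ k" "l \<noteq> 0" "xor l x < 2 ^ k"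
    using il J_xor[OF il(1)] J_xor[OF il(2)] unfolding J_def by blast+
  have \<gamma>': "(\<gamma>(k := c)) m \<in> {1, - 1}" if "m \<le> k" for m using c \<gamma>[of m] that by simp
  have "cd_orthogonal (\<gamma>(k := c)) (Suc k) (cd_pair k a b) (cd_pair k a' b') \<longleftrightarrow>
    cd_orthogonal (\<gamma>(k := c)) (Suc k) (cd_pair k (cd_e i) ((kap i * \<sigma>) *\<^sub>R cd_e (xor i x)))
      (cd_pair k (cd_e l) ((kap l * \<tau>) *\<^sub>R cd_e (xor l x)))"
    unfolding r(2) s(2) cd_orthogonal_def cd_mult_scaleR using r(1) s(1) by (simp del: cd_mult.simps)
  also have "\<dots> \<longleftrightarrow> cd_link (\<gamma>(k := c)) k i (xor i x) l (xor l x) ((kap i * \<sigma>) * (kap l * \<tau>))"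
    by (intro cd_orthogonal_pair_iff \<gamma>' J sign_mult kap_sign \<sigma>) simp_all
  also have "(kap i * \<sigma>) * (kap l * \<tau>) = kap i * kap l * (\<sigma> * \<tau>)" by simp
  finally show ?thesis .
qed

abbreviation "G1 \<equiv> cd_C \<gamma> (Suc k) (cd_e x)"
abbreviation "G2 \<equiv> cd_C \<gamma> (Suc k) (cd_e (2 ^ k + x))"
abbreviation "P \<equiv> x_pairs \<gamma> (Suc k) (cd_e x)"
abbreviation "R \<equiv> x_quads \<gamma> (Suc k) (cd_e x)"
abbreviation "Q1 \<equiv> \<lambda>a b. {L a b, L b (g *\<^sub>R a), L (t a) (t b), L (t b) (g *\<^sub>R t a)}"
abbreviation "Q2 \<equiv> \<lambda>a b. {L a (t b), L (t b) (g *\<^sub>R a), L (t a) (h *\<^sub>R b), L b ((h * g) *\<^sub>R t a)}"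
abbreviation "O1 \<equiv> \<lambda>a b c d. cd_orthogonal (\<gamma>(k := g)) (Suc k) (cd_pair k a b) (cd_pair k c d)"
abbreviation "O2 \<equiv> \<lambda>a b c d. cd_orthogonal (\<gamma>(k := h * g)) (Suc k) (cd_pair k a b) (cd_pair k c d)"

lemma rep_J: "rep a b i s \<Longrightarrow> i \<in> J"
  by (simp add: rep_def)

lemma gh_sign: "g \<in> {1, - 1}" "h * g \<in> {1, - 1}"
  by (intro sign_mult \<gamma>; simp)+

lemma O_iff:
  assumes "rep a b i \<sigma>" "rep c d l \<tau>" "\<sigma> \<in> {1, - 1}" "\<tau> \<in> {1, - 1}"
  shows "O1 a b c d \<longleftrightarrow> orth1 i l (\<sigma> * \<tau>)" "O2 a b c d \<longleftrightarrow> orth2 i l (\<sigma> * \<tau>)"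
  unfolding orth1_def orth2_def
  by (rule rep_orthogonal[OF gh_sign(1) assms] rep_orthogonal[OF gh_sign(2) assms])+

lemma quads_to_rep:
  assumes "(a, b, c, d) \<in> R"
  obtains i l \<sigma> \<tau> where "i \<in> J" "l \<in> J" "l \<noteq> i" "l \<noteq> xor i x" "\<sigma> \<in> {1, - 1}" "\<tau> \<in> {1, - 1}"
    "rep a b i \<sigma>" "rep c d l \<tau>"
  using assms unfolding x_quads_iff using rep_J by blast

lemma rep_to_quads:
  assumes "i \<in> J" "l \<in> J" "l \<noteq> i" "l \<noteq> xor i x" "\<sigma> \<in> {1, - 1}" "\<tau> \<in> {1, - 1}"
  obtains a b c d where "(a, b, c, d) \<in> R" "rep a b i \<sigma>" "rep c d l \<tau>"
proof -
  obtain a b where ab: "rep a b i \<sigma>" using rep_ex[OF assms(1,5)] by blast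
  obtain c d where cd: "rep c d l \<tau>" using rep_ex[OF assms(2,6)] by blast
  have "(a, b, c, d) \<in> R" unfolding x_quads_iff using assms ab cd by blast
  then show ?thesis using that ab cd by blast
qed

text \<open>Independent of the table \<open>T\<close> and of \<open>M\<close>, so one argument
  covers both characteristics and, by the choice of \<open>Q\<close> and \<open>Or\<close>, both
  subgraphs.\<close>

lemma outer:
  assumes "block_graph G J (\<lambda>i. xor i x) w M T orth"
    and quad: "\<And>a b i s. rep a b i s \<Longrightarrow> Q a b = block_graph.quad w i s"
    and Or: "\<And>a b c d i l \<sigma> \<tau>. rep a b i \<sigma> \<Longrightarrow> rep c d l \<tau> \<Longrightarrow> \<sigma> \<in> {1, - 1} \<Longrightarrow> \<tau> \<in> {1, - 1} \<Longrightarrow>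
      Or a b c d \<longleftrightarrow> orth i l (\<sigma> * \<tau>)"
  shows "(\<Union>(a, b, c, d)\<in>{(a, b, c, d). (a, b, c, d) \<in> R \<and> Or a b c d}. join_edges (Q a b) (Q c d)) =
      block_graph.outer_edges J (\<lambda>i. xor i x) w orth"
    and "(a, b, c, d) \<in> R \<Longrightarrow> if Or a b c d then join_edges (Q a b) (Q c d) \<subseteq> gedges G
      else join_edges (Q a b) (Q c d) \<inter> gedges G = {}"
proof -
  interpret block_graph G J "\<lambda>i. xor i x" w M T orth by (fact assms)
  have A: "\<exists>i l \<sigma> \<tau>. i \<in> J \<and> l \<in> J \<and> l \<noteq> i \<and> l \<noteq> xor i x \<and> \<sigma> \<in> {1, - 1} \<and> \<tau> \<in> {1, - 1} \<and>
      Q a b = quad i \<sigma> \<and> Q c d = quad l \<tau> \<and> (Or a b c d \<longleftrightarrow> orth i l (\<sigma> * \<tau>))"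
    if R: "(a, b, c, d) \<in> R" for a b c d
  proof -
    obtain i l \<sigma> \<tau> where *: "i \<in> J" "l \<in> J" "l \<noteq> i" "l \<noteq> xor i x" "\<sigma> \<in> {1, - 1}" "\<tau> \<in> {1, - 1}"
      and r: "rep a b i \<sigma>" "rep c d l \<tau>" using quads_to_rep[OF R] .
    show ?thesis
      by (rule exI[of _ i], rule exI[of _ l], rule exI[of _ \<sigma>], rule exI[of _ \<tau>])
        (intro conjI * quad r Or)
  qed
  have B: "\<exists>a b c d. (a, b, c, d) \<in> R \<and> Q a b = quad i \<sigma> \<and> Q c d = quad l \<tau> \<and> (Or a b c d \<longleftrightarrow> orth i l (\<sigma> * \<tau>))"
    if H: "i \<in> J" "l \<in> J" "l \<noteq> i" "l \<noteq> xor i x" "\<sigma> \<in> {1, - 1}" "\<tau> \<in> {1, - 1}" for i l \<sigma> \<tau>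
  proof -
    obtain a b c d where r: "(a, b, c, d) \<in> R" "rep a b i \<sigma>" "rep c d l \<tau>" using rep_to_quads[OF H] .
    show ?thesis
      by (rule exI[of _ a], rule exI[of _ b], rule exI[of _ c], rule exI[of _ d])
        (intro conjI r quad Or H)
  qed
  show "(\<Union>(a, b, c, d)\<in>{(a, b, c, d). (a, b, c, d) \<in> R \<and> Or a b c d}. join_edges (Q a b) (Q c d)) = outer_edges"
    by (rule outer_edges_eq(1)[OF A B])
  show "(a, b, c, d) \<in> R \<Longrightarrow> if Or a b c d then join_edges (Q a b) (Q c d) \<subseteq> gedges G
      else join_edges (Q a b) (Q c d) \<inter> gedges G = {}"
    by (rule outer_edges_eq(2)[OF A B])
qed

lemma quad1:
  assumes "block_graph G J p w1 M T orth" "rep a b i s"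
  shows "Q1 a b = block_graph.quad w1 i s"
  unfolding block_graph.quad_def[OF assms(1)] rep_lines[OF assms(2)] ..

lemma quad2:
  assumes "block_graph G J p w2 M T orth" "rep a b i s"
  shows "Q2 a b = block_graph.quad w2 i s"
  unfolding block_graph.quad_def[OF assms(1)] rep_lines[OF assms(2)] ..

abbreviation "D1 \<equiv> (\<lambda>a b.
   [{L (t (cd_e x)) te, L te (g *\<^sub>R t (cd_e x))},
    {L a b, L b (g *\<^sub>R a)},
    {L (t a) (t b), L (t b) (g *\<^sub>R t a)},
    {L (t (cd_e x)) (- te), L te (- (g *\<^sub>R t (cd_e x)))},
    {L a (- b), L b (- (g *\<^sub>R a))},
    {L (t a) (- t b), L (t b) (- (g *\<^sub>R t a))}])"
abbreviation "A1 \<equiv> (\<lambda>a b.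
   [L (cd_e x) (cd_e 0), L a b, L b (g *\<^sub>R a), L (cd_e x) (- cd_e 0), L a (- b), L b (- (g *\<^sub>R a))])"
abbreviation "B1 \<equiv> (\<lambda>a b.
   [L (cd_e x) (- cd_e 0), L (t a) (t b), L (t b) (g *\<^sub>R t a),
    L (cd_e x) (cd_e 0), L (t a) (- t b), L (t b) (- (g *\<^sub>R t a))])"
abbreviation "D2 \<equiv> (\<lambda>a b.
   [{L (cd_e x) te, L te (g *\<^sub>R cd_e x)},
    {L a (t b), L (t b) (g *\<^sub>R a)},
    {L (t a) (h *\<^sub>R b), L b ((h * g) *\<^sub>R t a)},
    {L (cd_e x) (- te), L te (- (g *\<^sub>R cd_e x))},
    {L a (- t b), L (t b) (- (g *\<^sub>R a))},
    {L (t a) (- (h *\<^sub>R b)), L b (- ((h * g) *\<^sub>R t a))}])"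
abbreviation "A2 \<equiv> (\<lambda>a b.
   [L (h *\<^sub>R t (cd_e x)) (cd_e 0), L a (t b), L (t b) (g *\<^sub>R a),
    L (h *\<^sub>R t (cd_e x)) (- cd_e 0), L a (- t b), L (t b) (- (g *\<^sub>R a))])"
abbreviation "B2 \<equiv> (\<lambda>a b.
   [L (h *\<^sub>R t (cd_e x)) (- cd_e 0), L (t a) (h *\<^sub>R b), L b ((h * g) *\<^sub>R t a),
    L (h *\<^sub>R t (cd_e x)) (cd_e 0), L (t a) (- (h *\<^sub>R b)), L b (- ((h * g) *\<^sub>R t a))])"
abbreviation "F1 \<equiv> (\<lambda>a b. {L a b, L a (- b)} \<union> {L b (g *\<^sub>R a), L b (- (g *\<^sub>R a))} \<union>
  {L (t a) (t b), L (t a) (- t b)} \<union> {L (t b) (g *\<^sub>R t a), L (t b) (- (g *\<^sub>R t a))})"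
abbreviation "F2 \<equiv> (\<lambda>a b. {L a (t b), L a (- t b)} \<union> {L (t b) (g *\<^sub>R a), L (t b) (- (g *\<^sub>R a))} \<union>
  {L (t a) (h *\<^sub>R b), L (t a) (- (h *\<^sub>R b))} \<union> {L b ((h * g) *\<^sub>R t a), L b (- ((h * g) *\<^sub>R t a))})"
abbreviation "S1 \<equiv> {L (t (cd_e x)) te, L (t (cd_e x)) (- te)} \<union> {L te (g *\<^sub>R t (cd_e x)), L te (- (g *\<^sub>R t (cd_e x)))}"
abbreviation "S2 \<equiv> {L (cd_e x) te, L (cd_e x) (- te)} \<union> {L te (g *\<^sub>R cd_e x), L te (- (g *\<^sub>R cd_e x))}"
abbreviation "H1 \<equiv> [L (cd_e x) (- cd_e 0), L (t (cd_e x)) te, L te (g *\<^sub>R t (cd_e x)),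
  L (cd_e x) (cd_e 0), L (t (cd_e x)) (- te), L te (- (g *\<^sub>R t (cd_e x)))]"
abbreviation "H2 \<equiv> [L (h *\<^sub>R t (cd_e x)) (- cd_e 0), L (cd_e x) te, L te (g *\<^sub>R cd_e x),
  L (h *\<^sub>R t (cd_e x)) (cd_e 0), L (cd_e x) (- te), L te (- (g *\<^sub>R cd_e x))]"
abbreviation "outer_joins Or Q \<equiv>
  (\<Union>(a, b, c, d)\<in>{(a, b, c, d). (a, b, c, d) \<in> R \<and> Or a b c d}. join_edges (Q a b) (Q c d))"

lemma tilde_x: "cd_e (2 ^ k + x) = t (cd_e x)"
  using x by (simp add: tilde_e)

lemma pairs_to_rep: "(a, b) \<in> P \<Longrightarrow> \<exists>i\<in>J. rep a b i 1"
  unfolding x_pairs_iff using rep_J by blast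

lemma rep_to_pairs: "i \<in> J \<Longrightarrow> \<exists>a b. (a, b) \<in> P \<and> rep a b i 1"
  unfolding x_pairs_iff using rep_ex[of i 1] by blast

lemma F_eq:
  assumes "rep a b i 1"
  shows "block_graph G J p w1 M T orth \<Longrightarrow> F1 a b = block_graph.quad w1 i 1 \<union> block_graph.quad w1 i (- 1)"
    and "block_graph G J p w2 M T orth \<Longrightarrow> F2 a b = block_graph.quad w2 i 1 \<union> block_graph.quad w2 i (- 1)"
  unfolding rep_lines[OF assms] by (auto simp: block_graph.quad_def)

section \<open>The four cases and the remaining edges\<close>

lemma part1:
  assumes "cd_chi \<gamma> (Suc k) (cd_e x) = - 1"
  shows "gverts G1 = S1 \<union> (\<Union>(a, b)\<in>P. F1 a b) \<and>
    (\<forall>(a, b)\<in>P. is_double_hexagon G1 (D1 a b)) \<and>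
    gedges G1 = (\<Union>(a, b)\<in>P. cyclic_join_edges (D1 a b)) \<union> outer_joins O1 Q1"
proof -
  interpret double_hexagons G1 J "\<lambda>i. xor i x" w1 orth1 by (rule double_hexagons1[OF assms])
  have rep: "D1 a b = double_hexagon i \<and> F1 a b = quad i 1 \<union> quad i (- 1)" if "rep a b i 1" for a b i
    unfolding double_hexagon_def special_lines[OF rep_J[OF that]] F_eq(1)[OF that block_graph_axioms]
    by (simp only: rep_lines[OF that])
  obtain i0 where i0: "i0 \<in> J" using nonempty by blast
  show ?thesis
  proof (rule description[where ?i0.0 = i0])
    show "\<exists>i\<in>J. D1 a b = double_hexagon i \<and> F1 a b = quad i 1 \<union> quad i (- 1)" if ab: "(a, b) \<in> P" for a b
    proof -
      obtain i where "i \<in> J" and r: "rep a b i 1" using pairs_to_rep[OF ab] by blast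
      then show ?thesis by (intro bexI[of _ i] rep[OF r])
    qed
    show "\<exists>a b. (a, b) \<in> P \<and> D1 a b = double_hexagon i \<and> F1 a b = quad i 1 \<union> quad i (- 1)" if i: "i \<in> J" for i
    proof -
      obtain a b where ab: "(a, b) \<in> P" and r: "rep a b i 1" using rep_to_pairs[OF i] by blast
      show ?thesis by (rule exI[of _ a], rule exI[of _ b]) (rule conjI[OF ab rep[OF r]])
    qed
    show "outer_joins O1 Q1 = outer_edges"
      by (rule outer(1)[OF block_graph_axioms quad1[OF block_graph_axioms] O_iff(1)])
    show "S1 = {w1 i0 0 1, w1 i0 0 (- 1), w1 i0 1 1, w1 i0 1 (- 1)}"
      unfolding special_lines[OF i0] by blast
  qed
qed

lemma part2:
  assumes "cd_chi \<gamma> (Suc k) (cd_e x) = 1"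
  shows "gverts G1 = {L (cd_e x) (cd_e 0), L (cd_e x) (- cd_e 0)} \<union> (S1 \<union> (\<Union>(a, b)\<in>P. F1 a b)) \<and>
    (\<forall>(a, b)\<in>P. is_hexagon G1 (A1 a b) \<and> is_hexagon G1 (B1 a b) \<and>
      gedges (induced G1 (set (A1 a b) \<union> set (B1 a b))) = cycle_edges (A1 a b) \<union> cycle_edges (B1 a b)) \<and>
    is_hexagon G1 H1 \<and>
    (\<forall>E\<in>gedges G1. E \<inter> S1 \<noteq> {} \<longrightarrow> E \<in> cycle_edges H1) \<and>
    gedges G1 = (\<Union>(a, b)\<in>P. cycle_edges (A1 a b) \<union> cycle_edges (B1 a b)) \<union> cycle_edges H1 \<union>
      outer_joins O1 Q1"
proof -
  interpret hexagons G1 J "\<lambda>i. xor i x" w1 orth1 by (rule hexagons1[OF assms])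
  have rep: "A1 a b = hexagon1 i \<and> B1 a b = hexagon2 i \<and> F1 a b = quad i 1 \<union> quad i (- 1)" if "rep a b i 1" for a b i
    unfolding hexagon1_def hexagon2_def special_lines[OF rep_J[OF that]] F_eq(1)[OF that block_graph_axioms]
    by (simp only: rep_lines[OF that])
  obtain i0 where i0: "i0 \<in> J" using nonempty by blast
  show ?thesis
  proof (rule description[where ?i0.0 = i0])
    show "\<exists>i\<in>J. A1 a b = hexagon1 i \<and> B1 a b = hexagon2 i \<and> F1 a b = quad i 1 \<union> quad i (- 1)" if ab: "(a, b) \<in> P" for a b
    proof -
      obtain i where "i \<in> J" and r: "rep a b i 1" using pairs_to_rep[OF ab] by blast
      then show ?thesis by (intro bexI[of _ i] rep[OF r])
    qed
    show "\<exists>a b. (a, b) \<in> P \<and> A1 a b = hexagon1 i \<and> B1 a b = hexagon2 i \<and> F1 a b = quad i 1 \<union> quad i (- 1)" if i: "i \<in> J" for i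
    proof -
      obtain a b where ab: "(a, b) \<in> P" and r: "rep a b i 1" using rep_to_pairs[OF i] by blast
      show ?thesis by (rule exI[of _ a], rule exI[of _ b]) (rule conjI[OF ab rep[OF r]])
    qed
    show "outer_joins O1 Q1 = outer_edges"
      by (rule outer(1)[OF block_graph_axioms quad1[OF block_graph_axioms] O_iff(1)])
    show "S1 = {w1 i0 0 1, w1 i0 0 (- 1), w1 i0 1 1, w1 i0 1 (- 1)}"
      unfolding special_lines[OF i0] by blast
    show "{L (cd_e x) (cd_e 0), L (cd_e x) (- cd_e 0)} = {w1 i0 6 1, w1 i0 6 (- 1)}"
      unfolding special_lines[OF i0] ..
    show "H1 = hexagon0 i0"
      unfolding special_lines[OF i0] hexagon0_def ..
  qed (fact i0)
qed

lemma part3: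
  assumes "cd_chi \<gamma> (Suc k) (cd_e (2 ^ k + x)) = - 1"
  shows "gverts G2 = S2 \<union> (\<Union>(a, b)\<in>P. F2 a b) \<and>
    (\<forall>(a, b)\<in>P. is_double_hexagon G2 (D2 a b)) \<and>
    gedges G2 = (\<Union>(a, b)\<in>P. cyclic_join_edges (D2 a b)) \<union> outer_joins O2 Q2"
proof -
  interpret double_hexagons G2 J "\<lambda>i. xor i x" w2 orth2 by (rule double_hexagons2[OF assms])
  have rep: "D2 a b = double_hexagon i \<and> F2 a b = quad i 1 \<union> quad i (- 1)" if "rep a b i 1" for a b i
    unfolding double_hexagon_def special_lines[OF rep_J[OF that]] F_eq(2)[OF that block_graph_axioms]
    by (simp only: rep_lines[OF that])
  obtain i0 where i0: "i0 \<in> J" using nonempty by blast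
  show ?thesis
  proof (rule description[where ?i0.0 = i0])
    show "\<exists>i\<in>J. D2 a b = double_hexagon i \<and> F2 a b = quad i 1 \<union> quad i (- 1)" if ab: "(a, b) \<in> P" for a b
    proof -
      obtain i where "i \<in> J" and r: "rep a b i 1" using pairs_to_rep[OF ab] by blast
      then show ?thesis by (intro bexI[of _ i] rep[OF r])
    qed
    show "\<exists>a b. (a, b) \<in> P \<and> D2 a b = double_hexagon i \<and> F2 a b = quad i 1 \<union> quad i (- 1)" if i: "i \<in> J" for i
    proof -
      obtain a b where ab: "(a, b) \<in> P" and r: "rep a b i 1" using rep_to_pairs[OF i] by blast
      show ?thesis by (rule exI[of _ a], rule exI[of _ b]) (rule conjI[OF ab rep[OF r]])
    qed
    show "outer_joins O2 Q2 = outer_edges"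
      by (rule outer(1)[OF block_graph_axioms quad2[OF block_graph_axioms] O_iff(2)])
    show "S2 = {w2 i0 0 1, w2 i0 0 (- 1), w2 i0 1 1, w2 i0 1 (- 1)}"
      unfolding special_lines[OF i0] by blast
  qed
qed

lemma part4:
  assumes "cd_chi \<gamma> (Suc k) (cd_e (2 ^ k + x)) = 1"
  shows "gverts G2 = {L (h *\<^sub>R t (cd_e x)) (cd_e 0), L (h *\<^sub>R t (cd_e x)) (- cd_e 0)} \<union> (S2 \<union> (\<Union>(a, b)\<in>P. F2 a b)) \<and>
    (\<forall>(a, b)\<in>P. is_hexagon G2 (A2 a b) \<and> is_hexagon G2 (B2 a b) \<and>
      gedges (induced G2 (set (A2 a b) \<union> set (B2 a b))) = cycle_edges (A2 a b) \<union> cycle_edges (B2 a b)) \<and>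
    is_hexagon G2 H2 \<and>
    (\<forall>E\<in>gedges G2. E \<inter> S2 \<noteq> {} \<longrightarrow> E \<in> cycle_edges H2) \<and>
    gedges G2 = (\<Union>(a, b)\<in>P. cycle_edges (A2 a b) \<union> cycle_edges (B2 a b)) \<union> cycle_edges H2 \<union>
      outer_joins O2 Q2"
proof -
  interpret hexagons G2 J "\<lambda>i. xor i x" w2 orth2 by (rule hexagons2[OF assms])
  have rep: "A2 a b = hexagon1 i \<and> B2 a b = hexagon2 i \<and> F2 a b = quad i 1 \<union> quad i (- 1)" if "rep a b i 1" for a b i
    unfolding hexagon1_def hexagon2_def special_lines[OF rep_J[OF that]] F_eq(2)[OF that block_graph_axioms]
    by (simp only: rep_lines[OF that])
  obtain i0 where i0: "i0 \<in> J" using nonempty by blast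
  show ?thesis
  proof (rule description[where ?i0.0 = i0])
    show "\<exists>i\<in>J. A2 a b = hexagon1 i \<and> B2 a b = hexagon2 i \<and> F2 a b = quad i 1 \<union> quad i (- 1)" if ab: "(a, b) \<in> P" for a b
    proof -
      obtain i where "i \<in> J" and r: "rep a b i 1" using pairs_to_rep[OF ab] by blast
      then show ?thesis by (intro bexI[of _ i] rep[OF r])
    qed
    show "\<exists>a b. (a, b) \<in> P \<and> A2 a b = hexagon1 i \<and> B2 a b = hexagon2 i \<and> F2 a b = quad i 1 \<union> quad i (- 1)" if i: "i \<in> J" for i
    proof -
      obtain a b where ab: "(a, b) \<in> P" and r: "rep a b i 1" using rep_to_pairs[OF i] by blast
      show ?thesis by (rule exI[of _ a], rule exI[of _ b]) (rule conjI[OF ab rep[OF r]])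
    qed
    show "outer_joins O2 Q2 = outer_edges"
      by (rule outer(1)[OF block_graph_axioms quad2[OF block_graph_axioms] O_iff(2)])
    show "S2 = {w2 i0 0 1, w2 i0 0 (- 1), w2 i0 1 1, w2 i0 1 (- 1)}"
      unfolding special_lines[OF i0] by blast
    show "{L (h *\<^sub>R t (cd_e x)) (cd_e 0), L (h *\<^sub>R t (cd_e x)) (- cd_e 0)} = {w2 i0 6 1, w2 i0 6 (- 1)}"
      unfolding special_lines[OF i0] ..
    show "H2 = hexagon0 i0"
      unfolding special_lines[OF i0] hexagon0_def ..
  qed (fact i0)
qed

lemma chi_sign: "cd_chi \<gamma> (Suc k) (cd_e x) \<in> {1, - 1}" "cd_chi \<gamma> (Suc k) (cd_e (2 ^ k + x)) \<in> {1, - 1}"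
proof -
  have "\<gamma> (Suc k) * cd_sign \<gamma> k x x \<in> {1, - 1}" "h * g * cd_sign \<gamma> k x x \<in> {1, - 1}"
    by (intro sign_mult gh_sign sgn_k)+
  then show "cd_chi \<gamma> (Suc k) (cd_e x) \<in> {1, - 1}" "cd_chi \<gamma> (Suc k) (cd_e (2 ^ k + x)) \<in> {1, - 1}"
    unfolding chi1 chi2 by auto
qed

text \<open>The characteristic influences only the table inside a block. Whichever value it has,
  some block graph with the same vertices \<open>w1\<close> or \<open>w2\<close> and the same
  orthogonality condition is available.\<close>

lemma remaining_edges:
  assumes R: "(a, b, c, d) \<in> R"
  shows "if O1 a b c d then join_edges (Q1 a b) (Q1 c d) \<subseteq> gedges G1 else join_edges (Q1 a b) (Q1 c d) \<inter> gedges G1 = {}"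
    and "if O2 a b c d then join_edges (Q2 a b) (Q2 c d) \<subseteq> gedges G2 else join_edges (Q2 a b) (Q2 c d) \<inter> gedges G2 = {}"
proof -
  have "\<exists>M T. block_graph G1 J (\<lambda>i. xor i x) w1 M T orth1"
    using chi_sign(1) double_hexagons1 hexagons1 unfolding double_hexagons_def hexagons_def by blast
  then show "if O1 a b c d then join_edges (Q1 a b) (Q1 c d) \<subseteq> gedges G1 else join_edges (Q1 a b) (Q1 c d) \<inter> gedges G1 = {}"
  proof (elim exE)
    fix M T assume *: "block_graph G1 J (\<lambda>i. xor i x) w1 M T orth1"
    show "if O1 a b c d then join_edges (Q1 a b) (Q1 c d) \<subseteq> gedges G1 else join_edges (Q1 a b) (Q1 c d) \<inter> gedges G1 = {}"
      by (rule outer(2)[OF * quad1[OF *] O_iff(1) R])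
  qed
  have "\<exists>M T. block_graph G2 J (\<lambda>i. xor i x) w2 M T orth2"
    using chi_sign(2) double_hexagons2 hexagons2 unfolding double_hexagons_def hexagons_def by blast
  then show "if O2 a b c d then join_edges (Q2 a b) (Q2 c d) \<subseteq> gedges G2 else join_edges (Q2 a b) (Q2 c d) \<inter> gedges G2 = {}"
  proof (elim exE)
    fix M T assume *: "block_graph G2 J (\<lambda>i. xor i x) w2 M T orth2"
    show "if O2 a b c d then join_edges (Q2 a b) (Q2 c d) \<subseteq> gedges G2 else join_edges (Q2 a b) (Q2 c d) \<inter> gedges G2 = {}"
      by (rule outer(2)[OF * quad2[OF *] O_iff(2) R])
  qed
qed

end

theorem theorem4p6:
  fixes \<gamma> :: "nat \<Rightarrow> real" and n :: nat and x :: cd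
  assumes "n \<ge> 3"
    and "\<forall>k\<le>n. \<gamma> k \<in> {1, - 1}"
    and "x \<in> cd_basis' (n - 1)"
  shows
    "let g = \<gamma> n; h = \<gamma> (n - 1);
         e = cd_e 0; te = cd_te n; t = cd_tilde \<gamma> n;
         L = cd_line n;
         pm = (\<lambda>a b. {L a b, L a (- b)});
         P = x_pairs \<gamma> n x;
         R = x_quads \<gamma> n x;
         \<comment> \<open>the subgraph for \<open>x\<close>\<close>
         G = cd_C \<gamma> n x;
         V\<^sub>1 = pm (t x) te \<union> pm te (g *\<^sub>R t x) \<union>
           (\<Union>(a, b)\<in>P. pm a b \<union> pm b (g *\<^sub>R a) \<union> pm (t a) (t b) \<union> pm (t b) (g *\<^sub>R t a));
         D\<^sub>1 = (\<lambda>a b.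
           [{L (t x) te, L te (g *\<^sub>R t x)},
            {L a b, L b (g *\<^sub>R a)},
            {L (t a) (t b), L (t b) (g *\<^sub>R t a)},
            {L (t x) (- te), L te (- (g *\<^sub>R t x))},
            {L a (- b), L b (- (g *\<^sub>R a))},
            {L (t a) (- t b), L (t b) (- (g *\<^sub>R t a))}]);
         A\<^sub>1 = (\<lambda>a b.
           [L x e, L a b, L b (g *\<^sub>R a), L x (- e), L a (- b), L b (- (g *\<^sub>R a))]);
         B\<^sub>1 = (\<lambda>a b.
           [L x (- e), L (t a) (t b), L (t b) (g *\<^sub>R t a),
            L x e, L (t a) (- t b), L (t b) (- (g *\<^sub>R t a))]);
         H\<^sub>1 = [L x (- e), L (t x) te, L te (g *\<^sub>R t x),
               L x e, L (t x) (- te), L te (- (g *\<^sub>R t x))];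
         Q\<^sub>1 = (\<lambda>a b. {L a b, L b (g *\<^sub>R a), L (t a) (t b), L (t b) (g *\<^sub>R t a)});
         orth\<^sub>1 = (\<lambda>a b c d. cd_orthogonal (\<gamma>(n - 1 := \<gamma> n)) n
           (cd_pair (n - 1) a b) (cd_pair (n - 1) c d));
         R\<^sub>1 = (\<Union>(a, b, c, d)\<in>{(a, b, c, d). (a, b, c, d) \<in> R \<and> orth\<^sub>1 a b c d}.
           join_edges (Q\<^sub>1 a b) (Q\<^sub>1 c d));
         \<comment> \<open>the subgraph for \<open>x\<close> tilde\<close>
         G' = cd_C \<gamma> n (t x);
         V\<^sub>2 = pm x te \<union> pm te (g *\<^sub>R x) \<union>
           (\<Union>(a, b)\<in>P. pm a (t b) \<union> pm (t b) (g *\<^sub>R a) \<union>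
             pm (t a) (h *\<^sub>R b) \<union> pm b ((h * g) *\<^sub>R t a));
         D\<^sub>2 = (\<lambda>a b.
           [{L x te, L te (g *\<^sub>R x)},
            {L a (t b), L (t b) (g *\<^sub>R a)},
            {L (t a) (h *\<^sub>R b), L b ((h * g) *\<^sub>R t a)},
            {L x (- te), L te (- (g *\<^sub>R x))},
            {L a (- t b), L (t b) (- (g *\<^sub>R a))},
            {L (t a) (- (h *\<^sub>R b)), L b (- ((h * g) *\<^sub>R t a))}]);
         A\<^sub>2 = (\<lambda>a b.
           [L (h *\<^sub>R t x) e, L a (t b), L (t b) (g *\<^sub>R a),
            L (h *\<^sub>R t x) (- e), L a (- t b), L (t b) (- (g *\<^sub>R a))]);
         B\<^sub>2 = (\<lambda>a b.
           [L (h *\<^sub>R t x) (- e), L (t a) (h *\<^sub>R b), L b ((h * g) *\<^sub>R t a),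
            L (h *\<^sub>R t x) e, L (t a) (- (h *\<^sub>R b)), L b (- ((h * g) *\<^sub>R t a))]);
         H\<^sub>2 = [L (h *\<^sub>R t x) (- e), L x te, L te (g *\<^sub>R x),
               L (h *\<^sub>R t x) e, L x (- te), L te (- (g *\<^sub>R x))];
         Q\<^sub>2 = (\<lambda>a b. {L a (t b), L (t b) (g *\<^sub>R a), L (t a) (h *\<^sub>R b), L b ((h * g) *\<^sub>R t a)});
         orth\<^sub>2 = (\<lambda>a b c d. cd_orthogonal (\<gamma>(n - 1 := \<gamma> (n - 1) * \<gamma> n)) n
           (cd_pair (n - 1) a b) (cd_pair (n - 1) c d));
         R\<^sub>2 = (\<Union>(a, b, c, d)\<in>{(a, b, c, d). (a, b, c, d) \<in> R \<and> orth\<^sub>2 a b c d}.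
           join_edges (Q\<^sub>2 a b) (Q\<^sub>2 c d))
     in
       (\<forall>(a, b)\<in>P. lin_indep [a, b, x]) \<and>
       \<comment> \<open>(1)\<close>
       (cd_chi \<gamma> n x = - 1 \<longrightarrow>
          gverts G = V\<^sub>1 \<and>
          (\<forall>(a, b)\<in>P. is_double_hexagon G (D\<^sub>1 a b)) \<and>
          gedges G = (\<Union>(a, b)\<in>P. cyclic_join_edges (D\<^sub>1 a b)) \<union> R\<^sub>1) \<and>
       \<comment> \<open>(2)\<close>
       (cd_chi \<gamma> n x = 1 \<longrightarrow>
          gverts G = pm x e \<union> V\<^sub>1 \<and>
          (\<forall>(a, b)\<in>P. is_hexagon G (A\<^sub>1 a b) \<and> is_hexagon G (B\<^sub>1 a b) \<and>
             gedges (induced G (set (A\<^sub>1 a b) \<union> set (B\<^sub>1 a b))) =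
               cycle_edges (A\<^sub>1 a b) \<union> cycle_edges (B\<^sub>1 a b)) \<and>
          is_hexagon G H\<^sub>1 \<and>
          (\<forall>E\<in>gedges G. E \<inter> (pm (t x) te \<union> pm te (g *\<^sub>R t x)) \<noteq> {} \<longrightarrow> E \<in> cycle_edges H\<^sub>1) \<and>
          gedges G = (\<Union>(a, b)\<in>P. cycle_edges (A\<^sub>1 a b) \<union> cycle_edges (B\<^sub>1 a b)) \<union>
            cycle_edges H\<^sub>1 \<union> R\<^sub>1) \<and>
       \<comment> \<open>(3)\<close>
       (cd_chi \<gamma> n (t x) = - 1 \<longrightarrow>
          gverts G' = V\<^sub>2 \<and>
          (\<forall>(a, b)\<in>P. is_double_hexagon G' (D\<^sub>2 a b)) \<and>
          gedges G' = (\<Union>(a, b)\<in>P. cyclic_join_edges (D\<^sub>2 a b)) \<union> R\<^sub>2) \<and>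
       \<comment> \<open>(4)\<close>
       (cd_chi \<gamma> n (t x) = 1 \<longrightarrow>
          gverts G' = pm (h *\<^sub>R t x) e \<union> V\<^sub>2 \<and>
          (\<forall>(a, b)\<in>P. is_hexagon G' (A\<^sub>2 a b) \<and> is_hexagon G' (B\<^sub>2 a b) \<and>
             gedges (induced G' (set (A\<^sub>2 a b) \<union> set (B\<^sub>2 a b))) =
               cycle_edges (A\<^sub>2 a b) \<union> cycle_edges (B\<^sub>2 a b)) \<and>
          is_hexagon G' H\<^sub>2 \<and>
          (\<forall>E\<in>gedges G'. E \<inter> (pm x te \<union> pm te (g *\<^sub>R x)) \<noteq> {} \<longrightarrow> E \<in> cycle_edges H\<^sub>2) \<and>
          gedges G' = (\<Union>(a, b)\<in>P. cycle_edges (A\<^sub>2 a b) \<union> cycle_edges (B\<^sub>2 a b)) \<union>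
            cycle_edges H\<^sub>2 \<union> R\<^sub>2) \<and>
       \<comment> \<open>remaining edges\<close>
       (\<forall>(a, b, c, d)\<in>R.
          (if orth\<^sub>1 a b c d
           then join_edges (Q\<^sub>1 a b) (Q\<^sub>1 c d) \<subseteq> gedges G
           else join_edges (Q\<^sub>1 a b) (Q\<^sub>1 c d) \<inter> gedges G = {}) \<and>
          (if orth\<^sub>2 a b c d
           then join_edges (Q\<^sub>2 a b) (Q\<^sub>2 c d) \<subseteq> gedges G'
           else join_edges (Q\<^sub>2 a b) (Q\<^sub>2 c d) \<inter> gedges G' = {}))"
proof -
  define k where "k = n - 1"
  have n: "n = Suc k" and k2: "2 \<le> k" using assms(1) by (simp_all add: k_def)
  obtain r where r: "r < 2 ^ k" "r \<noteq> 0" and xr: "x = cd_e r"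
    using assms(3) unfolding cd_basis'_iff k_def by blast
  interpret cd_center \<gamma> k r
    using assms(2) k2 r by unfold_locales (simp_all add: n)
  have indep: "\<forall>(a, b)\<in>P. lin_indep [a, b, cd_e r]"
    using pairs_to_rep rep_lin_indep by blast
  have rest: "\<forall>(a, b, c, d)\<in>R.
      (if O1 a b c d then join_edges (Q1 a b) (Q1 c d) \<subseteq> gedges G1
       else join_edges (Q1 a b) (Q1 c d) \<inter> gedges G1 = {}) \<and>
      (if O2 a b c d then join_edges (Q2 a b) (Q2 c d) \<subseteq> gedges G2
       else join_edges (Q2 a b) (Q2 c d) \<inter> gedges G2 = {})"
    using remaining_edges by blast
  show ?thesis
    \<comment> \<open>After unfolding, the goal is the conjunction of the parts verbatim, once
      e_(2^k + r) has been written as the tilde of e_r.\<close>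
    unfolding Let_def n xr diff_Suc_1
    by (rule conjI[OF indep conjI[OF impI[OF part1] conjI[OF impI[OF part2]
      conjI[OF impI[OF part3[unfolded tilde_x]] conjI[OF impI[OF part4[unfolded tilde_x]]
      rest[unfolded tilde_x]]]]]])
qed

end
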